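(* Let $g$ be a positive integer. There is an equivalence of categories $$\mathrm{OF}^g_{\mathbb C}\cong\mathrm{MHS}^g_{\mathbb C}$$ between the category of $g$-orthogonal families of mixed $\mathbb C$-Hodge structures and the category of mixed $g$-plectic $\mathbb C$-Hodge structures.
   Context: All filtrations are finite filtrations by linear subspaces. A pure $\mathbb C$-Hodge structure of weight $n$ is a finite dimensional $\mathbb C$-vector space $V_{\mathbb C}$ with descending filtrations $F^\bullet,\overline F^\bullet$ such that $V_{\mathbb C}=F^pV_{\mathbb C}\oplus\overline F^{n+1-p}V_{\mathbb C}$ for all $p$. A mixed $\mathbb C$-Hodge structure is $(V_{\mathbb C},W_\bullet,F^\bullet,\overline F^\bullet)$ with $W_\bullet$ ascending, $F^\bullet,\overline F^\bullet$ descending, such that each $\mathrm{Gr}^W_nV_{\mathbb C}$ with induced filtrations is pure of weight $n$. $\mathrm{Fil}^l_m(\mathbb C)$ is the category of quadruples $(V_{\mathbb C},\{W^\lambda_\bullet\}_{\lambda=1}^l,\{F_\mu^\bullet\}_{\mu=1}^m,\{\overline F_\mu^\bullet\}_{\mu=1}^m)$ with $V_{\mathbb C}$ a finite dimensional $\mathbb C$-vector space, $W^\lambda_\bullet$ finite ascending and $F_\mu^\bullet,\overline F_\mu^\bullet$ finite descending filtrations; morphisms are $\mathbb C$-linear maps compatible with all filtrations. $\mathrm{OF}^g_{\mathbb C}\subset\mathrm{Fil}^g_g(\mathbb C)$ is the full subcategory of objects such that for any $\mu$, $(V_{\mathbb C},W^\mu_\bullet,F_\mu^\bullet,\overline F_\mu^\bullet)$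 is a mixed $\mathbb C$-Hodge structure, and for any $\nu\ne\mu$ and $n,m\in\mathbb Z$, the subspaces $W^\mu_nV_{\mathbb C},F^m_\mu V_{\mathbb C},\overline F^m_\mu V_{\mathbb C}$ with filtrations induced from $W^\nu_\bullet,F_\nu^\bullet,\overline F_\nu^\bullet$ are mixed $\mathbb C$-Hodge structures. For $\boldsymbol n\in\mathbb Z^g$ put $|\boldsymbol n|=n_1+\cdots+n_g$; $\boldsymbol r\ge\boldsymbol p$ means $r_\mu\ge p_\mu$ for all $\mu$. For $V=(V_{\mathbb C},W_\bullet,\{F_\mu^\bullet\},\{\overline F_\mu^\bullet\})$ in $\mathrm{Fil}^1_g(\mathbb C)$, $I\subset\{1,\dots,g\}$, $\boldsymbol p\in\mathbb Z^g$, $p\in\mathbb Z$, put $$\boldsymbol F_I^{\boldsymbol p}V_{\mathbb C}=\bigcap_{\mu\notin I}F_\mu^{p_\mu}V_{\mathbb C}\cap\bigcap_{\nu\in I}\overline F_\nu^{p_\nu}V_{\mathbb C},\quad \overline{\boldsymbol F}_I^{\boldsymbol p}V_{\mathbb C}=\bigcap_{\mu\notin I}\overline F_\mu^{p_\mu}V_{\mathbb C}\cap\bigcap_{\nu\in I}F_\nu^{p_\nu}V_{\mathbb C},$$ $$F_I^pV_{\mathbb C}=\sum_{|\boldsymbol p|=p}\boldsymbol F_I^{\boldsymbol p}V_{\mathbb C},\quad \overline F_I^pV_{\mathbb C}=\sum_{|\boldsymbol p|=p}\overline{\boldsymbol F}_I^{\boldsymbol p}V_{\mathbb C},$$ and $\boldsymbol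 F_I^{\boldsymbol p}\mathrm{Gr}^W_nV_{\mathbb C}:=(W_n\cap\boldsymbol F_I^{\boldsymbol p})V_{\mathbb C}/(W_{n-1}\cap\boldsymbol F_I^{\boldsymbol p})V_{\mathbb C}\subset \mathrm{Gr}^W_nV_{\mathbb C}$, similarly for $\overline{\boldsymbol F}_I$; $(\boldsymbol F_I^{\boldsymbol r}\cap\overline{\boldsymbol F}_I^{\boldsymbol s})\mathrm{Gr}^W_nV_{\mathbb C}$ is the intersection of the two subspaces of $\mathrm{Gr}^W_nV_{\mathbb C}$. $V$ is a mixed weak $g$-plectic $\mathbb C$-Hodge structure if for every $I\subset\{1,\dots,g\}$: (a$_I$) $\boldsymbol F_I^{\boldsymbol p}\mathrm{Gr}^W_nV_{\mathbb C}=\bigoplus_{\boldsymbol r\ge\boldsymbol p,\,|\boldsymbol r+\boldsymbol s|=n}(\boldsymbol F_I^{\boldsymbol r}\cap\overline{\boldsymbol F}_I^{\boldsymbol s})\mathrm{Gr}^W_nV_{\mathbb C}$ for all $n\in\mathbb Z$, $\boldsymbol p\in\mathbb Z^g$; (b$_I$) $(V_{\mathbb C},W_\bullet,F_I^\bullet,\overline F_I^\bullet)$ is a mixed $\mathbb C$-Hodge structure; (c$_I$) for all $\boldsymbol p,\boldsymbol q\in\mathbb Z^g$ and $n=|\boldsymbol p+\boldsymbol q|$, $$((\boldsymbol F_I^{\boldsymbol p}\cap W_n+\overline{\boldsymbol F}_I^{\boldsymbol q}\cap W_n)\cap W_{n-1})V_{\mathbb C}\subset(\boldsymbol F_I^{\boldsymbol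 p}\cap W_{n-1})V_{\mathbb C}+\sum_{\boldsymbol j\ge\boldsymbol 0}(\overline{\boldsymbol F}_I^{\boldsymbol q-\boldsymbol j}\cap W_{n-|\boldsymbol j|-1})V_{\mathbb C}.$$ For $n=|\boldsymbol p+\boldsymbol q|$ put $$\boldsymbol A_I^{\boldsymbol p,\boldsymbol q}(V)=(\boldsymbol F_I^{\boldsymbol p}\cap W_n)V_{\mathbb C}\cap\Bigl((\overline{\boldsymbol F}_I^{\boldsymbol q}\cap W_n)V_{\mathbb C}+\sum_{\boldsymbol j\ge\boldsymbol 0}(\overline{\boldsymbol F}_I^{\boldsymbol q-\boldsymbol j}\cap W_{n-|\boldsymbol j|-1})V_{\mathbb C}\Bigr)$$ and $W_n^{I,\mu}V_{\mathbb C}:=\sum_{p_\mu+q_\mu\le n}\boldsymbol A_I^{\boldsymbol p,\boldsymbol q}(V)$ (sum over $\boldsymbol p,\boldsymbol q\in\mathbb Z^g$). $\mathrm{MHS}^g_{\mathbb C}$ is the full subcategory of $\mathrm{Fil}^1_g(\mathbb C)$ of mixed weak $g$-plectic $\mathbb C$-Hodge structures $V$ such that $W_n^{I,\mu}V_{\mathbb C}=W_n^{J,\mu}V_{\mathbb C}$ for all $I,J\subset\{1,\dots,g\}$, $\mu=1,\dots,g$, $n\in\mathbb Z$. *)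

theory Defs
  imports "Jordan_Normal_Form.VS_Connect" "HOL-Algebra.AbelCoset"
begin

section \<open>Categories and equivalences\<close>

text \<open>
  Arrows of different hom-sets need not be distinct elements of the arrow type, so identities,
  composition and the action of a functor on arrows take the objects as arguments;
  \<open>Comp C X Y Z h f\<close> is the composite of \<open>f : X \<rightarrow> Y\<close> and \<open>h : Y \<rightarrow> Z\<close>.
\<close>

record ('o, 'a) category =
  Obj :: "'o set"
  Hom :: "'o \<Rightarrow> 'o \<Rightarrow> 'a set"
  Id :: "'o \<Rightarrow> 'a"
  Comp :: "'o \<Rightarrow> 'o \<Rightarrow> 'o \<Rightarrow> 'a \<Rightarrow> 'a \<Rightarrow> 'a"

definition is_category :: "('o, 'a) category \<Rightarrow> bool" where
  "is_category C \<longleftrightarrow>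
     (\<forall>X\<in>Obj C. Id C X \<in> Hom C X X) \<and>
     (\<forall>X\<in>Obj C. \<forall>Y\<in>Obj C. \<forall>Z\<in>Obj C. \<forall>f\<in>Hom C X Y. \<forall>h\<in>Hom C Y Z.
        Comp C X Y Z h f \<in> Hom C X Z) \<and>
     (\<forall>X\<in>Obj C. \<forall>Y\<in>Obj C. \<forall>f\<in>Hom C X Y.
        Comp C X X Y f (Id C X) = f \<and> Comp C X Y Y (Id C Y) f = f) \<and>
     (\<forall>X\<in>Obj C. \<forall>Y\<in>Obj C. \<forall>Z\<in>Obj C. \<forall>T\<in>Obj C.
        \<forall>f\<in>Hom C X Y. \<forall>h\<in>Hom C Y Z. \<forall>k\<in>Hom C Z T.
        Comp C X Y T (Comp C Y Z T k h) f = Comp C X Z T k (Comp C X Y Z h f))"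

definition full_subcategory :: "('o, 'a) category \<Rightarrow> ('o \<Rightarrow> bool) \<Rightarrow> ('o, 'a) category" where
  "full_subcategory C P = C\<lparr>Obj := {X \<in> Obj C. P X}\<rparr>"

definition is_iso :: "('o, 'a) category \<Rightarrow> 'o \<Rightarrow> 'o \<Rightarrow> 'a \<Rightarrow> bool" where
  "is_iso C X Y f \<longleftrightarrow> f \<in> Hom C X Y \<and>
     (\<exists>h\<in>Hom C Y X. Comp C X Y X h f = Id C X \<and> Comp C Y X Y f h = Id C Y)"

record ('o, 'a, 'p, 'b) func =
  on_obj :: "'o \<Rightarrow> 'p"
  on_arr :: "'o \<Rightarrow> 'o \<Rightarrow> 'a \<Rightarrow> 'b"

definition is_functor ::
    "('o, 'a) category \<Rightarrow> ('p, 'b) category \<Rightarrow> ('o, 'a, 'p, 'b) func \<Rightarrow> bool" where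
  "is_functor C D \<Phi> \<longleftrightarrow>
     (\<forall>X\<in>Obj C. on_obj \<Phi> X \<in> Obj D) \<and>
     (\<forall>X\<in>Obj C. \<forall>Y\<in>Obj C. \<forall>f\<in>Hom C X Y.
        on_arr \<Phi> X Y f \<in> Hom D (on_obj \<Phi> X) (on_obj \<Phi> Y)) \<and>
     (\<forall>X\<in>Obj C. on_arr \<Phi> X X (Id C X) = Id D (on_obj \<Phi> X)) \<and>
     (\<forall>X\<in>Obj C. \<forall>Y\<in>Obj C. \<forall>Z\<in>Obj C. \<forall>f\<in>Hom C X Y. \<forall>h\<in>Hom C Y Z.
        on_arr \<Phi> X Z (Comp C X Y Z h f) =
        Comp D (on_obj \<Phi> X) (on_obj \<Phi> Y) (on_obj \<Phi> Z) (on_arr \<Phi> Y Z h) (on_arr \<Phi> X Y f))"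

definition id_func :: "('o, 'a, 'o, 'a) func" where
  "id_func = \<lparr>on_obj = (\<lambda>X. X), on_arr = (\<lambda>X Y f. f)\<rparr>"

definition comp_func ::
    "('p, 'b, 'q, 'c) func \<Rightarrow> ('o, 'a, 'p, 'b) func \<Rightarrow> ('o, 'a, 'q, 'c) func" where
  "comp_func \<Psi> \<Phi> =
     \<lparr>on_obj = (\<lambda>X. on_obj \<Psi> (on_obj \<Phi> X)),
      on_arr = (\<lambda>X Y f. on_arr \<Psi> (on_obj \<Phi> X) (on_obj \<Phi> Y) (on_arr \<Phi> X Y f))\<rparr>"

definition naturally_isomorphic ::
    "('o, 'a) category \<Rightarrow> ('p, 'b) category \<Rightarrow>
     ('o, 'a, 'p, 'b) func \<Rightarrow> ('o, 'a, 'p, 'b) func \<Rightarrow> bool" where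
  "naturally_isomorphic C D \<Phi> \<Psi> \<longleftrightarrow>
     (\<exists>\<eta>. (\<forall>X\<in>Obj C. is_iso D (on_obj \<Phi> X) (on_obj \<Psi> X) (\<eta> X)) \<and>
          (\<forall>X\<in>Obj C. \<forall>Y\<in>Obj C. \<forall>f\<in>Hom C X Y.
             Comp D (on_obj \<Phi> X) (on_obj \<Phi> Y) (on_obj \<Psi> Y) (\<eta> Y) (on_arr \<Phi> X Y f) =
             Comp D (on_obj \<Phi> X) (on_obj \<Psi> X) (on_obj \<Psi> Y) (on_arr \<Psi> X Y f) (\<eta> X)))"

definition equivalent_categories :: "('o, 'a) category \<Rightarrow> ('p, 'b) category \<Rightarrow> bool" where
  "equivalent_categories C D \<longleftrightarrow> is_category C \<and> is_category D \<and>
     (\<exists>\<Phi> \<Psi>. is_functor C D \<Phi> \<and> is_functor D C \<Psi> \<and>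
            naturally_isomorphic C C (comp_func \<Psi> \<Phi>) id_func \<and>
            naturally_isomorphic D D (comp_func \<Phi> \<Psi>) id_func)"


section \<open>Complex vector spaces, subspaces and filtrations\<close>

text \<open>
  A complex vector space is a module record over \<open>class_ring :: complex ring\<close>, with a carrier in an
  arbitrary type \<open>'v\<close>. The ring fields \<open>mult\<close> and \<open>one\<close> of the record carry no meaning.
\<close>

type_synonym 'v cspace = "(complex, 'v) module"

definition fd_cspace :: "'v cspace \<Rightarrow> bool" where
  "fd_cspace V \<longleftrightarrow> vectorspace class_ring V \<and> vectorspace.fin_dim class_ring V"

definition csubspace :: "'v cspace \<Rightarrow> 'v set \<Rightarrow> bool" where
  "csubspace V U \<longleftrightarrow> VectorSpace.subspace class_ring U V"

definition Sum_spaces :: "'v cspace \<Rightarrow> 'i set \<Rightarrow> ('i \<Rightarrow> 'v set) \<Rightarrow> 'v set" where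
  "Sum_spaces V A U = LinearCombinations.module.span class_ring V (\<Union>i\<in>A. U i)"

definition is_direct_sum :: "'v cspace \<Rightarrow> 'v set \<Rightarrow> 'i set \<Rightarrow> ('i \<Rightarrow> 'v set) \<Rightarrow> bool" where
  "is_direct_sum V T A U \<longleftrightarrow>
     T = Sum_spaces V A U \<and>
     (\<forall>i\<in>A. U i \<inter> Sum_spaces V (A - {i}) U = {\<zero>\<^bsub>V\<^esub>})"

definition quotient_space :: "'v cspace \<Rightarrow> 'v set \<Rightarrow> 'v set cspace" where
  "quotient_space V U =
     \<lparr>carrier = A_RCOSETS V U,
      mult = (\<lambda>_ _. U), one = U,
      zero = U,
      add = set_add V,
      smult = (\<lambda>c A. U <+>\<^bsub>V\<^esub> (smult V c ` A))\<rparr>"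

definition ascending_filtration :: "'v cspace \<Rightarrow> (int \<Rightarrow> 'v set) \<Rightarrow> bool" where
  "ascending_filtration V W \<longleftrightarrow>
     (\<forall>n. csubspace V (W n)) \<and> (\<forall>m n. m \<le> n \<longrightarrow> W m \<subseteq> W n) \<and>
     (\<exists>n. W n = {\<zero>\<^bsub>V\<^esub>}) \<and> (\<exists>n. W n = carrier V)"

definition descending_filtration :: "'v cspace \<Rightarrow> (int \<Rightarrow> 'v set) \<Rightarrow> bool" where
  "descending_filtration V F \<longleftrightarrow>
     (\<forall>p. csubspace V (F p)) \<and> (\<forall>p q. p \<le> q \<longrightarrow> F q \<subseteq> F p) \<and>
     (\<exists>p. F p = carrier V) \<and> (\<exists>p. F p = {\<zero>\<^bsub>V\<^esub>})"

definition Gr :: "'v cspace \<Rightarrow> (int \<Rightarrow> 'v set) \<Rightarrow> int \<Rightarrow> 'v set cspace" where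
  "Gr V W n = quotient_space (V\<lparr>carrier := W n\<rparr>) (W (n - 1))"

text \<open>
  The quotient of \<open>W n \<inter> U\<close> by \<open>W (n - 1) \<inter> U\<close> as a subspace of \<open>Gr V W n\<close>, that is, the image of
  \<open>W n \<inter> U\<close>.
\<close>

definition Gr_sub :: "'v cspace \<Rightarrow> (int \<Rightarrow> 'v set) \<Rightarrow> int \<Rightarrow> 'v set \<Rightarrow> 'v set set" where
  "Gr_sub V W n U = (\<lambda>x. W (n - 1) +>\<^bsub>V\<^esub> x) ` (W n \<inter> U)"


section \<open>Pure and mixed complex Hodge structures\<close>

definition pure_Hodge :: "int \<Rightarrow> 'v cspace \<Rightarrow> (int \<Rightarrow> 'v set) \<Rightarrow> (int \<Rightarrow> 'v set) \<Rightarrow> bool" where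
  "pure_Hodge n V F Fb \<longleftrightarrow>
     fd_cspace V \<and> descending_filtration V F \<and> descending_filtration V Fb \<and>
     (\<forall>p. carrier V = F p <+>\<^bsub>V\<^esub> Fb (n + 1 - p) \<and> F p \<inter> Fb (n + 1 - p) = {\<zero>\<^bsub>V\<^esub>})"

definition mixed_Hodge ::
    "'v cspace \<Rightarrow> (int \<Rightarrow> 'v set) \<Rightarrow> (int \<Rightarrow> 'v set) \<Rightarrow> (int \<Rightarrow> 'v set) \<Rightarrow> bool" where
  "mixed_Hodge V W F Fb \<longleftrightarrow>
     fd_cspace V \<and> ascending_filtration V W \<and>
     descending_filtration V F \<and> descending_filtration V Fb \<and>
     (\<forall>n. pure_Hodge n (Gr V W n) (\<lambda>p. Gr_sub V W n (F p)) (\<lambda>p. Gr_sub V W n (Fb p)))"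

definition mixed_Hodge_on ::
    "'v cspace \<Rightarrow> 'v set \<Rightarrow> (int \<Rightarrow> 'v set) \<Rightarrow> (int \<Rightarrow> 'v set) \<Rightarrow> (int \<Rightarrow> 'v set) \<Rightarrow> bool" where
  "mixed_Hodge_on V U W F Fb \<longleftrightarrow>
     mixed_Hodge (V\<lparr>carrier := U\<rparr>) (\<lambda>n. U \<inter> W n) (\<lambda>p. U \<inter> F p) (\<lambda>p. U \<inter> Fb p)"


section \<open>Multiply filtered spaces\<close>

text \<open>
  The indices \<open>\<lambda> = 1, \<dots>, l\<close> and \<open>\<mu> = 1, \<dots>, m\<close> of the filtrations range over finite types \<open>'l\<close> and
  \<open>'m\<close> with \<open>l\<close> and \<open>m\<close> elements. So a positive integer \<open>g\<close> is represented by a finite type \<open>'g\<close>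
  with \<open>CARD('g) = g\<close>, a \<open>g\<close>-tuple of integers by a function \<open>'g \<Rightarrow> int\<close>, and the single weight
  filtration of an object with \<open>l = 1\<close> is indexed by \<open>unit\<close>.
\<close>

record ('v, 'l, 'm) filtered_space =
  space_of :: "'v cspace"
  W_of :: "'l \<Rightarrow> int \<Rightarrow> 'v set"
  F_of :: "'m \<Rightarrow> int \<Rightarrow> 'v set"
  Fb_of :: "'m \<Rightarrow> int \<Rightarrow> 'v set"

definition is_filtered_space :: "('v, 'l::finite, 'm::finite) filtered_space \<Rightarrow> bool" where
  "is_filtered_space X \<longleftrightarrow>
     fd_cspace (space_of X) \<and>
     (\<forall>i. ascending_filtration (space_of X) (W_of X i)) \<and>
     (\<forall>\<mu>. descending_filtration (space_of X) (F_of X \<mu>)) \<and>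
     (\<forall>\<mu>. descending_filtration (space_of X) (Fb_of X \<mu>))"

text \<open>A linear map is represented by its extensional function, undefined off the carrier.\<close>

definition filtered_maps ::
    "('v, 'l::finite, 'm::finite) filtered_space \<Rightarrow> ('v, 'l, 'm) filtered_space \<Rightarrow> ('v \<Rightarrow> 'v) set" where
  "filtered_maps X Y =
     {f \<in> extensional (carrier (space_of X)).
        linear_map class_ring (space_of X) (space_of Y) f \<and>
        (\<forall>i n. f ` W_of X i n \<subseteq> W_of Y i n) \<and>
        (\<forall>\<mu> p. f ` F_of X \<mu> p \<subseteq> F_of Y \<mu> p) \<and>
        (\<forall>\<mu> p. f ` Fb_of X \<mu> p \<subseteq> Fb_of Y \<mu> p)}"

definition Fil :: "(('v, 'l::finite, 'm::finite) filtered_space, 'v \<Rightarrow> 'v) category" where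
  "Fil = \<lparr>Obj = {X. is_filtered_space X},
          Hom = filtered_maps,
          Id = (\<lambda>X. \<lambda>x\<in>carrier (space_of X). x),
          Comp = (\<lambda>X Y Z h f. compose (carrier (space_of X)) h f)\<rparr>"


section \<open>Orthogonal families of mixed Hodge structures\<close>

definition orthogonal_family :: "('v, 'g::finite, 'g) filtered_space \<Rightarrow> bool" where
  "orthogonal_family X \<longleftrightarrow>
     (\<forall>\<mu>. mixed_Hodge (space_of X) (W_of X \<mu>) (F_of X \<mu>) (Fb_of X \<mu>)) \<and>
     (\<forall>\<mu> \<nu>. \<nu> \<noteq> \<mu> \<longrightarrow> (\<forall>n.
        mixed_Hodge_on (space_of X) (W_of X \<mu> n) (W_of X \<nu>) (F_of X \<nu>) (Fb_of X \<nu>) \<and>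
        mixed_Hodge_on (space_of X) (F_of X \<mu> n) (W_of X \<nu>) (F_of X \<nu>) (Fb_of X \<nu>) \<and>
        mixed_Hodge_on (space_of X) (Fb_of X \<mu> n) (W_of X \<nu>) (F_of X \<nu>) (Fb_of X \<nu>)))"

definition OF ::
    "'v itself \<Rightarrow> 'g::finite itself \<Rightarrow> (('v, 'g, 'g) filtered_space, 'v \<Rightarrow> 'v) category" where
  "OF _ _ = full_subcategory Fil orthogonal_family"


section \<open>Mixed plectic Hodge structures\<close>

definition tot :: "('g::finite \<Rightarrow> int) \<Rightarrow> int" where
  "tot n = (\<Sum>\<mu>\<in>UNIV. n \<mu>)"

abbreviation weight :: "('v, unit, 'g) filtered_space \<Rightarrow> int \<Rightarrow> 'v set" where
  "weight X \<equiv> W_of X ()"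

definition multi_F :: "('v, unit, 'g::finite) filtered_space \<Rightarrow> 'g set \<Rightarrow> ('g \<Rightarrow> int) \<Rightarrow> 'v set" where
  "multi_F X I p = (\<Inter>\<mu>\<in>-I. F_of X \<mu> (p \<mu>)) \<inter> (\<Inter>\<nu>\<in>I. Fb_of X \<nu> (p \<nu>))"

definition multi_Fb :: "('v, unit, 'g::finite) filtered_space \<Rightarrow> 'g set \<Rightarrow> ('g \<Rightarrow> int) \<Rightarrow> 'v set" where
  "multi_Fb X I p = (\<Inter>\<mu>\<in>-I. Fb_of X \<mu> (p \<mu>)) \<inter> (\<Inter>\<nu>\<in>I. F_of X \<nu> (p \<nu>))"

definition total_F :: "('v, unit, 'g::finite) filtered_space \<Rightarrow> 'g set \<Rightarrow> int \<Rightarrow> 'v set" where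
  "total_F X I k = Sum_spaces (space_of X) {p. tot p = k} (multi_F X I)"

definition total_Fb :: "('v, unit, 'g::finite) filtered_space \<Rightarrow> 'g set \<Rightarrow> int \<Rightarrow> 'v set" where
  "total_Fb X I k = Sum_spaces (space_of X) {p. tot p = k} (multi_Fb X I)"

text \<open>
  The sum over \<open>j \<ge> 0\<close> that occurs both in condition (c) and in the subspaces \<open>A_sub\<close>.
\<close>

definition lower_Fb ::
    "('v, unit, 'g::finite) filtered_space \<Rightarrow> 'g set \<Rightarrow> int \<Rightarrow> ('g \<Rightarrow> int) \<Rightarrow> 'v set" where
  "lower_Fb X I n q =
     Sum_spaces (space_of X) {j. \<forall>\<mu>. 0 \<le> j \<mu>}
       (\<lambda>j. multi_Fb X I (\<lambda>\<mu>. q \<mu> - j \<mu>) \<inter> weight X (n - tot j - 1))"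

definition plectic_a :: "('v, unit, 'g::finite) filtered_space \<Rightarrow> 'g set \<Rightarrow> bool" where
  "plectic_a X I \<longleftrightarrow>
     (\<forall>n p. is_direct_sum (Gr (space_of X) (weight X) n)
        (Gr_sub (space_of X) (weight X) n (multi_F X I p))
        {(r, s). (\<forall>\<mu>. p \<mu> \<le> r \<mu>) \<and> tot (\<lambda>\<mu>. r \<mu> + s \<mu>) = n}
        (\<lambda>(r, s). Gr_sub (space_of X) (weight X) n (multi_F X I r) \<inter>
                  Gr_sub (space_of X) (weight X) n (multi_Fb X I s)))"

definition plectic_b :: "('v, unit, 'g::finite) filtered_space \<Rightarrow> 'g set \<Rightarrow> bool" where
  "plectic_b X I \<longleftrightarrow> mixed_Hodge (space_of X) (weight X) (total_F X I) (total_Fb X I)"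

definition plectic_c :: "('v, unit, 'g::finite) filtered_space \<Rightarrow> 'g set \<Rightarrow> bool" where
  "plectic_c X I \<longleftrightarrow>
     (\<forall>p q n. n = tot (\<lambda>\<mu>. p \<mu> + q \<mu>) \<longrightarrow>
        ((multi_F X I p \<inter> weight X n) <+>\<^bsub>space_of X\<^esub> (multi_Fb X I q \<inter> weight X n))
          \<inter> weight X (n - 1)
        \<subseteq> (multi_F X I p \<inter> weight X (n - 1)) <+>\<^bsub>space_of X\<^esub> lower_Fb X I n q)"

definition mixed_weak_plectic :: "('v, unit, 'g::finite) filtered_space \<Rightarrow> bool" where
  "mixed_weak_plectic X \<longleftrightarrow> (\<forall>I. plectic_a X I \<and> plectic_b X I \<and> plectic_c X I)"

definition A_sub ::
    "('v, unit, 'g::finite) filtered_space \<Rightarrow> 'g set \<Rightarrow> ('g \<Rightarrow> int) \<Rightarrow> ('g \<Rightarrow> int) \<Rightarrow> 'v set" where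
  "A_sub X I p q =
     (let n = tot (\<lambda>\<mu>. p \<mu> + q \<mu>) in
      (multi_F X I p \<inter> weight X n) \<inter>
      ((multi_Fb X I q \<inter> weight X n) <+>\<^bsub>space_of X\<^esub> lower_Fb X I n q))"

definition partial_weight ::
    "('v, unit, 'g::finite) filtered_space \<Rightarrow> 'g set \<Rightarrow> 'g \<Rightarrow> int \<Rightarrow> 'v set" where
  "partial_weight X I \<mu> n =
     Sum_spaces (space_of X) {(p, q). p \<mu> + q \<mu> \<le> n} (\<lambda>(p, q). A_sub X I p q)"

definition mixed_plectic :: "('v, unit, 'g::finite) filtered_space \<Rightarrow> bool" where
  "mixed_plectic X \<longleftrightarrow> mixed_weak_plectic X \<and>
     (\<forall>I J \<mu> n. partial_weight X I \<mu> n = partial_weight X J \<mu> n)"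

definition MHS ::
    "'v itself \<Rightarrow> 'g::finite itself \<Rightarrow> (('v, unit, 'g) filtered_space, 'v \<Rightarrow> 'v) category" where
  "MHS _ _ = full_subcategory Fil mixed_plectic"

end

theory Submission
  imports Defs "HOL-Library.Function_Algebras"
begin

text \<open>
  The two functors change only the weight filtrations: vector spaces, the filtrations \<open>F\<close> and \<open>Fb\<close>
  and linear maps stay as they are. From an orthogonal family one forms the total weight filtration
  \<open>W n = (\<Sum>|m| = n. \<Inter>\<mu>. W\<^sub>\<mu> (m \<mu>))\<close>, from a plectic structure the partial weight filtrations. Both
  constructions are visibly compatible with filtered maps and turn out to be mutually inverse on the
  nose, so the theorem is a statement about objects, and its substance is linear algebra.

  Everything rests on Deligne's splitting. For a weight filtration \<open>W\<close> and two opposed filtrations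
  \<open>F\<close>, \<open>G\<close> on its graded pieces, the subspaces
  \<open>A (p, q) = F p \<inter> W n \<inter> (G q \<inter> W n + (\<Sum>j\<ge>0. G (q - j) \<inter> W (n - |j| - 1)))\<close>, \<open>n = |p + q|\<close>, map
  isomorphically to the \<open>(p, q)\<close>-components of the graded pieces and decompose the space, and \<open>W\<close> and
  \<open>F\<close> are the sums of those pieces whose indices satisfy the evident inequality. The argument
  needs only that the indices form a directed ordered group with a degree, so one locale, \<open>deligne\<close>,
  covers integers (one mixed Hodge structure, \<open>deligne_of_opposed\<close>) and \<open>g\<close>-tuples (plectic structures).

  No quotients occur in the main argument. A direct sum decomposition makes the map from sets of
  indices to sums of pieces a homomorphism of lattices, so that intersections and sums of such
  subspaces are computed on index sets. Conditions on graded pieces are rewritten beforehand as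
  conditions on subspaces of the ambient space (\<open>mixed_Hodge_iff\<close>, \<open>direct_sum_quotient_iff\<close>).

  From a plectic structure one gets, for each subset \<open>I\<close>, a splitting whose pieces \<open>A\<^sub>I (r, s)\<close> compute
  \<open>F\<^sub>\<mu>\<close> for \<open>\<mu> \<notin> I\<close>, \<open>Fb\<^sub>\<mu>\<close> for \<open>\<mu> \<in> I\<close>, the weights, and, because the partial weights do not depend on
  \<open>I\<close>, all partial weights at once. Modulo lower total weight, \<open>A\<^sub>I (r, s)\<close> agrees with
  \<open>A\<^bsub>-I\<^esub> (s, r)\<close>. So on the graded pieces of the total weight both \<open>F\<^sub>\<nu>\<close> and \<open>Fb\<^sub>\<nu>\<close> are seen in the same
  bigrading and are opposed with respect to the \<open>\<nu>\<close>-th partial weight; opposedness lifts along the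
  total weight filtration (\<open>opposed_of_splittings\<close>).

  From an orthogonal family one gets a Deligne splitting for each \<open>\<mu>\<close>. Orthogonality says that the
  filtrations with index \<open>\<mu>\<close> are themselves mixed Hodge structures for \<open>\<nu>\<close>, hence are graded by the
  \<open>\<nu>\<close>-th splitting; the splittings for different indices are therefore compatible and intersect to a
  splitting indexed by pairs of tuples (\<open>splitting_combine\<close>). In it all the plectic conditions can be read
  off (\<open>opposite_splittings\<close>), and it coincides with the splitting by the subspaces \<open>A_sub\<close>, since a
  direct sum decomposition cannot be enlarged piece by piece. Hence the partial weights of the total
  object are the weights one started from.
\<close>

section \<open>Subspaces and independent families\<close>

locale complex_space = vectorspace "class_ring :: complex ring" V for V :: "'v cspace"
begin

abbreviation sub :: "'v set \<Rightarrow> bool" where "sub \<equiv> csubspace V"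

abbreviation vsum (infixl "\<uplus>" 65) where "X \<uplus> Y \<equiv> X <+>\<^bsub>V\<^esub> Y"

abbreviation Span :: "'i set \<Rightarrow> ('i \<Rightarrow> 'v set) \<Rightarrow> 'v set" where
  "Span S A \<equiv> Sum_spaces V S A"

lemma sub_iff:
  "sub X \<longleftrightarrow> X \<subseteq> carrier V \<and> \<zero>\<^bsub>V\<^esub> \<in> X \<and> (\<forall>x\<in>X. \<forall>y\<in>X. x \<oplus>\<^bsub>V\<^esub> y \<in> X) \<and>
     (\<forall>c. \<forall>x\<in>X. c \<odot>\<^bsub>V\<^esub> x \<in> X)"
  unfolding csubspace_def VectorSpace.subspace_def submodule_def
  using vectorspace_axioms module_axioms by auto

lemma subI:
  assumes "X \<subseteq> carrier V" "\<zero>\<^bsub>V\<^esub> \<in> X"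
    "\<And>x y. x \<in> X \<Longrightarrow> y \<in> X \<Longrightarrow> x \<oplus>\<^bsub>V\<^esub> y \<in> X"
    "\<And>c x. x \<in> X \<Longrightarrow> c \<odot>\<^bsub>V\<^esub> x \<in> X"
  shows "sub X"
  using assms by (auto simp: sub_iff)

lemma sub_carrier: "sub X \<Longrightarrow> X \<subseteq> carrier V"
  and sub_zero: "sub X \<Longrightarrow> \<zero>\<^bsub>V\<^esub> \<in> X"
  and sub_add: "sub X \<Longrightarrow> x \<in> X \<Longrightarrow> y \<in> X \<Longrightarrow> x \<oplus>\<^bsub>V\<^esub> y \<in> X"
  and sub_smult: "sub X \<Longrightarrow> x \<in> X \<Longrightarrow> c \<odot>\<^bsub>V\<^esub> x \<in> X"
  by (auto simp: sub_iff)

lemma smult_minus_one: "x \<in> carrier V \<Longrightarrow> (-1) \<odot>\<^bsub>V\<^esub> x = \<ominus>\<^bsub>V\<^esub> x"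
proof -
  assume x: "x \<in> carrier V"
  have "((-1) + 1) \<odot>\<^bsub>V\<^esub> x = (-1) \<odot>\<^bsub>V\<^esub> x \<oplus>\<^bsub>V\<^esub> 1 \<odot>\<^bsub>V\<^esub> x"
    using smult_l_distr[of "-1" 1 x] x by simp
  moreover have "1 \<odot>\<^bsub>V\<^esub> x = x" using smult_one[OF x] by simp
  moreover have "0 \<odot>\<^bsub>V\<^esub> x = \<zero>\<^bsub>V\<^esub>" using smult_l_null[OF x] by simp
  ultimately have "(-1) \<odot>\<^bsub>V\<^esub> x \<oplus>\<^bsub>V\<^esub> x = \<zero>\<^bsub>V\<^esub>" by simp
  moreover have "(-1) \<odot>\<^bsub>V\<^esub> x \<in> carrier V" using x smult_closed[of "-1" x] by simp
  ultimately show ?thesis using x M.minus_equality by metis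
qed

lemma sub_uminus: "sub X \<Longrightarrow> x \<in> X \<Longrightarrow> \<ominus>\<^bsub>V\<^esub> x \<in> X"
  using smult_minus_one sub_smult sub_carrier by (metis subsetD)

lemma sub_minus: "sub X \<Longrightarrow> x \<in> X \<Longrightarrow> y \<in> X \<Longrightarrow> x \<ominus>\<^bsub>V\<^esub> y \<in> X"
  by (simp add: a_minus_def sub_uminus sub_add)

lemma sub_cancel_left:
  assumes "sub X" "x \<in> X" "x \<oplus>\<^bsub>V\<^esub> y \<in> X" "y \<in> carrier V"
  shows "y \<in> X"
proof -
  have "x \<in> carrier V" using assms sub_carrier by blast
  then have "\<ominus>\<^bsub>V\<^esub> x \<oplus>\<^bsub>V\<^esub> (x \<oplus>\<^bsub>V\<^esub> y) = y"
    using assms(4) by (simp add: M.r_neg1)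
  then show ?thesis using sub_add[OF assms(1) sub_uminus[OF assms(1,2)] assms(3)] by simp
qed

lemma sub_cancel_right:
  assumes "sub X" "y \<in> X" "x \<oplus>\<^bsub>V\<^esub> y \<in> X" "x \<in> carrier V"
  shows "x \<in> X"
proof -
  have "y \<in> carrier V" using assms sub_carrier by blast
  then show ?thesis using sub_cancel_left[OF assms(1,2), of x] assms by (simp add: M.a_comm)
qed

lemma sub_top: "sub (carrier V)"
  by (rule subI) (auto intro: smult_closed[simplified])

lemma sub_bot: "sub {\<zero>\<^bsub>V\<^esub>}"
  by (rule subI) (auto simp: smult_r_null[simplified])

lemma sub_Int: "sub X \<Longrightarrow> sub Y \<Longrightarrow> sub (X \<inter> Y)"
  by (auto simp: sub_iff)

lemma sub_INT:
  assumes A: "\<And>i. i \<in> S \<Longrightarrow> sub (A i)" and "S \<noteq> {}"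
  shows "sub (\<Inter>i\<in>S. A i)"
proof (rule subI)
  obtain i where "i \<in> S" using assms(2) by auto
  then show "(\<Inter>i\<in>S. A i) \<subseteq> carrier V" using sub_carrier[OF A] by blast
qed (use sub_zero[OF A] sub_add[OF A] sub_smult[OF A] in auto)

lemma mem_vsum: "x \<in> X \<uplus> Y \<longleftrightarrow> (\<exists>a\<in>X. \<exists>b\<in>Y. x = a \<oplus>\<^bsub>V\<^esub> b)"
  by (auto simp: set_add_def')

lemma sub_vsum:
  assumes X: "sub X" and Y: "sub Y" shows "sub (X \<uplus> Y)"
proof (rule subI)
  note c = subsetD[OF sub_carrier[OF X]] subsetD[OF sub_carrier[OF Y]]
  show "X \<uplus> Y \<subseteq> carrier V" using c by (auto simp: mem_vsum)
  show "\<zero>\<^bsub>V\<^esub> \<in> X \<uplus> Y"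
    unfolding mem_vsum using sub_zero[OF X] sub_zero[OF Y] by (metis M.l_zero M.zero_closed)
  fix x assume "x \<in> X \<uplus> Y"
  then obtain a b where ab: "a \<in> X" "b \<in> Y" "x = a \<oplus>\<^bsub>V\<^esub> b" by (auto simp: mem_vsum)
  {
    fix y assume "y \<in> X \<uplus> Y"
    then obtain a' b' where ab': "a' \<in> X" "b' \<in> Y" "y = a' \<oplus>\<^bsub>V\<^esub> b'" by (auto simp: mem_vsum)
    have "x \<oplus>\<^bsub>V\<^esub> y = (a \<oplus>\<^bsub>V\<^esub> a') \<oplus>\<^bsub>V\<^esub> (b \<oplus>\<^bsub>V\<^esub> b')"
      using ab ab' c by (simp add: M.a_ac)
    then show "x \<oplus>\<^bsub>V\<^esub> y \<in> X \<uplus> Y"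
      unfolding mem_vsum using ab ab' sub_add[OF X] sub_add[OF Y] by blast
  }
  fix k
  have "k \<odot>\<^bsub>V\<^esub> x = k \<odot>\<^bsub>V\<^esub> a \<oplus>\<^bsub>V\<^esub> k \<odot>\<^bsub>V\<^esub> b"
    using ab c smult_r_distr[of k a b] by simp
  then show "k \<odot>\<^bsub>V\<^esub> x \<in> X \<uplus> Y"
    unfolding mem_vsum using ab sub_smult[OF X] sub_smult[OF Y] by blast
qed

lemma vsum_upper1: assumes "sub X" "sub Y" shows "X \<subseteq> X \<uplus> Y"
proof
  fix x assume x: "x \<in> X"
  then have "x = x \<oplus>\<^bsub>V\<^esub> \<zero>\<^bsub>V\<^esub>" using sub_carrier[OF assms(1)] by auto
  then show "x \<in> X \<uplus> Y" using x sub_zero[OF assms(2)] unfolding mem_vsum by blast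
qed

lemma vsum_upper2: assumes "sub X" "sub Y" shows "Y \<subseteq> X \<uplus> Y"
proof
  fix x assume x: "x \<in> Y"
  then have "x = \<zero>\<^bsub>V\<^esub> \<oplus>\<^bsub>V\<^esub> x" using sub_carrier[OF assms(2)] by auto
  then show "x \<in> X \<uplus> Y" using x sub_zero[OF assms(1)] unfolding mem_vsum by blast
qed

lemma vsum_least:
  assumes "sub Z" "X \<subseteq> Z" "Y \<subseteq> Z" shows "X \<uplus> Y \<subseteq> Z"
proof
  fix x assume "x \<in> X \<uplus> Y"
  then obtain a b where "a \<in> X" "b \<in> Y" "x = a \<oplus>\<^bsub>V\<^esub> b" unfolding mem_vsum by blast
  then show "x \<in> Z" using assms(2,3) sub_add[OF assms(1), of a b] by blast
qed

lemma vsum_mono: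
  assumes "X \<subseteq> X'" "Y \<subseteq> Y'" shows "X \<uplus> Y \<subseteq> X' \<uplus> Y'"
proof
  fix x assume "x \<in> X \<uplus> Y"
  then obtain a b where "a \<in> X" "b \<in> Y" "x = a \<oplus>\<^bsub>V\<^esub> b" unfolding mem_vsum by blast
  then show "x \<in> X' \<uplus> Y'" using assms unfolding mem_vsum by blast
qed

lemma vsum_absorb: "sub X \<Longrightarrow> sub Y \<Longrightarrow> Y \<subseteq> X \<Longrightarrow> X \<uplus> Y = X"
  by (simp add: subset_antisym vsum_least vsum_upper1)

lemma vsum_comm: "sub X \<Longrightarrow> sub Y \<Longrightarrow> X \<uplus> Y = Y \<uplus> X"
  by (intro subset_antisym vsum_least sub_vsum vsum_upper1 vsum_upper2)

lemma modular:
  assumes "sub X" "sub Y" "sub Z" "X \<subseteq> Z"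
  shows "(X \<uplus> Y) \<inter> Z \<subseteq> X \<uplus> (Y \<inter> Z)"
proof
  fix x assume "x \<in> (X \<uplus> Y) \<inter> Z"
  then obtain a b where ab: "a \<in> X" "b \<in> Y" "x = a \<oplus>\<^bsub>V\<^esub> b" "x \<in> Z" by (auto simp: mem_vsum)
  then have "b \<in> Z" using sub_cancel_left[OF assms(3), of a b] assms sub_carrier by blast
  then show "x \<in> X \<uplus> (Y \<inter> Z)" using ab by (auto simp: mem_vsum)
qed

lemma sub_Span:
  assumes "\<And>i. i \<in> S \<Longrightarrow> sub (A i)" shows "sub (Span S A)"
  unfolding Sum_spaces_def csubspace_def
  by (rule span_is_subspace) (use assms sub_carrier in blast)

lemma Span_upper:
  assumes "\<And>i. i \<in> S \<Longrightarrow> sub (A i)" "i \<in> S" shows "A i \<subseteq> Span S A"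
proof -
  have "(\<Union>i\<in>S. A i) \<subseteq> carrier V" using assms sub_carrier by blast
  then have "(\<Union>i\<in>S. A i) \<subseteq> Span S A" unfolding Sum_spaces_def by (rule in_own_span)
  then show ?thesis using assms(2) by blast
qed

lemma Span_least:
  assumes "sub Z" "\<And>i. i \<in> S \<Longrightarrow> A i \<subseteq> Z" shows "Span S A \<subseteq> Z"
  unfolding Sum_spaces_def
  by (rule span_is_subset) (use assms in \<open>auto simp: csubspace_def VectorSpace.subspace_def\<close>)

lemma Span_mono: "S \<subseteq> T \<Longrightarrow> Span S A \<subseteq> Span T A"
  unfolding Sum_spaces_def by (rule span_is_monotone) blast

lemma Span_empty: "Span {} A = {\<zero>\<^bsub>V\<^esub>}"
  unfolding Sum_spaces_def using span_empty by simp

lemma Span_Un: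
  assumes "\<And>i. i \<in> S \<union> T \<Longrightarrow> sub (A i)" shows "Span (S \<union> T) A = Span S A \<uplus> Span T A"
proof
  have s: "sub (Span S A)" "sub (Span T A)" using assms by (auto intro!: sub_Span)
  show "Span (S \<union> T) A \<subseteq> Span S A \<uplus> Span T A"
  proof (rule Span_least[OF sub_vsum[OF s]])
    fix i assume "i \<in> S \<union> T"
    then have "A i \<subseteq> Span S A \<or> A i \<subseteq> Span T A"
      using Span_upper[of S A i] Span_upper[of T A i] assms by auto
    then show "A i \<subseteq> Span S A \<uplus> Span T A" using vsum_upper1[OF s] vsum_upper2[OF s] by blast
  qed
  show "Span S A \<uplus> Span T A \<subseteq> Span (S \<union> T) A"
    by (rule vsum_least[OF sub_Span[OF assms]]) (assumption, (rule Span_mono, blast)+)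
qed

lemma Span_insert:
  assumes "sub (A i)" "\<And>j. j \<in> S \<Longrightarrow> sub (A j)" shows "Span (insert i S) A = A i \<uplus> Span S A"
proof -
  have "Span {i} A = A i"
    using Span_least[OF assms(1), of "{i}" A] Span_upper[of "{i}" A i] assms(1) by auto
  then show ?thesis using Span_Un[of "{i}" S A] assms by auto
qed

lemma Span_finite:
  assumes "x \<in> Span S A" "\<And>i. i \<in> S \<Longrightarrow> sub (A i)"
  shows "\<exists>F. finite F \<and> F \<subseteq> S \<and> x \<in> Span F A"
proof -
  let ?U = "{x. \<exists>F. finite F \<and> F \<subseteq> S \<and> x \<in> Span F A}"
  have F: "sub (Span F A)" if "F \<subseteq> S" for F using that assms(2) by (auto intro: sub_Span)
  have "sub ?U"
  proof (rule subI)
    show "?U \<subseteq> carrier V" using F sub_carrier by blast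
    show "\<zero>\<^bsub>V\<^esub> \<in> ?U" using Span_empty by (force intro!: exI[of _ "{}"])
    show "c \<odot>\<^bsub>V\<^esub> x \<in> ?U" if "x \<in> ?U" for c x using that F sub_smult by blast
    fix x y assume "x \<in> ?U" "y \<in> ?U"
    then obtain G H where GH: "finite G" "G \<subseteq> S" "x \<in> Span G A" "finite H" "H \<subseteq> S" "y \<in> Span H A" by auto
    then have "x \<oplus>\<^bsub>V\<^esub> y \<in> Span (G \<union> H) A"
      using sub_add[OF F[of "G \<union> H"], of x y] Span_mono[of G "G \<union> H" A] Span_mono[of H "G \<union> H" A] by blast
    then show "x \<oplus>\<^bsub>V\<^esub> y \<in> ?U" using GH by (intro CollectI exI[of _ "G \<union> H"]) auto
  qed
  moreover have "A i \<subseteq> ?U" if "i \<in> S" for i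
    using Span_upper[of "{i}" A i] assms(2) that by (auto intro!: exI[of _ "{i}"])
  ultimately have "Span S A \<subseteq> ?U" by (rule Span_least)
  then show ?thesis using assms(1) by auto
qed

lemma Span_reindex: "Span S (\<lambda>i. A (h i)) = Span (h ` S) A"
  unfolding Sum_spaces_def by simp

lemma Span_le:
  assumes "\<And>i. i \<in> T \<Longrightarrow> sub (B i)" "\<And>i. i \<in> S \<Longrightarrow> \<exists>j\<in>T. A i \<subseteq> B j"
  shows "Span S A \<subseteq> Span T B"
proof (rule Span_least[OF sub_Span])
  show "sub (B i)" if "i \<in> T" for i using assms that by blast
  fix i assume "i \<in> S"
  then show "A i \<subseteq> Span T B" using assms Span_upper[of T B] by (meson subset_trans)
qed

text \<open>
  Independence in the form in which it is used: intersections of sums are computed on index sets.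
  For \<open>S = {i}\<close> and \<open>T = - {i}\<close> this is the usual condition, and \<open>independent_if_disjoint\<close> is the
  converse.
\<close>

definition independent :: "('i \<Rightarrow> 'v set) \<Rightarrow> bool" where
  "independent A \<longleftrightarrow> (\<forall>i. sub (A i)) \<and> (\<forall>S T. Span S A \<inter> Span T A \<subseteq> Span (S \<inter> T) A)"

lemma independent_sub: "independent A \<Longrightarrow> sub (A i)"
  by (simp add: independent_def)

lemma independent_Int: "independent A \<Longrightarrow> Span S A \<inter> Span T A = Span (S \<inter> T) A"
  unfolding independent_def by (intro subset_antisym Int_greatest Span_mono) auto

lemma independent_Un: "independent A \<Longrightarrow> Span S A \<uplus> Span T A = Span (S \<union> T) A"
  by (simp add: independent_sub Span_Un)

text \<open>
  A vector in two finite sums \<open>F\<close> and \<open>G\<close> has zero component at every index of \<open>F - G\<close>: that component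
  also lies in the sum of the other pieces. These indices are removed one at a time.
\<close>

lemma independent_if_disjoint:
  assumes A: "\<And>i. sub (A i)"
    and dis: "\<And>i F. finite F \<Longrightarrow> i \<notin> F \<Longrightarrow> A i \<inter> Span F A \<subseteq> {\<zero>\<^bsub>V\<^esub>}"
  shows "independent A"
proof -
  have fin: "x \<in> Span (F \<inter> G) A" if "finite F" "finite G" "x \<in> Span F A" "x \<in> Span G A" for x F G
    using that
  proof (induction "card (F - G)" arbitrary: F)
    case 0
    then have "F \<inter> G = F" by auto
    then show ?case using 0 by simp
  next
    case (Suc n)
    then obtain i where i: "i \<in> F" "i \<notin> G" by (metis card.empty Diff_eq_empty_iff nat.distinct(1) subsetI)
    let ?F = "F - {i}"
    have "insert i ?F = F" using i by auto
    then have "x \<in> A i \<uplus> Span ?F A" using Span_insert[of A i ?F] A Suc.prems by simp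
    then obtain a d where ad: "a \<in> A i" "d \<in> Span ?F A" "x = a \<oplus>\<^bsub>V\<^esub> d" by (auto simp: mem_vsum)
    have s: "sub (Span H A)" for H using A by (rule sub_Span)
    have c: "a \<in> carrier V" "d \<in> carrier V" using ad A s sub_carrier by blast+
    have "x \<in> Span (G \<union> ?F) A" "d \<in> Span (G \<union> ?F) A"
      using Suc.prems ad Span_mono[of G "G \<union> ?F" A] Span_mono[of ?F "G \<union> ?F" A] by auto
    then have "a \<in> Span (G \<union> ?F) A" using sub_cancel_right[OF s, of d] ad c by blast
    then have "a = \<zero>\<^bsub>V\<^esub>" using dis[of "G \<union> ?F" i] ad i Suc.prems by auto
    then have "x \<in> Span ?F A" using ad c by simp
    moreover have "n = card (?F - G)"
    proof -
      have "?F - G = (F - G) - {i}" by auto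
      then show ?thesis using Suc.hyps(2) i Suc.prems by (simp add: card_Diff_singleton_if)
    qed
    ultimately have "x \<in> Span (?F \<inter> G) A" using Suc.hyps(1)[of ?F] Suc.prems by simp
    then show ?case using Span_mono[of "?F \<inter> G" "F \<inter> G" A] by auto
  qed
  have "Span S A \<inter> Span T A \<subseteq> Span (S \<inter> T) A" for S T
  proof
    fix x assume "x \<in> Span S A \<inter> Span T A"
    then obtain F G where "finite F" "F \<subseteq> S" "x \<in> Span F A" "finite G" "G \<subseteq> T" "x \<in> Span G A"
      using Span_finite[of x S A] Span_finite[of x T A] A by auto
    then show "x \<in> Span (S \<inter> T) A"
      using fin[of F G x] Span_mono[of "F \<inter> G" "S \<inter> T" A] by blast
  qed
  then show ?thesis using A by (simp add: independent_def)
qed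

text \<open>
  Independence follows from relations in which the distinguished index has maximal weight, since any
  relation can be solved for a piece of maximal weight. This is what a splitting of the
  graded pieces of a filtration provides.
\<close>

lemma independent_if_weights:
  fixes wt :: "'i \<Rightarrow> int"
  assumes A: "\<And>i. sub (A i)"
    and dis: "\<And>i F. finite F \<Longrightarrow> i \<notin> F \<Longrightarrow> (\<And>j. j \<in> F \<Longrightarrow> wt j \<le> wt i) \<Longrightarrow> A i \<inter> Span F A \<subseteq> {\<zero>\<^bsub>V\<^esub>}"
  shows "independent A"
proof (rule independent_if_disjoint[OF A])
  have s: "sub (Span H A)" for H using A by (rule sub_Span)
  fix i :: 'i and F assume "finite F" "i \<notin> F"
  then show "A i \<inter> Span F A \<subseteq> {\<zero>\<^bsub>V\<^esub>}"
  proof (induction "card F" arbitrary: F)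
    case 0
    then show ?case by (simp add: Span_empty)
  next
    case (Suc n)
    show ?case
    proof (cases "\<forall>j\<in>F. wt j \<le> wt i")
      case True
      then show ?thesis using dis[of F i] Suc.prems by blast
    next
      case False
      then have ne: "wt ` F \<noteq> {}" by auto
      have "finite (wt ` F)" using Suc.prems by simp
      then have "Max (wt ` F) \<in> wt ` F" using ne by (rule Max_in)
      then obtain j where j: "j \<in> F" "wt j = Max (wt ` F)" by auto
      have max: "wt k \<le> wt j" if "k \<in> F" for k using j(2) that Suc.prems by simp
      have ij: "wt i < wt j" using False max by force
      let ?F = "F - {j}"
      have iF: "insert j ?F = F" using j by auto
      show ?thesis
      proof
        fix x assume x: "x \<in> A i \<inter> Span F A"
        then have "x \<in> A j \<uplus> Span ?F A" using Span_insert[of A j ?F] A iF by simp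
        then obtain a d where ad: "a \<in> A j" "d \<in> Span ?F A" "x = a \<oplus>\<^bsub>V\<^esub> d" by (auto simp: mem_vsum)
        have c: "a \<in> carrier V" "d \<in> carrier V" using ad A s sub_carrier by blast+
        have "x \<in> Span (insert i ?F) A" "d \<in> Span (insert i ?F) A"
          using x ad Span_upper[of "insert i ?F" A i] Span_mono[of ?F "insert i ?F" A] A by auto
        then have "a \<in> Span (insert i ?F) A" using sub_cancel_right[OF s, of d] ad c by blast
        moreover have "j \<notin> insert i ?F" using Suc.prems j by auto
        ultimately have "a = \<zero>\<^bsub>V\<^esub>" using dis[of "insert i ?F" j] ad Suc.prems max ij by fastforce
        then have "x \<in> Span ?F A" using ad c by simp
        moreover have "n = card ?F" using Suc.hyps(2) j Suc.prems by simp
        ultimately show "x \<in> {\<zero>\<^bsub>V\<^esub>}" using Suc.hyps(1)[of ?F] Suc.prems x by auto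
      qed
    qed
  qed
qed

definition splitting :: "('i \<Rightarrow> 'v set) \<Rightarrow> bool" where
  "splitting A \<longleftrightarrow> independent A \<and> Span UNIV A = carrier V"

text \<open>
  A vector of \<open>B i\<close> decomposes along \<open>A\<close>, and the parts outside index \<open>i\<close> vanish because they lie in the
  other pieces of \<open>B\<close>. This identifies Deligne's subspaces with a given splitting once one
  inclusion is known.
\<close>

lemma splitting_maximal:
  assumes A: "splitting A" and B: "independent B" and AB: "\<And>i. A i \<subseteq> B i"
  shows "A i = B i"
proof
  have sA: "sub (A i)" and sB: "sub (B i)" for i
    using A B by (auto simp: splitting_def independent_sub)
  have "B i \<subseteq> Span UNIV A" using A sub_carrier[OF sB] by (simp add: splitting_def)
  also have "Span UNIV A = A i \<uplus> Span (-{i}) A"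
    using Span_insert[of A i "-{i}"] sA by (simp add: insert_absorb Compl_eq_Diff_UNIV insert_Diff_if)
  finally have "B i \<subseteq> (A i \<uplus> Span (-{i}) A) \<inter> B i" by auto
  also have "\<dots> \<subseteq> A i \<uplus> (Span (-{i}) A \<inter> B i)"
    by (intro modular sA sB sub_Span AB)
  also have "\<dots> \<subseteq> A i"
  proof (rule vsum_least[OF sA])
    have "Span (-{i}) A \<inter> B i \<subseteq> Span (-{i}) B \<inter> Span {i} B"
      using Span_le[of "-{i}" B "-{i}" A] Span_upper[of "{i}" B i] AB sB by blast
    also have "\<dots> \<subseteq> {\<zero>\<^bsub>V\<^esub>}" using independent_Int[OF B] by (simp add: Span_empty)
    finally show "Span (-{i}) A \<inter> B i \<subseteq> A i" using sub_zero[OF sA] by blast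
  qed simp
  finally show "B i \<subseteq> A i" .
qed (rule AB)

end

section \<open>Quotients and graded pieces\<close>

lemma class_ring_field: "field (class_ring :: complex ring)"
  by (rule class_field.field_axioms)

text \<open>
  The axioms hold for representatives. This gives the quotient its vector space structure.
\<close>

lemma surjective_image_vectorspace:
  fixes M :: "'a cspace" and Q :: "'b cspace"
  assumes M: "vectorspace class_ring M"
    and car: "carrier Q = f ` carrier M"
    and zero: "\<zero>\<^bsub>Q\<^esub> = f \<zero>\<^bsub>M\<^esub>"
    and add: "\<And>x y. x \<in> carrier M \<Longrightarrow> y \<in> carrier M \<Longrightarrow> f x \<oplus>\<^bsub>Q\<^esub> f y = f (x \<oplus>\<^bsub>M\<^esub> y)"
    and smult: "\<And>c x. x \<in> carrier M \<Longrightarrow> c \<odot>\<^bsub>Q\<^esub> f x = f (c \<odot>\<^bsub>M\<^esub> x)"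
  shows "linear_map class_ring M Q f"
proof -
  interpret M: complex_space M using M by (simp add: complex_space_def)
  have cl: "c \<odot>\<^bsub>M\<^esub> x \<in> carrier M" if "x \<in> carrier M" for c x
    using M.smult_closed[of c x] that by simp
  have grp: "abelian_group Q"
  proof (rule abelian_groupI)
    fix x assume "x \<in> carrier Q"
    then obtain a where a: "a \<in> carrier M" "x = f a" unfolding car by blast
    show "\<zero>\<^bsub>Q\<^esub> \<oplus>\<^bsub>Q\<^esub> x = x" using a by (simp add: zero add)
    have "f (\<ominus>\<^bsub>M\<^esub> a) \<oplus>\<^bsub>Q\<^esub> x = \<zero>\<^bsub>Q\<^esub>" using a by (simp add: zero add M.l_neg)
    then show "\<exists>y\<in>carrier Q. y \<oplus>\<^bsub>Q\<^esub> x = \<zero>\<^bsub>Q\<^esub>"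
      unfolding car using a M.a_inv_closed by blast
    fix y assume "y \<in> carrier Q"
    then obtain b where b: "b \<in> carrier M" "y = f b" unfolding car by blast
    show "x \<oplus>\<^bsub>Q\<^esub> y \<in> carrier Q" using a b by (simp add: add car)
    show "x \<oplus>\<^bsub>Q\<^esub> y = y \<oplus>\<^bsub>Q\<^esub> x" using a b by (simp add: add M.a_comm)
    fix z assume "z \<in> carrier Q"
    then obtain c where "c \<in> carrier M" "z = f c" unfolding car by blast
    then show "(x \<oplus>\<^bsub>Q\<^esub> y) \<oplus>\<^bsub>Q\<^esub> z = x \<oplus>\<^bsub>Q\<^esub> (y \<oplus>\<^bsub>Q\<^esub> z)"
      using a b by (simp add: add M.a_assoc)
  qed (simp add: car zero)
  have cring: "cring (class_ring :: complex ring)"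
    using class_ring_field by (simp add: field_def domain_def)
  have "module class_ring Q"
  proof (rule moduleI[OF cring grp], goal_cases)
    case (1 c x)
    then obtain a where "a \<in> carrier M" "x = f a" unfolding car by blast
    then show ?case by (simp add: smult car cl)
  next
    case (2 b c x)
    then obtain a where "a \<in> carrier M" "x = f a" unfolding car by blast
    then show ?case using M.smult_l_distr[of b c a] by (simp add: smult add cl)
  next
    case (3 c x y)
    then obtain a b where "a \<in> carrier M" "x = f a" "b \<in> carrier M" "y = f b" unfolding car by blast
    then show ?case using M.smult_r_distr[of c a b] by (simp add: smult add cl)
  next
    case (4 b c x)
    then obtain a where "a \<in> carrier M" "x = f a" unfolding car by blast
    then show ?case using M.smult_assoc1[of b c a] by (simp add: smult cl)
  next
    case (5 x)
    then obtain a where "a \<in> carrier M" "x = f a" unfolding car by blast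
    then show ?case using M.smult_one[of a] by (simp add: smult)
  qed
  then have Q: "vectorspace class_ring Q"
    using class_ring_field by (simp add: vectorspace_def)
  show ?thesis
    unfolding linear_map_def mod_hom_def mod_hom_axioms_def LinearCombinations.module_hom_def
    using M Q car add smult by (auto simp: vectorspace_def)
qed

context complex_space
begin

lemma subspace_vectorspace: "sub X \<Longrightarrow> vectorspace class_ring (V\<lparr>carrier := X\<rparr>)"
  using subspace_is_vs by (simp add: csubspace_def)

lemma vsum_restrict: "set_add (V\<lparr>carrier := X\<rparr>) = set_add V"
  by (simp add: set_add_def set_mult_def fun_eq_iff)

lemma sub_restrict: "sub X \<Longrightarrow> csubspace (V\<lparr>carrier := X\<rparr>) Y \<longleftrightarrow> sub Y \<and> Y \<subseteq> X"
proof -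
  assume X: "sub X"
  interpret X: complex_space "V\<lparr>carrier := X\<rparr>"
    using subspace_vectorspace[OF X] by (simp add: complex_space_def)
  show ?thesis unfolding X.sub_iff sub_iff using sub_carrier[OF X] by auto
qed

lemma finite_dimensional_subspace:
  assumes fd: "fin_dim" and X: "sub X"
  shows "fd_cspace (V\<lparr>carrier := X\<rparr>)"
proof -
  let ?X = "V\<lparr>carrier := X\<rparr>"
  interpret X: vectorspace class_ring ?X by (rule subspace_vectorspace[OF X])
  have sm: "submodule class_ring X V" using X by (simp add: csubspace_def VectorSpace.subspace_def)
  let ?P = "\<lambda>S. S \<subseteq> X \<and> \<not> lin_dep S"
  \<comment> \<open>A maximal independent subset of the subspace exists because its size is bounded, and it generates.\<close>
  have "finite A \<and> card A \<le> dim" if "?P A" for A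
    using that sub_carrier[OF X] fin_dim_li_fin[OF fd, of A] li_le_dim(2)[OF fd, of A] by blast
  moreover have "?P {}" by (auto simp: lin_dep_def)
  ultimately obtain A where A: "finite A" "maximal A ?P" using maximal_exists[of ?P dim "{}"] by blast
  have "maximal A (\<lambda>S. S \<subseteq> carrier ?X \<and> \<not> X.lin_dep S)"
  proof -
    have "(\<lambda>S. S \<subseteq> carrier ?X \<and> \<not> X.lin_dep S) = ?P"
      using span_li_not_depend(2)[OF _ sm] by auto
    then show ?thesis using A by simp
  qed
  then have "X.span A = carrier ?X" by (rule X.max_li_is_gen)
  moreover have "A \<subseteq> X" using A(2) by (auto simp: maximal_def)
  ultimately have "X.fin_dim" unfolding X.fin_dim_def using A(1) by auto
  then show ?thesis unfolding fd_cspace_def using X.vectorspace_axioms by simp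
qed

end

text \<open>
  The setting for one graded piece: \<open>X = W n\<close> and \<open>N = W (n - 1)\<close>. The lemmas translate statements about
  images in the quotient into statements about subspaces between \<open>N\<close> and \<open>X\<close>.
\<close>

locale subquotient = complex_space +
  fixes N X assumes N: "csubspace V N" and X: "csubspace V X" and NX: "N \<subseteq> X"
begin

abbreviation coset ("\<pi>") where "\<pi> x \<equiv> N +>\<^bsub>V\<^esub> x"

abbreviation "Q \<equiv> quotient_space (V\<lparr>carrier := X\<rparr>) N"

lemma mem_coset: "x \<in> carrier V \<Longrightarrow> z \<in> \<pi> x \<longleftrightarrow> z \<in> carrier V \<and> z \<ominus>\<^bsub>V\<^esub> x \<in> N"
proof -
  assume x: "x \<in> carrier V"
  have "h \<oplus>\<^bsub>V\<^esub> x \<ominus>\<^bsub>V\<^esub> x = h" if "h \<in> carrier V" for h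
    using x that by (simp add: a_minus_def M.a_assoc M.r_neg)
  moreover have "(z \<ominus>\<^bsub>V\<^esub> x) \<oplus>\<^bsub>V\<^esub> x = z" if "z \<in> carrier V"
    using x that by (simp add: a_minus_def M.a_assoc M.l_neg)
  ultimately show ?thesis
    unfolding a_r_coset_def' using x sub_carrier[OF N] by (auto; metis subsetD M.a_closed)
qed

lemma coset_eq_iff:
  assumes "x \<in> carrier V" "y \<in> carrier V" shows "\<pi> x = \<pi> y \<longleftrightarrow> x \<ominus>\<^bsub>V\<^esub> y \<in> N"
proof
  have "x \<in> \<pi> x" using assms sub_zero[OF N] by (simp add: mem_coset a_minus_def M.r_neg)
  then show "\<pi> x = \<pi> y \<Longrightarrow> x \<ominus>\<^bsub>V\<^esub> y \<in> N" using assms mem_coset by blast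
next
  assume d: "x \<ominus>\<^bsub>V\<^esub> y \<in> N"
  show "\<pi> x = \<pi> y"
  proof (rule Set.set_eqI)
    fix z show "z \<in> \<pi> x \<longleftrightarrow> z \<in> \<pi> y"
    proof (cases "z \<in> carrier V")
      case True
      have c: "z \<ominus>\<^bsub>V\<^esub> x \<in> carrier V" "x \<ominus>\<^bsub>V\<^esub> y \<in> carrier V" using True assms by auto
      have "(z \<ominus>\<^bsub>V\<^esub> x) \<oplus>\<^bsub>V\<^esub> (x \<ominus>\<^bsub>V\<^esub> y) = z \<ominus>\<^bsub>V\<^esub> y"
        using True assms by (simp add: a_minus_def M.a_assoc M.r_neg1)
      then show ?thesis using assms True mem_coset sub_add[OF N _ d] sub_cancel_right[OF N d _ c(1)]
        by metis
    qed (use assms mem_coset in blast)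
  qed
qed

lemma coset_add:
  assumes x: "x \<in> carrier V" and y: "y \<in> carrier V"
  shows "\<pi> x <+>\<^bsub>V\<^esub> \<pi> y = \<pi> (x \<oplus>\<^bsub>V\<^esub> y)"
proof -
  note c = subsetD[OF sub_carrier[OF N]]
  have "\<exists>h\<in>N. (a \<oplus>\<^bsub>V\<^esub> x) \<oplus>\<^bsub>V\<^esub> (b \<oplus>\<^bsub>V\<^esub> y) = h \<oplus>\<^bsub>V\<^esub> (x \<oplus>\<^bsub>V\<^esub> y)" if "a \<in> N" "b \<in> N" for a b
    using that x y c by (intro bexI[of _ "a \<oplus>\<^bsub>V\<^esub> b"]) (auto simp: M.a_ac sub_add[OF N])
  moreover have "\<exists>a\<in>N. \<exists>b\<in>N. h \<oplus>\<^bsub>V\<^esub> (x \<oplus>\<^bsub>V\<^esub> y) = (a \<oplus>\<^bsub>V\<^esub> x) \<oplus>\<^bsub>V\<^esub> (b \<oplus>\<^bsub>V\<^esub> y)" if "h \<in> N" for h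
    using that x y c sub_zero[OF N]
    by (intro bexI[of _ h] bexI[of _ "\<zero>\<^bsub>V\<^esub>"]) (auto simp: M.a_ac)
  ultimately show ?thesis
    unfolding set_eq_iff mem_vsum a_r_coset_def' by (simp, metis)
qed

lemma coset_smult:
  assumes x: "x \<in> carrier V"
  shows "N <+>\<^bsub>V\<^esub> ((\<lambda>z. c \<odot>\<^bsub>V\<^esub> z) ` \<pi> x) = \<pi> (c \<odot>\<^bsub>V\<^esub> x)"
proof -
  note cN = subsetD[OF sub_carrier[OF N]]
  have cl: "c \<odot>\<^bsub>V\<^esub> z \<in> carrier V" if "z \<in> carrier V" for z using smult_closed[of c z] that by simp
  have "\<exists>h\<in>N. a \<oplus>\<^bsub>V\<^esub> c \<odot>\<^bsub>V\<^esub> (b \<oplus>\<^bsub>V\<^esub> x) = h \<oplus>\<^bsub>V\<^esub> c \<odot>\<^bsub>V\<^esub> x" if "a \<in> N" "b \<in> N" for a b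
    using that x cN cl smult_r_distr[of c b x] sub_smult[OF N]
    by (intro bexI[of _ "a \<oplus>\<^bsub>V\<^esub> c \<odot>\<^bsub>V\<^esub> b"]) (auto simp: M.a_ac sub_add[OF N])
  moreover have "\<exists>a\<in>N. \<exists>b\<in>N. h \<oplus>\<^bsub>V\<^esub> c \<odot>\<^bsub>V\<^esub> x = a \<oplus>\<^bsub>V\<^esub> c \<odot>\<^bsub>V\<^esub> (b \<oplus>\<^bsub>V\<^esub> x)" if "h \<in> N" for h
    using that x sub_zero[OF N]
    by (intro bexI[of _ h] bexI[of _ "\<zero>\<^bsub>V\<^esub>"]) auto
  ultimately show ?thesis
    unfolding set_eq_iff mem_vsum a_r_coset_def' image_iff by (simp, metis)
qed

lemma coset_linear: "linear_map class_ring (V\<lparr>carrier := X\<rparr>) Q \<pi>"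
proof (rule surjective_image_vectorspace[OF subspace_vectorspace[OF X]])
  show "carrier Q = \<pi> ` carrier (V\<lparr>carrier := X\<rparr>)"
    unfolding quotient_space_def A_RCOSETS_def' by (auto simp: a_r_coset_def')
  have "\<pi> \<zero>\<^bsub>V\<^esub> = N"
    unfolding a_r_coset_def' using subsetD[OF sub_carrier[OF N]] by auto
  then show "\<zero>\<^bsub>Q\<^esub> = \<pi> \<zero>\<^bsub>V\<lparr>carrier := X\<rparr>\<^esub>" by (simp add: quotient_space_def)
next
  fix x y assume "x \<in> carrier (V\<lparr>carrier := X\<rparr>)" "y \<in> carrier (V\<lparr>carrier := X\<rparr>)"
  then show "\<pi> x \<oplus>\<^bsub>Q\<^esub> \<pi> y = \<pi> (x \<oplus>\<^bsub>V\<lparr>carrier := X\<rparr>\<^esub> y)"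
    using sub_carrier[OF X] coset_add[of x y] by (auto simp: quotient_space_def vsum_restrict)
next
  fix c x assume "x \<in> carrier (V\<lparr>carrier := X\<rparr>)"
  then show "c \<odot>\<^bsub>Q\<^esub> \<pi> x = \<pi> (c \<odot>\<^bsub>V\<lparr>carrier := X\<rparr>\<^esub> x)"
    using sub_carrier[OF X] coset_smult[of x c] by (auto simp: quotient_space_def vsum_restrict)
qed

sublocale XQ: linear_map class_ring "V\<lparr>carrier := X\<rparr>" Q \<pi> by (rule coset_linear)

lemma carrier_Q: "carrier Q = \<pi> ` X"
  unfolding quotient_space_def A_RCOSETS_def' by (auto simp: a_r_coset_def')

lemma zero_Q: "\<zero>\<^bsub>Q\<^esub> = \<pi> \<zero>\<^bsub>V\<^esub>"
  using XQ.f0_is_0 by simp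

lemma fd_Q: assumes "fin_dim" shows "fd_cspace Q"
proof -
  have "XQ.V.fin_dim" using finite_dimensional_subspace[OF assms X] by (simp add: fd_cspace_def)
  then have "XQ.W.fin_dim" using XQ.surj_fin_dim carrier_Q by simp
  then show ?thesis using XQ.W.vectorspace_axioms by (simp add: fd_cspace_def)
qed


lemma coset_image_subset_iff:
  assumes Y: "sub Y" "Y \<subseteq> X" and Z: "sub Z" "Z \<subseteq> X"
  shows "\<pi> ` Y \<subseteq> \<pi> ` Z \<longleftrightarrow> Y \<subseteq> Z \<uplus> N"
proof
  note c = subsetD[OF sub_carrier[OF Y(1)]] subsetD[OF sub_carrier[OF Z(1)]] subsetD[OF sub_carrier[OF N]]
  {
    assume le: "\<pi> ` Y \<subseteq> \<pi> ` Z"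
    show "Y \<subseteq> Z \<uplus> N"
    proof
      fix y assume y: "y \<in> Y"
      then obtain z where z: "z \<in> Z" "\<pi> y = \<pi> z" using le by auto
      then have "y \<ominus>\<^bsub>V\<^esub> z \<in> N" using c y coset_eq_iff by blast
      moreover have "y = z \<oplus>\<^bsub>V\<^esub> (y \<ominus>\<^bsub>V\<^esub> z)"
        using c y z by (simp add: a_minus_def M.a_ac M.r_neg1 M.r_neg)
      ultimately show "y \<in> Z \<uplus> N" unfolding mem_vsum using z by blast
    qed
  next
    assume le: "Y \<subseteq> Z \<uplus> N"
    show "\<pi> ` Y \<subseteq> \<pi> ` Z"
    proof
      fix u assume "u \<in> \<pi> ` Y"
      then obtain y where y: "y \<in> Y" "u = \<pi> y" by auto
      then obtain z n where zn: "z \<in> Z" "n \<in> N" "y = z \<oplus>\<^bsub>V\<^esub> n" using le unfolding subset_iff mem_vsum by blast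
      then have "y \<ominus>\<^bsub>V\<^esub> z = n" using c by (simp add: a_minus_def M.a_ac M.r_neg1 M.r_neg)
      then have "u = \<pi> z" using coset_eq_iff zn y c by simp
      then show "u \<in> \<pi> ` Z" using zn by auto
    qed
  }
qed

lemma coset_image_eq_iff:
  assumes Y: "sub Y" "Y \<subseteq> X" and Z: "sub Z" "Z \<subseteq> X"
  shows "\<pi> ` Y = \<pi> ` Z \<longleftrightarrow> Y \<subseteq> Z \<uplus> N \<and> Z \<subseteq> Y \<uplus> N"
  using coset_image_subset_iff[OF Y Z] coset_image_subset_iff[OF Z Y] by (metis subset_antisym equalityE)

lemma coset_image_N:
  assumes Y: "sub Y" "Y \<subseteq> X" shows "\<pi> ` (Y \<uplus> N) = \<pi> ` Y"
proof -
  have "sub (Y \<uplus> N)" "Y \<uplus> N \<subseteq> X" using Y N NX X by (auto intro: sub_vsum vsum_least[THEN subsetD])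
  then show ?thesis using coset_image_subset_iff Y vsum_upper1[OF Y(1) N]
    by (metis image_mono subset_antisym subset_refl)
qed

lemma coset_image_Int:
  assumes Y: "sub Y" "Y \<subseteq> X" and Z: "sub Z" "Z \<subseteq> X"
  shows "\<pi> ` Y \<inter> \<pi> ` Z = \<pi> ` ((Y \<uplus> N) \<inter> (Z \<uplus> N))"
proof
  have "\<pi> ` ((Y \<uplus> N) \<inter> (Z \<uplus> N)) \<subseteq> \<pi> ` (Y \<uplus> N) \<inter> \<pi> ` (Z \<uplus> N)" by auto
  then show "\<pi> ` ((Y \<uplus> N) \<inter> (Z \<uplus> N)) \<subseteq> \<pi> ` Y \<inter> \<pi> ` Z"
    using coset_image_N[OF Y] coset_image_N[OF Z] by simp
  note c = subsetD[OF sub_carrier[OF Y(1)]] subsetD[OF sub_carrier[OF Z(1)]] subsetD[OF sub_carrier[OF N]]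
  show "\<pi> ` Y \<inter> \<pi> ` Z \<subseteq> \<pi> ` ((Y \<uplus> N) \<inter> (Z \<uplus> N))"
  proof
    fix u assume "u \<in> \<pi> ` Y \<inter> \<pi> ` Z"
    then obtain y z where yz: "y \<in> Y" "z \<in> Z" "u = \<pi> y" "\<pi> y = \<pi> z" by auto
    then have "y \<ominus>\<^bsub>V\<^esub> z \<in> N" using c coset_eq_iff by blast
    moreover have "y = z \<oplus>\<^bsub>V\<^esub> (y \<ominus>\<^bsub>V\<^esub> z)"
      using c yz by (simp add: a_minus_def M.a_ac M.r_neg1 M.r_neg)
    ultimately have "y \<in> Z \<uplus> N" unfolding mem_vsum using yz by blast
    moreover have "y \<in> Y \<uplus> N" using vsum_upper1[OF Y(1) N] yz by blast
    ultimately show "u \<in> \<pi> ` ((Y \<uplus> N) \<inter> (Z \<uplus> N))" using yz by blast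
  qed
qed

lemma coset_image_sub:
  assumes Y: "sub Y" "Y \<subseteq> X" shows "csubspace Q (\<pi> ` Y)"
proof -
  interpret Q: complex_space Q using XQ.W.vectorspace_axioms by (simp add: complex_space_def)
  note c = subsetD[OF Y(2)]
  show ?thesis
  proof (rule Q.subI)
    show "\<pi> ` Y \<subseteq> carrier Q" using Y carrier_Q by auto
    show "\<zero>\<^bsub>Q\<^esub> \<in> \<pi> ` Y" using zero_Q sub_zero[OF Y(1)] by auto
    fix u assume "u \<in> \<pi> ` Y"
    then obtain y where y: "y \<in> Y" "u = \<pi> y" by auto
    show "k \<odot>\<^bsub>Q\<^esub> u \<in> \<pi> ` Y" for k
      using y XQ.f_smult[of k y] c sub_smult[OF Y(1), of y k] by auto
    fix w assume "w \<in> \<pi> ` Y"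
    then obtain z where z: "z \<in> Y" "w = \<pi> z" by auto
    then show "u \<oplus>\<^bsub>Q\<^esub> w \<in> \<pi> ` Y"
      using y XQ.f_add[of y z] c sub_add[OF Y(1), of y z] by auto
  qed
qed

lemma coset_image_vsum:
  assumes Y: "sub Y" "Y \<subseteq> X" and Z: "sub Z" "Z \<subseteq> X"
  shows "\<pi> ` Y <+>\<^bsub>Q\<^esub> \<pi> ` Z = \<pi> ` (Y \<uplus> Z)"
proof -
  have "\<pi> y \<oplus>\<^bsub>Q\<^esub> \<pi> z = \<pi> (y \<oplus>\<^bsub>V\<^esub> z)" if "y \<in> Y" "z \<in> Z" for y z
    using XQ.f_add[of y z] that Y Z by auto
  then show ?thesis by (auto simp: set_add_def' image_UN)
qed

lemma coset_image_Span:
  assumes Y: "\<And>i. i \<in> S \<Longrightarrow> sub (Y i) \<and> Y i \<subseteq> X"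
  shows "Sum_spaces Q S (\<lambda>i. \<pi> ` Y i) = \<pi> ` Span S Y"
proof
  interpret Q: complex_space Q using XQ.W.vectorspace_axioms by (simp add: complex_space_def)
  have s: "sub (Span S Y)" "Span S Y \<subseteq> X"
    by (rule sub_Span, use Y in blast) (rule Span_least[OF X], use Y in blast)
  show "Sum_spaces Q S (\<lambda>i. \<pi> ` Y i) \<subseteq> \<pi> ` Span S Y"
    by (rule Q.Span_least[OF coset_image_sub[OF s]]) (use Y Span_upper[of S Y] in blast)
  let ?Z = "{x \<in> X. \<pi> x \<in> Sum_spaces Q S (\<lambda>i. \<pi> ` Y i)}"
  have q: "csubspace Q (Sum_spaces Q S (\<lambda>i. \<pi> ` Y i))" using Y coset_image_sub by (blast intro: Q.sub_Span)
  have "sub ?Z"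
  proof (rule subI)
    show "?Z \<subseteq> carrier V" using sub_carrier[OF X] by auto
    show "\<zero>\<^bsub>V\<^esub> \<in> ?Z" using Q.sub_zero[OF q] zero_Q sub_zero[OF X] by simp
    show "k \<odot>\<^bsub>V\<^esub> x \<in> ?Z" if "x \<in> ?Z" for k x
      using that XQ.f_smult[of k x] Q.sub_smult[OF q, of "\<pi> x" k] sub_smult[OF X, of x k] by auto
    show "x \<oplus>\<^bsub>V\<^esub> y \<in> ?Z" if "x \<in> ?Z" "y \<in> ?Z" for x y
      using that XQ.f_add[of x y] Q.sub_add[OF q, of "\<pi> x" "\<pi> y"] sub_add[OF X, of x y] by auto
  qed
  moreover have "Y i \<subseteq> ?Z" if "i \<in> S" for i
    using Q.Span_upper[of S "\<lambda>i. \<pi> ` Y i" i] that Y coset_image_sub by blast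
  ultimately have "Span S Y \<subseteq> ?Z" by (rule Span_least)
  then show "\<pi> ` Span S Y \<subseteq> Sum_spaces Q S (\<lambda>i. \<pi> ` Y i)" by auto
qed

lemma coset_image_Int_trivial_iff:
  assumes Y: "sub Y" "Y \<subseteq> X" and Z: "sub Z" "Z \<subseteq> X"
  shows "\<pi> ` Y \<inter> \<pi> ` Z = {\<zero>\<^bsub>Q\<^esub>} \<longleftrightarrow> (Y \<uplus> N) \<inter> (Z \<uplus> N) \<subseteq> N"
proof -
  have s: "sub ((Y \<uplus> N) \<inter> (Z \<uplus> N))" by (intro sub_Int sub_vsum Y Z N)
  have s': "(Y \<uplus> N) \<inter> (Z \<uplus> N) \<subseteq> X" using vsum_least[OF X Y(2) NX] by blast
  have z: "{\<zero>\<^bsub>Q\<^esub>} = \<pi> ` {\<zero>\<^bsub>V\<^esub>}" using zero_Q by simp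
  have z': "sub {\<zero>\<^bsub>V\<^esub>}" "{\<zero>\<^bsub>V\<^esub>} \<subseteq> X" using sub_bot sub_zero[OF X] by auto
  have n: "{\<zero>\<^bsub>V\<^esub>} \<uplus> N = N"
    using vsum_absorb[OF N sub_bot] vsum_comm[OF N sub_bot] sub_zero[OF N] by simp
  have "{\<zero>\<^bsub>V\<^esub>} \<subseteq> (Y \<uplus> N) \<inter> (Z \<uplus> N) \<uplus> N"
    using sub_zero[OF sub_vsum[OF s N]] by simp
  then show ?thesis
    unfolding coset_image_Int[OF Y Z] z coset_image_eq_iff[OF s s' z'] n by blast
qed

text \<open>
  The pieces are given by their full preimages \<open>H i\<close>, so no multiple of \<open>N\<close> has to be added to them.
\<close>

lemma direct_sum_quotient_iff:
  assumes T: "sub T" "T \<subseteq> X" and H: "\<And>i. i \<in> S \<Longrightarrow> sub (H i) \<and> H i \<subseteq> X \<and> N \<subseteq> H i"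
  shows "is_direct_sum Q (\<pi> ` T) S (\<lambda>i. \<pi> ` H i) \<longleftrightarrow>
    T \<subseteq> Span S H \<uplus> N \<and> Span S H \<subseteq> T \<uplus> N \<and> (\<forall>i\<in>S. H i \<inter> (Span (S - {i}) H \<uplus> N) \<subseteq> N)"
proof -
  have s: "sub (Span S' H)" "Span S' H \<subseteq> X" if "S' \<subseteq> S" for S'
    by (rule sub_Span, use H that in blast) (rule Span_least[OF X], use H that in blast)
  have sp: "Sum_spaces Q S' (\<lambda>i. \<pi> ` H i) = \<pi> ` Span S' H" if "S' \<subseteq> S" for S'
    using that H coset_image_Span[of S' H] by blast
  have "\<pi> ` H i \<inter> \<pi> ` Span (S - {i}) H = {\<zero>\<^bsub>Q\<^esub>} \<longleftrightarrow> H i \<inter> (Span (S - {i}) H \<uplus> N) \<subseteq> N"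
    if "i \<in> S" for i
  proof -
    have "H i \<uplus> N = H i" using vsum_absorb[of "H i" N] H[OF that] N by blast
    then show ?thesis
      using coset_image_Int_trivial_iff[of "H i" "Span (S - {i}) H"] s[OF Diff_subset] H[OF that] by simp
  qed
  then show ?thesis
    unfolding is_direct_sum_def sp[OF Diff_subset] sp[OF subset_refl] coset_image_eq_iff[OF T s[OF subset_refl]]
    by (simp add: conj_assoc)
qed

end

text \<open>
  The two clauses say that the images of \<open>F p\<close> and \<open>G (n + 1 - p)\<close> span the \<open>n\<close>-th graded piece and
  meet in zero there; the quotient is avoided by adding \<open>W (n - 1)\<close>.
\<close>

definition opposed_on_graded ::
    "'v cspace \<Rightarrow> (int \<Rightarrow> 'v set) \<Rightarrow> (int \<Rightarrow> 'v set) \<Rightarrow> (int \<Rightarrow> 'v set) \<Rightarrow> bool" where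
  "opposed_on_graded V W F G \<longleftrightarrow> (\<forall>n p.
     W n \<subseteq> ((W n \<inter> F p) <+>\<^bsub>V\<^esub> (W n \<inter> G (n + 1 - p))) <+>\<^bsub>V\<^esub> W (n - 1) \<and>
     ((W n \<inter> F p) <+>\<^bsub>V\<^esub> W (n - 1)) \<inter> ((W n \<inter> G (n + 1 - p)) <+>\<^bsub>V\<^esub> W (n - 1)) \<subseteq> W (n - 1))"

lemma mixed_Hodge_iff:
  "mixed_Hodge V W F G \<longleftrightarrow> fd_cspace V \<and> ascending_filtration V W \<and>
     descending_filtration V F \<and> descending_filtration V G \<and> opposed_on_graded V W F G"
proof (cases "fd_cspace V \<and> ascending_filtration V W \<and> descending_filtration V F \<and> descending_filtration V G")
  case True
  interpret complex_space V using True by (simp add: complex_space_def fd_cspace_def)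
  have fd: "fin_dim" using True by (simp add: fd_cspace_def)
  have "pure_Hodge n (Gr V W n) (\<lambda>p. Gr_sub V W n (F p)) (\<lambda>p. Gr_sub V W n (G p)) \<longleftrightarrow> (\<forall>p.
     W n \<subseteq> ((W n \<inter> F p) \<uplus> (W n \<inter> G (n + 1 - p))) \<uplus> W (n - 1) \<and>
     ((W n \<inter> F p) \<uplus> W (n - 1)) \<inter> ((W n \<inter> G (n + 1 - p)) \<uplus> W (n - 1)) \<subseteq> W (n - 1))" for n
  proof -
    interpret q: subquotient V "W (n - 1)" "W n"
      by unfold_locales (use True in \<open>auto simp: ascending_filtration_def\<close>)
    have gr: "Gr V W n = q.Q" by (simp add: Gr_def)
    have desc: "descending_filtration q.Q (\<lambda>p. Gr_sub V W n (H p))" if H: "descending_filtration V H" for H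
      unfolding descending_filtration_def
    proof (intro conjI allI impI)
      show "csubspace q.Q (Gr_sub V W n (H p))" for p
        unfolding Gr_sub_def by (rule q.coset_image_sub) (use H q.X in \<open>auto simp: descending_filtration_def sub_Int\<close>)
      show "Gr_sub V W n (H p') \<subseteq> Gr_sub V W n (H p)" if "p \<le> p'" for p p'
        unfolding Gr_sub_def using H that by (intro image_mono) (auto simp: descending_filtration_def)
      obtain p where "H p = carrier V" using H by (auto simp: descending_filtration_def)
      then have "W n \<inter> H p = W n" using sub_carrier[OF q.X] by auto
      then show "\<exists>p. Gr_sub V W n (H p) = carrier q.Q" using q.carrier_Q by (metis Gr_sub_def)
      obtain p where "H p = {\<zero>\<^bsub>V\<^esub>}" using H by (auto simp: descending_filtration_def)
      then have "W n \<inter> H p = {\<zero>\<^bsub>V\<^esub>}" using sub_zero[OF q.X] by auto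
      then show "\<exists>p. Gr_sub V W n (H p) = {\<zero>\<^bsub>q.Q\<^esub>}" using q.zero_Q by (metis Gr_sub_def image_empty image_insert)
    qed
    have FG: "sub (W n \<inter> F p)" "sub (W n \<inter> G p)" "W n \<inter> F p \<subseteq> W n" "W n \<inter> G p \<subseteq> W n" for p
      using True q.X by (auto simp: descending_filtration_def sub_Int)
    have "carrier q.Q = Gr_sub V W n (F p) <+>\<^bsub>q.Q\<^esub> Gr_sub V W n (G p') \<longleftrightarrow>
        W n \<subseteq> ((W n \<inter> F p) \<uplus> (W n \<inter> G p')) \<uplus> W (n - 1)" for p p'
    proof -
      have s: "sub ((W n \<inter> F p) \<uplus> (W n \<inter> G p'))" "(W n \<inter> F p) \<uplus> (W n \<inter> G p') \<subseteq> W n"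
        by (intro sub_vsum FG) (intro vsum_least q.X FG)
      show ?thesis
        unfolding Gr_sub_def q.coset_image_vsum[OF FG(1,3) FG(2,4)] q.carrier_Q
          q.coset_image_eq_iff[OF q.X subset_refl s]
        using s(2) vsum_upper1[OF q.X q.N] by blast
    qed
    moreover have "Gr_sub V W n (F p) \<inter> Gr_sub V W n (G p') = {\<zero>\<^bsub>q.Q\<^esub>} \<longleftrightarrow>
        ((W n \<inter> F p) \<uplus> W (n - 1)) \<inter> ((W n \<inter> G p') \<uplus> W (n - 1)) \<subseteq> W (n - 1)" for p p'
      unfolding Gr_sub_def by (rule q.coset_image_Int_trivial_iff[OF FG(1,3) FG(2,4)])
    ultimately show ?thesis
      unfolding pure_Hodge_def gr using True by (simp add: q.fd_Q[OF fd] desc)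
  qed
  then show ?thesis unfolding mixed_Hodge_def opposed_on_graded_def using True by blast
qed (auto simp: mixed_Hodge_def)

context complex_space
begin

lemma mixed_Hodge_on_iff:
  assumes fd: "fin_dim" and W: "ascending_filtration V W" and F: "descending_filtration V F"
    and G: "descending_filtration V G" and U: "sub U"
  shows "mixed_Hodge_on V U W F G \<longleftrightarrow>
    opposed_on_graded V (\<lambda>n. U \<inter> W n) (\<lambda>p. U \<inter> F p) (\<lambda>p. U \<inter> G p)"
proof -
  let ?U = "V\<lparr>carrier := U\<rparr>"
  have s: "csubspace ?U (U \<inter> Y)" if "sub Y" for Y using that U by (simp add: sub_restrict sub_Int)
  have e: "U \<inter> carrier V = U" "U \<inter> {\<zero>\<^bsub>V\<^esub>} = {\<zero>\<^bsub>V\<^esub>}" using sub_carrier[OF U] sub_zero[OF U] by auto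
  have "ascending_filtration ?U (\<lambda>n. U \<inter> W n)"
    unfolding ascending_filtration_def
  proof (intro conjI allI impI)
    show "csubspace ?U (U \<inter> W n)" for n using W s by (simp add: ascending_filtration_def)
    show "U \<inter> W m \<subseteq> U \<inter> W n" if "m \<le> n" for m n
      using W that by (auto simp: ascending_filtration_def)
    obtain k l where "W k = {\<zero>\<^bsub>V\<^esub>}" "W l = carrier V" using W by (auto simp: ascending_filtration_def)
    then show "\<exists>n. U \<inter> W n = {\<zero>\<^bsub>?U\<^esub>}" "\<exists>n. U \<inter> W n = carrier ?U"
      using e by (auto intro: exI[of _ k] exI[of _ l])
  qed
  moreover have "descending_filtration ?U (\<lambda>n. U \<inter> H n)" if H: "descending_filtration V H" for H
    unfolding descending_filtration_def
  proof (intro conjI allI impI)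
    show "csubspace ?U (U \<inter> H n)" for n using H s by (simp add: descending_filtration_def)
    show "U \<inter> H n \<subseteq> U \<inter> H m" if "m \<le> n" for m n
      using H that by (auto simp: descending_filtration_def)
    obtain k l where "H k = {\<zero>\<^bsub>V\<^esub>}" "H l = carrier V" using H by (auto simp: descending_filtration_def)
    then show "\<exists>n. U \<inter> H n = {\<zero>\<^bsub>?U\<^esub>}" "\<exists>n. U \<inter> H n = carrier ?U"
      using e by (auto intro: exI[of _ k] exI[of _ l])
  qed
  ultimately show ?thesis
    unfolding mixed_Hodge_on_def mixed_Hodge_iff opposed_on_graded_def vsum_restrict
    using F G finite_dimensional_subspace[OF fd U] by simp
qed

end

section \<open>Deligne subspaces\<close>

text \<open>
  The index type \<open>'k\<close> is \<open>int\<close> for one mixed Hodge structure and \<open>'g \<Rightarrow> int\<close> for a plectic structure,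
  where \<open>F\<close> and \<open>G\<close> are the intersections \<open>multi_F\<close> and \<open>multi_Fb\<close>. The space \<open>X\<close> being filtered may be
  smaller than the carrier, because the splitting is also applied to subspaces such as a step of another
  filtration.
\<close>

locale bifiltered = complex_space +
  fixes W :: "int \<Rightarrow> 'a set" and F G :: "'k::ordered_ab_group_add \<Rightarrow> 'a set" and tot :: "'k \<Rightarrow> int" and X
  assumes tot_add: "tot (a + b) = tot a + tot b"
    and tot_mono: "a \<le> b \<Longrightarrow> tot a \<le> tot b"
    and directed: "\<exists>c. c \<le> a \<and> c \<le> (b::'k)"
    and W: "csubspace V (W n)" and F: "csubspace V (F p)" and G: "csubspace V (G p)"
    and W_mono: "m \<le> n \<Longrightarrow> W m \<subseteq> W n" and F_mono: "p \<le> r \<Longrightarrow> F r \<subseteq> F p"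
    and G_mono: "p \<le> r \<Longrightarrow> G r \<subseteq> G p"
    and W_bot: "\<exists>n. W n = {\<zero>\<^bsub>V\<^esub>}" and W_le: "W n \<subseteq> X" and W_top: "\<exists>n. W n = X" and F_top: "\<exists>p. F p = X"
begin

text \<open>
  \<open>P n p\<close>, \<open>Q n q\<close> and \<open>H n (p, q)\<close> are the preimages in \<open>W n\<close> of \<open>F p\<close>, \<open>G q\<close> and of their intersection in
  the \<open>n\<close>-th graded piece; \<open>A (p, q)\<close> is Deligne's lift of the last one for \<open>n = tot (p + q)\<close>.
\<close>

definition P where "P n p = (W n \<inter> F p) \<uplus> W (n - 1)"
definition Q where "Q n q = (W n \<inter> G q) \<uplus> W (n - 1)"
definition H where "H n = (\<lambda>(r, s). P n r \<inter> Q n s)"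
definition low where "low n q = Span {j. 0 \<le> j} (\<lambda>j. G (q - j) \<inter> W (n - tot j - 1))"
definition A where
  "A = (\<lambda>(p, q). (F p \<inter> W (tot (p + q))) \<inter> ((G q \<inter> W (tot (p + q))) \<uplus> low (tot (p + q)) q))"

lemma tot_zero: "tot 0 = 0" using tot_add[of 0 0] by simp
lemma tot_diff: "tot (a - b) = tot a - tot b" using tot_add[of "a - b" b] by simp

lemma sub_P: "sub (P n p)" and sub_Q: "sub (Q n p)"
  unfolding P_def Q_def by (intro sub_vsum sub_Int W F G)+

lemma sub_H: "sub (H n i)"
  unfolding H_def by (cases i) (simp add: sub_Int sub_P sub_Q)

lemma sub_SpanH: "sub (Span T (H n))" by (intro sub_Span sub_H)

lemma P_le: "P n p \<subseteq> W n" and Q_le: "Q n p \<subseteq> W n"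
  unfolding P_def Q_def by (intro vsum_least W W_mono Int_lower1; simp)+

lemma W_le_P: "W (n - 1) \<subseteq> P n p" and W_le_Q: "W (n - 1) \<subseteq> Q n p"
  unfolding P_def Q_def by (intro vsum_upper2 sub_Int W F G)+

lemma H_le: "H n i \<subseteq> W n" and W_le_H: "W (n - 1) \<subseteq> H n i"
  unfolding H_def using P_le W_le_P W_le_Q by (cases i; fastforce)+

lemma sub_low: "sub (low n q)"
  unfolding low_def by (intro sub_Span sub_Int G W)

lemma low_le: "low n q \<subseteq> W (n - 1)"
  unfolding low_def
proof (rule Span_least[OF W])
  fix j :: 'k assume "j \<in> {j. 0 \<le> j}"
  then have "n - tot j - 1 \<le> n - 1" using tot_mono[of 0 j] tot_zero by simp
  then show "G (q - j) \<inter> W (n - tot j - 1) \<subseteq> W (n - 1)" using W_mono by blast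
qed

lemma le_low: "G q \<inter> W (n - 1) \<subseteq> low n q"
  using Span_upper[of "{j. 0 \<le> j}" "\<lambda>j. G (q - j) \<inter> W (n - tot j - 1)" 0]
  unfolding low_def by (simp add: tot_zero sub_Int G W)

lemma sub_A: "sub (A i)"
  unfolding A_def by (cases i) (simp add: sub_Int sub_vsum sub_low F G W)

lemma A_le_F: "A (p, q) \<subseteq> F p" and A_le_W: "A (p, q) \<subseteq> W (tot (p + q))"
  and A_le_G: "A (p, q) \<subseteq> (G q \<inter> W (tot (p + q))) \<uplus> low (tot (p + q)) q"
  unfolding A_def by auto

lemma A_le_P: "A (p, q) \<subseteq> P (tot (p + q)) p"
  using A_le_F A_le_W vsum_upper1[of "W (tot (p + q)) \<inter> F p" "W (tot (p + q) - 1)"] W F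
  unfolding P_def by (blast intro: sub_Int)

lemma A_le_Q: "A (p, q) \<subseteq> Q (tot (p + q)) q"
proof -
  have "(G q \<inter> W (tot (p + q))) \<uplus> low (tot (p + q)) q \<subseteq> Q (tot (p + q)) q"
    unfolding Q_def by (rule vsum_mono[OF _ low_le]) blast
  then show ?thesis using A_le_G by blast
qed

lemma sub_SpanA: "sub (Span T A)" by (intro sub_Span sub_A)

lemma A_le_H: "A (p, q) \<subseteq> H (tot (p + q)) (p, q)"
  unfolding H_def using Int_greatest[OF A_le_P A_le_Q] by simp

lemma W_descent:
  assumes "x \<in> W m" "\<And>k. k \<le> m \<Longrightarrow> x \<in> W k \<Longrightarrow> x \<in> W (k - 1)"
  shows "x = \<zero>\<^bsub>V\<^esub>"
proof -
  obtain b where b: "W b = {\<zero>\<^bsub>V\<^esub>}" using W_bot by blast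
  have "x \<in> W (m - int d)" for d
  proof (induction d)
    case (Suc d)
    then show ?case using assms(2)[of "m - int d"] by (simp add: algebra_simps)
  qed (use assms in simp)
  then have "x \<in> W (m - int (nat (m - b)))" .
  then have "x \<in> W b" using W_mono[of "m - int (nat (m - b))" b] assms(1) W_mono[of m b] by (cases "b \<le> m") auto
  then show ?thesis using b by simp
qed

end

text \<open>
  The first two axioms say that \<open>H\<close> decomposes the graded pieces compatibly with \<open>F\<close>. In
  the third, the sum runs over all \<open>G q\<close> of large enough degree in any direction: for tuples it is
  stronger than the opposedness of single \<open>F p\<close> and \<open>G q\<close>, and expresses that the total filtrations are
  opposed. The fourth allows elements of \<open>H\<close> to be lifted to \<open>A\<close>.
\<close>

locale deligne = bifiltered +
  assumes P_split: "P n p \<subseteq> Span {(r, s). p \<le> r \<and> tot (r + s) = n} (H n) \<uplus> W (n - 1)"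
    and H_indep: "p \<le> r \<Longrightarrow> tot (r + s) = n \<Longrightarrow>
      H n (r, s) \<inter> (Span ({(r, s). p \<le> r \<and> tot (r + s) = n} - {(r, s)}) (H n) \<uplus> W (n - 1)) \<subseteq> W (n - 1)"
    and opposed: "F p \<inter> ((W m \<inter> Span {q. m + 1 - tot p \<le> tot q} G) \<uplus> W (m - 1)) \<subseteq> W (m - 1)"
    and exchange: "n = tot (p + q) \<Longrightarrow>
      ((F p \<inter> W n) \<uplus> (G q \<inter> W n)) \<inter> W (n - 1) \<subseteq> (F p \<inter> W (n - 1)) \<uplus> low n q"
begin

text \<open>
  \<open>A\<close> injects into the graded piece. A vector of the intersection lies in \<open>F p\<close> and in \<open>low\<close>. If it lies in
  \<open>W m\<close> with \<open>m < n\<close>, then modulo \<open>W (m - 1)\<close> only the summands of \<open>low\<close> with \<open>tot j < n - m\<close> remain, and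
  their degree is large enough for opposedness to push the vector into \<open>W (m - 1)\<close>.
\<close>

lemma A_Int_lower: assumes n: "n = tot (p + q)" shows "A (p, q) \<inter> W (n - 1) \<subseteq> {\<zero>\<^bsub>V\<^esub>}"
proof
  fix x assume x: "x \<in> A (p, q) \<inter> W (n - 1)"
  have "A (p, q) \<inter> W (n - 1) \<subseteq> (low n q \<uplus> (G q \<inter> W n)) \<inter> W (n - 1)"
    using A_le_G[of p q] vsum_comm[OF sub_low sub_Int[OF G W]] n by auto
  also have "\<dots> \<subseteq> low n q \<uplus> ((G q \<inter> W n) \<inter> W (n - 1))"
    by (intro modular sub_low sub_Int G W low_le)
  also have "\<dots> \<subseteq> low n q"
    using le_low by (intro vsum_least sub_low) auto
  finally have xl: "x \<in> low n q" using x by blast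
  have xF: "x \<in> F p" using x A_le_F by blast
  have "x \<in> W (m - 1)" if m: "m \<le> n - 1" "x \<in> W m" for m
  proof -
    let ?T = "Span {q. m + 1 - tot p \<le> tot q} G"
    have T: "sub ?T" by (intro sub_Span G)
    have "low n q \<subseteq> W (m - 1) \<uplus> ?T"
      unfolding low_def
    proof (rule Span_least[OF sub_vsum[OF W T]])
      fix j :: 'b assume "j \<in> {j. 0 \<le> j}"
      show "G (q - j) \<inter> W (n - tot j - 1) \<subseteq> W (m - 1) \<uplus> ?T"
      proof (cases "tot j \<le> n - 1 - m")
        case True
        then have "G (q - j) \<subseteq> ?T"
          using n by (intro Span_upper G) (simp add: tot_add tot_diff)
        then show ?thesis using vsum_upper2[OF W T] by blast
      next
        case False
        then show ?thesis using W_mono[of "n - tot j - 1" "m - 1"] vsum_upper1[OF W T] by fastforce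
      qed
    qed
    then have "x \<in> (W (m - 1) \<uplus> ?T) \<inter> W m" using xl m by blast
    then have "x \<in> W (m - 1) \<uplus> (?T \<inter> W m)"
      using modular[OF W T W, of "m - 1" m] W_mono[of "m - 1" m] by auto
    then have "x \<in> (W m \<inter> ?T) \<uplus> W (m - 1)"
      using vsum_comm[OF W sub_Int[OF W T], of "m - 1" m] by (simp add: Int_commute)
    then show ?thesis using opposed[of p m] xF by blast
  qed
  then show "x \<in> {\<zero>\<^bsub>V\<^esub>}" using W_descent[of x "n - 1"] x by blast
qed

text \<open>
  \<open>A\<close> surjects onto the component of the graded piece. If a vector of \<open>F p \<inter> W n\<close> differs from one of
  \<open>G q \<inter> W n\<close> by \<open>W (n - 1)\<close>, then \<open>exchange\<close> splits this difference into a part that can be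
  subtracted from the first vector within \<open>F p\<close> and a part in \<open>low n q\<close>.
\<close>

lemma H_eq: assumes n: "n = tot (p + q)" shows "H n (p, q) = A (p, q) \<uplus> W (n - 1)"
proof
  show "A (p, q) \<uplus> W (n - 1) \<subseteq> H n (p, q)"
    using A_le_H[of p q] W_le_H n by (intro vsum_least sub_H) auto
  let ?F = "F p \<inter> W n" and ?F' = "F p \<inter> W (n - 1)" and ?G = "G q \<inter> W n" and ?W = "W (n - 1)"
  let ?l = "low n q"
  note subs = sub_vsum sub_Int F G W sub_low sub_A
  have "H n (p, q) \<subseteq> (?W \<uplus> ?F) \<inter> (?G \<uplus> ?W)"
    unfolding H_def P_def Q_def using vsum_comm[of ?F ?W] subs by (simp add: Int_commute)
  also have "\<dots> \<subseteq> ?W \<uplus> (?F \<inter> (?G \<uplus> ?W))"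
    by (intro modular subs vsum_upper2)
  also have "\<dots> \<subseteq> A (p, q) \<uplus> ?W"
  proof (intro vsum_least subs vsum_upper2)
    have "?F \<inter> (?G \<uplus> ?W) \<subseteq> (?G \<uplus> ?W) \<inter> (?F \<uplus> ?G)"
      using vsum_upper1[of ?F ?G] subs by blast
    also have "\<dots> \<subseteq> ?G \<uplus> (?W \<inter> (?F \<uplus> ?G))" by (intro modular subs vsum_upper2)
    also have "\<dots> \<subseteq> ?G \<uplus> (?F' \<uplus> ?l)"
      using exchange[OF n] by (intro vsum_mono) auto
    also have "\<dots> \<subseteq> ?F' \<uplus> (?G \<uplus> ?l)"
    proof (intro vsum_least subs)
      show "?G \<subseteq> ?F' \<uplus> (?G \<uplus> ?l)" "?l \<subseteq> ?F' \<uplus> (?G \<uplus> ?l)"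
        using vsum_upper1[of ?G ?l] vsum_upper2[of ?G ?l] vsum_upper2[of ?F' "?G \<uplus> ?l"] subs by blast+
      show "?F' \<subseteq> ?F' \<uplus> (?G \<uplus> ?l)" by (intro vsum_upper1 subs)
    qed
    finally have "?F \<inter> (?G \<uplus> ?W) \<subseteq> (?F' \<uplus> (?G \<uplus> ?l)) \<inter> ?F" by blast
    also have "\<dots> \<subseteq> ?F' \<uplus> ((?G \<uplus> ?l) \<inter> ?F)"
      using W_mono[of "n - 1" n] by (intro modular subs) auto
    also have "\<dots> \<subseteq> A (p, q) \<uplus> ?W"
    proof (intro vsum_least subs)
      show "?F' \<subseteq> A (p, q) \<uplus> ?W" using vsum_upper2[of "A (p, q)" ?W] subs by blast
      have "(?G \<uplus> ?l) \<inter> ?F = A (p, q)" by (simp add: A_def n Int_commute)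
      then show "(?G \<uplus> ?l) \<inter> ?F \<subseteq> A (p, q) \<uplus> ?W" using vsum_upper1[of "A (p, q)" ?W] subs by simp
    qed
    finally show "?F \<inter> (?G \<uplus> ?W) \<subseteq> A (p, q) \<uplus> ?W" .
  qed
  finally show "H n (p, q) \<subseteq> A (p, q) \<uplus> ?W" .
qed

text \<open>
  Induction on \<open>n\<close>: the image of \<open>F p \<inter> W n\<close> in the graded piece is a sum of components with \<open>r \<ge> p\<close>, and
  these lift to \<open>A (r, s) \<subseteq> F r \<subseteq> F p\<close>, so that the remainder stays in \<open>F p\<close>.
\<close>

lemma F_Int_W: "F p \<inter> W n = Span {(r, s). p \<le> r \<and> tot (r + s) \<le> n} A"
proof
  let ?S = "\<lambda>n. {(r, s). p \<le> r \<and> tot (r + s) \<le> n}"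
  show "Span (?S n) A \<subseteq> F p \<inter> W n"
  proof (rule Span_least[OF sub_Int[OF F W]])
    fix i assume "i \<in> ?S n"
    then obtain r s where i: "i = (r, s)" "p \<le> r" "tot (r + s) \<le> n" by auto
    show "A i \<subseteq> F p \<inter> W n"
      using subset_trans[OF A_le_F[of r s] F_mono[OF i(2)]] subset_trans[OF A_le_W[of r s] W_mono[OF i(3)]] i(1)
      by simp
  qed
  obtain b where b: "W b = {\<zero>\<^bsub>V\<^esub>}" using W_bot by blast
  show "F p \<inter> W n \<subseteq> Span (?S n) A"
  proof (cases "b \<le> n")
    case False
    then have "W n \<subseteq> {\<zero>\<^bsub>V\<^esub>}" using b W_mono[of n b] by auto
    then show ?thesis using sub_zero[OF sub_SpanA[of "?S n"]] by blast
  next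
    case True
    then show ?thesis
    proof (induction n rule: int_ge_induct)
      case base
      then show ?case using b sub_zero[OF sub_SpanA[of "?S b"]] by auto
    next
      case (step n)
      let ?T = "{(r, s). p \<le> r \<and> tot (r + s) = n + 1}"
      have "Span ?T (H (n + 1)) \<subseteq> Span ?T A \<uplus> W n"
      proof (rule Span_least[OF sub_vsum[OF sub_SpanA W]])
        fix i assume i: "i \<in> ?T"
        then obtain r s where "i = (r, s)" "tot (r + s) = n + 1" by auto
        then have "H (n + 1) i = A i \<uplus> W n" using H_eq[of "n + 1" r s] by simp
        then show "H (n + 1) i \<subseteq> Span ?T A \<uplus> W n"
          using vsum_mono[OF Span_upper[OF sub_A i] order_refl] by simp
      qed
      then have "P (n + 1) p \<subseteq> Span ?T A \<uplus> W n"
        using P_split[of "n + 1" p] vsum_least[OF sub_vsum[OF sub_SpanA[of ?T] W[of n]] _ vsum_upper2[OF sub_SpanA W]]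
          order_trans[of "P (n + 1) p" "Span ?T (H (n + 1)) \<uplus> W n" "Span ?T A \<uplus> W n"]
        by simp
      moreover have "F p \<inter> W (n + 1) \<subseteq> P (n + 1) p"
        unfolding P_def using vsum_upper1[OF sub_Int[OF W F] W] by blast
      ultimately have "F p \<inter> W (n + 1) \<subseteq> (Span ?T A \<uplus> W n) \<inter> F p" by blast
      also have "\<dots> \<subseteq> Span ?T A \<uplus> (W n \<inter> F p)"
      proof (intro modular sub_SpanA W F Span_least)
        fix i assume "i \<in> ?T"
        then obtain r s where i: "i = (r, s)" "p \<le> r" by auto
        then show "A i \<subseteq> F p" using subset_trans[OF A_le_F[of r s] F_mono[OF i(2)]] by simp
      qed
      also have "\<dots> \<subseteq> Span (?S (n + 1)) A"
      proof (intro vsum_least sub_SpanA)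
        show "Span ?T A \<subseteq> Span (?S (n + 1)) A" by (rule Span_mono) auto
        have "Span (?S n) A \<subseteq> Span (?S (n + 1)) A" by (rule Span_mono) auto
        then show "W n \<inter> F p \<subseteq> Span (?S (n + 1)) A" using step.IH by blast
      qed
      finally show ?case .
    qed
  qed
qed

lemma finite_lower_bound: "finite R \<Longrightarrow> \<exists>p. \<forall>r\<in>R. p \<le> (r::'b)"
proof (induction R rule: finite_induct)
  case (insert x R)
  then obtain p where p: "\<forall>r\<in>R. p \<le> r" by blast
  obtain c where "c \<le> x" "c \<le> p" using directed by blast
  then show ?case using p by (auto intro: order_trans)
qed simp

lemma A_independent: "independent A"
proof (rule independent_if_weights[where wt = "\<lambda>(r, s). tot (r + s)", OF sub_A])
  fix i J assume J: "finite J" "i \<notin> J" and wt: "\<And>j. j \<in> J \<Longrightarrow> (case j of (r, s) \<Rightarrow> tot (r + s)) \<le> (case i of (r, s) \<Rightarrow> tot (r + s))"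
  obtain r s where i: "i = (r, s)" by (cases i)
  define n where "n = tot (r + s)"
  \<comment> \<open>A common lower bound puts all indices of a finite relation into one decomposition.\<close>
  obtain p where p: "\<forall>r\<in>insert r (fst ` J). p \<le> r" using finite_lower_bound[of "insert r (fst ` J)"] J by auto
  let ?T = "{(r, s). p \<le> r \<and> tot (r + s) = n} - {(r, s)}"
  have sT: "sub (Span ?T (H n) \<uplus> W (n - 1))" by (intro sub_vsum sub_Span sub_H W)
  have "Span J A \<subseteq> Span ?T (H n) \<uplus> W (n - 1)"
  proof (rule Span_least[OF sT])
    fix j assume j: "j \<in> J"
    obtain r' s' where j': "j = (r', s')" by (cases j)
    show "A j \<subseteq> Span ?T (H n) \<uplus> W (n - 1)"
    proof (cases "tot (r' + s') = n")
      case True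
      then have "j \<in> ?T" using j j' p J i by force
      then have "H n j \<subseteq> Span ?T (H n)" by (intro Span_upper sub_H)
      moreover have "A j \<subseteq> H n j" using A_le_H[of r' s'] True j' by simp
      ultimately show ?thesis using vsum_upper1[OF sub_SpanH[of ?T n] W[of "n - 1"]] by blast
    next
      case False
      then have "tot (r' + s') \<le> n - 1" using wt[OF j] j' i n_def by simp
      then have "A j \<subseteq> W (n - 1)" using subset_trans[OF A_le_W[of r' s'] W_mono] j' by simp
      then show ?thesis using vsum_upper2[OF sub_SpanH[of ?T n] W[of "n - 1"]] by blast
    qed
  qed
  moreover have "A i \<subseteq> H n i" using A_le_H[of r s] i n_def by simp
  ultimately have "A i \<inter> Span J A \<subseteq> A i \<inter> W (n - 1)"
    using H_indep[of p r s n] p i n_def by blast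
  then show "A i \<inter> Span J A \<subseteq> {\<zero>\<^bsub>V\<^esub>}" using A_Int_lower[OF n_def] i by blast
qed

lemma Span_A: "Span UNIV A = X"
proof
  obtain n p where np: "W n = X" "F p = X" using W_top F_top by blast
  show "X \<subseteq> Span UNIV A" using F_Int_W[of p n] np Span_mono[OF subset_UNIV] by blast
  have "sub X" using W[of n] np by simp
  then show "Span UNIV A \<subseteq> X"
  proof (rule Span_least)
    show "A i \<subseteq> X" for i using subset_trans[OF A_le_W W_le] by (cases i) simp
  qed
qed

end

text \<open>
  Deligne's classical situation, one mixed Hodge structure. Opposedness alone gives the other axioms:
  the components of the graded pieces arise by descending induction on \<open>p\<close>, and \<open>exchange\<close>
  holds because already all of \<open>W (n - 1)\<close> lies in its right-hand side.
\<close>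

lemma (in complex_space) deligne_of_opposed:
  fixes W F G :: "int \<Rightarrow> 'v set"
  assumes W: "\<And>n. sub (W n)" and F: "\<And>n. sub (F n)" and G: "\<And>n. sub (G n)"
    and W_mono: "\<And>m n. m \<le> n \<Longrightarrow> W m \<subseteq> W n" and F_mono: "\<And>m n. m \<le> n \<Longrightarrow> F n \<subseteq> F m"
    and G_mono: "\<And>m n. m \<le> n \<Longrightarrow> G n \<subseteq> G m"
    and W_bot: "\<exists>n. W n = {\<zero>\<^bsub>V\<^esub>}" and W_le: "\<And>n. W n \<subseteq> X" and W_top: "\<exists>n. W n = X"
    and F_top: "\<exists>p. F p = X" and F_bot: "\<exists>p. F p = {\<zero>\<^bsub>V\<^esub>}"
    and op: "opposed_on_graded V W F G"
  shows "deligne V W F G (\<lambda>n. n) X"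
proof -
  interpret bifiltered V W F G "\<lambda>n. n" X
  proof
    show "\<exists>c. c \<le> a \<and> c \<le> b" for a b :: int by (rule exI[of _ "min a b"]) simp
  qed (use assms in auto)
  have op1: "W n \<subseteq> ((W n \<inter> F p) \<uplus> (W n \<inter> G (n + 1 - p))) \<uplus> W (n - 1)"
    and op2: "P n p \<inter> Q n (n + 1 - p) \<subseteq> W (n - 1)" for n p
    using op unfolding opposed_on_graded_def P_def Q_def by blast+
  note subs = sub_vsum sub_Int sub_P sub_Q W F G sub_low
  have P_mono: "P n r \<subseteq> P n p" if "p \<le> r" for n p r
    unfolding P_def using F_mono[OF that] by (intro vsum_mono) auto
  have Q_mono: "Q n r \<subseteq> Q n p" if "p \<le> r" for n p r
    unfolding Q_def using G_mono[OF that] by (intro vsum_mono) auto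
  have PQ: "W n \<subseteq> P n p \<uplus> Q n (n + 1 - p)" for n p
  proof -
    have "W n \<inter> F p \<subseteq> P n p" "W n \<inter> G (n + 1 - p) \<subseteq> Q n (n + 1 - p)"
      unfolding P_def Q_def by (intro vsum_upper1 subs)+
    moreover have "P n p \<subseteq> P n p \<uplus> Q n (n + 1 - p)" "Q n (n + 1 - p) \<subseteq> P n p \<uplus> Q n (n + 1 - p)"
      by (intro vsum_upper1 vsum_upper2 subs)+
    ultimately have "((W n \<inter> F p) \<uplus> (W n \<inter> G (n + 1 - p))) \<uplus> W (n - 1) \<subseteq> P n p \<uplus> Q n (n + 1 - p)"
      using W_le_P[of n p] by (intro vsum_least subs) blast+
    then show ?thesis using op1 by blast
  qed
  show ?thesis
  proof
    fix n p :: int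
    let ?S = "\<lambda>p. {(r, s). p \<le> r \<and> r + s = n}"
    obtain p1 where p1: "F p1 = {\<zero>\<^bsub>V\<^esub>}" using F_bot by blast
    have big: "P n p \<subseteq> Span (?S p) (H n) \<uplus> W (n - 1)" if "p1 \<le> p" for p
    proof -
      have "W n \<inter> F p \<subseteq> W (n - 1)" using F_mono[OF that] p1 sub_zero[OF W] by auto
      then have "P n p \<subseteq> W (n - 1)" unfolding P_def by (intro vsum_least W order_refl)
      then show ?thesis using vsum_upper2[OF sub_SpanH[of "?S p" n] W[of "n - 1"]] by blast
    qed
    show "P n p \<subseteq> Span (?S p) (H n) \<uplus> W (n - 1)"
    proof (cases "p1 \<le> p")
      case False
      then have "p \<le> p1" by simp
      then show ?thesis
      proof (induction p rule: int_le_induct)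
        case base
        show ?case by (rule big) simp
      next
        case (step p)
        let ?R = "Span (?S (p - 1)) (H n) \<uplus> W (n - 1)"
        have R: "sub ?R" by (intro sub_vsum sub_SpanH W)
        have "P n (p - 1) \<subseteq> (P n p \<uplus> Q n (n + 1 - p)) \<inter> P n (p - 1)"
          using PQ[of n p] P_le[of n "p - 1"] by blast
        also have "\<dots> \<subseteq> P n p \<uplus> (Q n (n + 1 - p) \<inter> P n (p - 1))"
          by (intro modular subs P_mono) simp
        also have "\<dots> \<subseteq> ?R"
        proof (intro vsum_least R)
          have "Span (?S p) (H n) \<subseteq> Span (?S (p - 1)) (H n)" by (rule Span_mono) auto
          then show "P n p \<subseteq> ?R" using step.IH vsum_mono[OF _ order_refl] by blast
          have "H n (p - 1, n + 1 - p) \<subseteq> Span (?S (p - 1)) (H n)"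
            by (rule Span_upper[OF sub_H]) simp
          then show "Q n (n + 1 - p) \<inter> P n (p - 1) \<subseteq> ?R"
            using vsum_upper1[OF sub_SpanH[of "?S (p - 1)" n] W[of "n - 1"]] by (auto simp: H_def)
        qed
        finally show ?case .
      qed
    qed (rule big)
  next
    fix p r s n :: int assume pr: "p \<le> r" and n: "r + s = n"
    let ?T = "{(r, s). p \<le> r \<and> r + s = n} - {(r, s)}"
    have e: "n + 1 - r = s + 1" "n - r = s" using n by auto
    let ?R = "P n (r + 1) \<uplus> Q n (s + 1)"
    have R: "P n (r + 1) \<subseteq> ?R" "Q n (s + 1) \<subseteq> ?R" by (intro vsum_upper1 vsum_upper2 subs)+
    \<comment> \<open>Every other component has a larger first or a larger second index.\<close>
    have "Span ?T (H n) \<subseteq> ?R"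
    proof (rule Span_least)
      fix i assume "i \<in> ?T"
      then obtain r' s' where i: "i = (r', s')" "r' + s' = n" and ne: "(r', s') \<noteq> (r, s)" by auto
      then have "r' \<noteq> r" using n by auto
      show "H n i \<subseteq> ?R"
      proof (cases "r < r'")
        case True
        then have "P n r' \<subseteq> P n (r + 1)" by (intro P_mono) simp
        then show ?thesis using R i by (auto simp: H_def)
      next
        case False
        then have "Q n s' \<subseteq> Q n (s + 1)" using i n \<open>r' \<noteq> r\<close> by (intro Q_mono) simp
        then show ?thesis using R i by (auto simp: H_def)
      qed
    qed (intro subs)
    then have "Span ?T (H n) \<uplus> W (n - 1) \<subseteq> ?R"
      using order_trans[OF W_le_P R(1)] by (intro vsum_least subs)
    then have "H n (r, s) \<inter> (Span ?T (H n) \<uplus> W (n - 1)) \<subseteq> (?R \<inter> P n r) \<inter> Q n s"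
      by (auto simp: H_def)
    also have "?R \<inter> P n r \<subseteq> P n (r + 1) \<uplus> (Q n (s + 1) \<inter> P n r)"
      by (intro modular subs P_mono) simp
    also have "\<dots> \<subseteq> P n (r + 1)"
    proof (intro vsum_least subs order_refl)
      have "Q n (s + 1) \<inter> P n r \<subseteq> W (n - 1)" using op2[of n r] e by (simp add: Int_commute)
      then show "Q n (s + 1) \<inter> P n r \<subseteq> P n (r + 1)" by (rule order_trans[OF _ W_le_P])
    qed
    also have "P n (r + 1) \<inter> Q n s \<subseteq> W (n - 1)" using op2[of n "r + 1"] e by simp
    finally show "H n (r, s) \<inter> (Span ?T (H n) \<uplus> W (n - 1)) \<subseteq> W (n - 1)" by blast
  next
    fix p m :: int
    have "Span {q. m + 1 - p \<le> q} G \<subseteq> G (m + 1 - p)" by (rule Span_least[OF G]) (auto intro: G_mono[THEN subsetD])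
    then have "(W m \<inter> Span {q. m + 1 - p \<le> q} G) \<uplus> W (m - 1) \<subseteq> Q m (m + 1 - p)"
      unfolding Q_def by (intro vsum_mono) auto
    moreover have "F p \<inter> W m \<subseteq> P m p" unfolding P_def using vsum_upper1[OF sub_Int[OF W F] W, of m p "m - 1"] by (simp add: Int_commute)
    ultimately show "F p \<inter> ((W m \<inter> Span {q. m + 1 - p \<le> q} G) \<uplus> W (m - 1)) \<subseteq> W (m - 1)"
      using Q_le[of m "m + 1 - p"] op2[of m p] by blast
  next
    fix n p q :: int assume n: "n = p + q"
    let ?R = "(F p \<inter> W (n - 1)) \<uplus> low n q"
    have R: "sub ?R" by (intro subs)
    \<comment> \<open>Starting from the bottom of \<open>W\<close>, the step \<open>W k\<close> is covered with \<open>j = n - 1 - k\<close>.\<close>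
    obtain b where b: "W b = {\<zero>\<^bsub>V\<^esub>}" using W_bot by blast
    have low: "W k \<inter> G (k + 1 - p) \<subseteq> low n q" if "k \<le> n - 1" for k
      using Span_upper[of "{j. 0 \<le> j}" "\<lambda>j. G (q - j) \<inter> W (n - j - 1)" "n - 1 - k"] that n
      unfolding low_def by (simp add: subs algebra_simps Int_commute)
    have "W k \<subseteq> ?R" if "k \<le> n - 1" for k
    proof (cases "b \<le> k")
      case False
      then show ?thesis using W_mono[of k b] b sub_zero[OF R] by auto
    next
      case True
      then show ?thesis using that
      proof (induction k rule: int_ge_induct)
        case base
        then show ?case using b sub_zero[OF R] by auto
      next
        case (step k)
        have "W (k + 1) \<inter> F p \<subseteq> F p \<inter> W (n - 1)" using W_mono[of "k + 1" "n - 1"] step by auto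
        moreover have "F p \<inter> W (n - 1) \<subseteq> ?R" "low n q \<subseteq> ?R" by (intro vsum_upper1 vsum_upper2 subs)+
        ultimately have "((W (k + 1) \<inter> F p) \<uplus> (W (k + 1) \<inter> G (k + 1 + 1 - p))) \<uplus> W (k + 1 - 1) \<subseteq> ?R"
          using low[of "k + 1"] step by (intro vsum_least R) auto
        then show ?case using op1[of "k + 1" p] by blast
      qed
    qed
    then show "((F p \<inter> W n) \<uplus> (G q \<inter> W n)) \<inter> W (n - 1) \<subseteq> ?R" by blast
  qed
qed

section \<open>Graded subspaces and combined splittings\<close>

context complex_space
begin

lemma independent_unique:
  assumes A: "independent A" and "a \<in> A i" "a' \<in> A i" "b \<in> Span (-{i}) A" "b' \<in> Span (-{i}) A"
    and eq: "a \<oplus>\<^bsub>V\<^esub> b = a' \<oplus>\<^bsub>V\<^esub> b'"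
  shows "a = a'" and "b = b'"
proof -
  have s: "sub (A i)" "sub (Span (-{i}) A)" using A by (auto intro: independent_sub sub_Span)
  have c: "a \<in> carrier V" "a' \<in> carrier V" "b \<in> carrier V" "b' \<in> carrier V"
    using assms s sub_carrier by blast+
  have d: "a' \<ominus>\<^bsub>V\<^esub> a \<in> A i" "b' \<in> Span (-{i}) A" using assms sub_minus[OF s(1)] by auto
  have "(a' \<ominus>\<^bsub>V\<^esub> a) \<oplus>\<^bsub>V\<^esub> b' = \<ominus>\<^bsub>V\<^esub> a \<oplus>\<^bsub>V\<^esub> (a' \<oplus>\<^bsub>V\<^esub> b')"
    using c by (simp add: a_minus_def M.a_ac)
  also have "\<dots> = b" unfolding eq[symmetric] using c by (simp add: M.r_neg1)
  finally have "(a' \<ominus>\<^bsub>V\<^esub> a) \<oplus>\<^bsub>V\<^esub> b' \<in> Span (-{i}) A" using assms by simp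
  then have "a' \<ominus>\<^bsub>V\<^esub> a \<in> Span (-{i}) A"
    using sub_cancel_right[OF s(2) d(2)] c by simp
  moreover have "a' \<ominus>\<^bsub>V\<^esub> a \<in> Span {i} A" 
    using d(1) Span_upper[of "{i}" A i, OF independent_sub[OF A]] by auto
  ultimately have "a' \<ominus>\<^bsub>V\<^esub> a \<in> Span ({i} \<inter> -{i}) A" unfolding independent_Int[OF A, symmetric] by blast
  then have z: "a' \<ominus>\<^bsub>V\<^esub> a = \<zero>\<^bsub>V\<^esub>" by (simp add: Span_empty)
  have "a' = (a' \<ominus>\<^bsub>V\<^esub> a) \<oplus>\<^bsub>V\<^esub> a" using c by (simp add: a_minus_def M.a_assoc M.l_neg)
  then show "a = a'" using c unfolding z by simp
  then have "\<ominus>\<^bsub>V\<^esub> a \<oplus>\<^bsub>V\<^esub> (a \<oplus>\<^bsub>V\<^esub> b) = \<ominus>\<^bsub>V\<^esub> a \<oplus>\<^bsub>V\<^esub> (a \<oplus>\<^bsub>V\<^esub> b')" using eq by simp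
  then show "b = b'" using c by (simp add: M.r_neg1)
qed

text \<open>
  Stability under the projections to the pieces of \<open>A\<close>. Comparing one index with all others makes
  the closure under intersections a consequence of uniqueness of the two components.
\<close>

definition graded :: "('i \<Rightarrow> 'v set) \<Rightarrow> 'v set \<Rightarrow> bool" where
  "graded A U \<longleftrightarrow> (\<forall>i. U \<subseteq> (U \<inter> A i) \<uplus> (U \<inter> Span (-{i}) A))"

lemma graded_if_Span:
  assumes A: "\<And>i. sub (A i)" and U: "sub U" and le: "U \<subseteq> Span UNIV (\<lambda>i. U \<inter> A i)"
  shows "graded A U"
  unfolding graded_def
proof
  fix i
  have s: "sub (U \<inter> A i)" for i using U A by (rule sub_Int)
  have "Span UNIV (\<lambda>i. U \<inter> A i) = (U \<inter> A i) \<uplus> Span (-{i}) (\<lambda>i. U \<inter> A i)"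
    using Span_insert[of "\<lambda>i. U \<inter> A i" i "-{i}"] s by (simp add: insert_absorb Compl_eq_Diff_UNIV insert_Diff_if)
  moreover have "Span (-{i}) (\<lambda>i. U \<inter> A i) \<subseteq> U \<inter> Span (-{i}) A"
  proof (rule Span_least)
    show "sub (U \<inter> Span (-{i}) A)" using U A by (intro sub_Int sub_Span)
    show "U \<inter> A j \<subseteq> U \<inter> Span (-{i}) A" if "j \<in> -{i}" for j
      using Span_upper[of "-{i}" A j] A that by blast
  qed
  ultimately show "U \<subseteq> (U \<inter> A i) \<uplus> (U \<inter> Span (-{i}) A)"
    using le vsum_mono[of "U \<inter> A i" "U \<inter> A i" "Span (-{i}) (\<lambda>i. U \<inter> A i)" "U \<inter> Span (-{i}) A"] by auto
qed

lemma graded_Span: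
  assumes A: "\<And>i. sub (A i)" and U: "\<And>k. k \<in> S \<Longrightarrow> sub (U k)" and g: "\<And>k. k \<in> S \<Longrightarrow> graded A (U k)"
  shows "graded A (Span S U)"
  unfolding graded_def
proof
  fix i
  let ?R = "(Span S U \<inter> A i) \<uplus> (Span S U \<inter> Span (-{i}) A)"
  have SU: "sub (Span S U)" using U by (rule sub_Span)
  have "U k \<subseteq> ?R" if "k \<in> S" for k
  proof -
    have "U k \<subseteq> Span S U" by (rule Span_upper[OF U that])
    then have "(U k \<inter> A i) \<uplus> (U k \<inter> Span (-{i}) A) \<subseteq> ?R" by (intro vsum_mono) auto
    then show ?thesis using g[OF that] unfolding graded_def by blast
  qed
  then show "Span S U \<subseteq> ?R"
    by (intro Span_least sub_vsum sub_Int SU A sub_Span[of "-{i}" A])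
qed

lemma graded_vsum:
  assumes A: "\<And>i. sub (A i)" and "sub X" "sub Y" "graded A X" "graded A Y" shows "graded A (X \<uplus> Y)"
proof -
  have "Span {True, False} (\<lambda>b. if b then X else Y) = X \<uplus> Span {False} (\<lambda>b. if b then X else Y)"
    using assms by (subst Span_insert) auto
  also have "Span {False} (\<lambda>b. if b then X else Y) = Y"
    using assms Span_insert[of "\<lambda>b. if b then X else Y" False "{}"]
    by (simp add: Span_empty vsum_absorb sub_bot sub_zero)
  finally have "X \<uplus> Y = Span {True, False} (\<lambda>b. if b then X else Y)" by simp
  show ?thesis unfolding \<open>X \<uplus> Y = _\<close> by (rule graded_Span[OF A]) (use assms in auto)
qed

lemma graded_INT:
  assumes A: "independent A" and "S \<noteq> {}" and g: "\<And>k. k \<in> S \<Longrightarrow> graded A (U k)"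
  shows "graded A (\<Inter>k\<in>S. U k)"
  unfolding graded_def
proof (intro allI subsetI)
  fix i x assume x: "x \<in> (\<Inter>k\<in>S. U k)"
  have split: "\<exists>a\<in>U k \<inter> A i. \<exists>b\<in>U k \<inter> Span (-{i}) A. x = a \<oplus>\<^bsub>V\<^esub> b" if "k \<in> S" for k
    unfolding mem_vsum[symmetric] using g[OF that] x that unfolding graded_def by auto
  obtain k0 where k0: "k0 \<in> S" using assms(2) by auto
  then obtain a b where ab: "a \<in> A i" "b \<in> Span (-{i}) A" "x = a \<oplus>\<^bsub>V\<^esub> b"
    using split by blast
  have "a \<in> U k \<and> b \<in> U k" if k: "k \<in> S" for k
  proof -
    obtain a' b' where ab': "a' \<in> U k \<inter> A i" "b' \<in> U k \<inter> Span (-{i}) A" "x = a' \<oplus>\<^bsub>V\<^esub> b'"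
      using split[OF k] by blast
    have "a \<oplus>\<^bsub>V\<^esub> b = a' \<oplus>\<^bsub>V\<^esub> b'" using ab(3) ab'(3) by (rule subst)
    then have "a = a'" "b = b'"
      using independent_unique[OF A ab(1) _ ab(2), of a' b'] ab' by blast+
    then show ?thesis using ab' by blast
  qed
  then show "x \<in> ((\<Inter>k\<in>S. U k) \<inter> A i) \<uplus> ((\<Inter>k\<in>S. U k) \<inter> Span (-{i}) A)"
    unfolding mem_vsum using ab by blast
qed

lemma graded_Int:
  assumes "independent A" "graded A X" "graded A Y" shows "graded A (X \<inter> Y)"
proof -
  have "X \<inter> Y = (\<Inter>b\<in>{True, False}. if b then X else Y)" by auto
  then show ?thesis using graded_INT[OF assms(1), of "{True, False}" "\<lambda>b. if b then X else Y"] assms by auto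
qed

lemma graded_carrier:
  assumes "splitting A" shows "graded A (carrier V)"
  by (rule graded_if_Span) (use assms in \<open>auto simp: splitting_def independent_sub sub_top Int_absorb1 sub_carrier\<close>)

text \<open>
  A vector of \<open>U\<close> involves finitely many pieces, and splitting off one component at a time never leaves
  \<open>U\<close>.
\<close>

lemma graded_expand:
  assumes A: "splitting A" and U: "sub U" and g: "graded A U"
  shows "U \<subseteq> Span UNIV (\<lambda>i. U \<inter> A i)"
proof -
  have ind: "independent A" and sA: "sub (A i)" for i using A by (auto simp: splitting_def independent_sub)
  let ?R = "Span UNIV (\<lambda>i. U \<inter> A i)"
  have R: "sub ?R" using U sA by (intro sub_Span sub_Int)
  have "U \<inter> Span J A \<subseteq> ?R" if "finite J" for J
    using that
  proof (induction J rule: finite_induct)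
    case empty
    then show ?case using sub_zero[OF R] by (auto simp: Span_empty)
  next
    case (insert i J)
    show ?case
    proof
      fix x assume x: "x \<in> U \<inter> Span (insert i J) A"
      then have "x \<in> A i \<uplus> Span J A" unfolding Span_insert[OF sA sA] by blast
      then obtain a b where ab: "a \<in> A i" "b \<in> Span J A" "x = a \<oplus>\<^bsub>V\<^esub> b"
        unfolding mem_vsum by blast
      have bb: "b \<in> Span (-{i}) A" using ab Span_mono[of J "-{i}" A] insert by auto
      obtain a' b' where ab': "a' \<in> U \<inter> A i" "b' \<in> U \<inter> Span (-{i}) A" "x = a' \<oplus>\<^bsub>V\<^esub> b'"
        using g x unfolding graded_def subset_iff mem_vsum by blast
      then have "a = a'" "b = b'" using independent_unique[OF ind, of a i a' b b'] ab bb by auto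
      then have "b \<in> ?R" using insert.IH ab ab' by blast
      moreover have "a' \<in> ?R" using Span_upper[of UNIV "\<lambda>i. U \<inter> A i" i] U sA ab' by (blast intro: sub_Int)
      ultimately show "x \<in> ?R" using sub_add[OF R] ab'(3) \<open>b = b'\<close> by simp
    qed
  qed
  note fin = this
  show ?thesis
  proof
    fix x assume x: "x \<in> U"
    then have xA: "x \<in> Span UNIV A" using A sub_carrier[OF U] unfolding splitting_def by blast
    obtain J where "finite J" "x \<in> Span J A" using Span_finite[OF xA sA] by blast
    then show "x \<in> ?R" using fin x by blast
  qed
qed



text \<open>
  Both halves go by induction on the set \<open>M\<close> of splittings already intersected. For spanning, an
  intersection over \<open>M\<close> is graded for the next splitting and is decomposed further. For
  independence, a piece \<open>f\<close> is compared with the sum of the complements \<open>?B \<mu>\<close> of its factors, which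
  contains every other piece; since this sum over \<open>M\<close> is graded for the next splitting \<open>\<nu>\<close>, adding
  \<open>?B \<nu>\<close> to it contributes nothing inside \<open>A \<nu> (f \<nu>)\<close>.
\<close>

lemma splitting_combine:
  fixes A :: "'m::finite \<Rightarrow> 'i \<Rightarrow> 'v set"
  assumes A: "\<And>\<mu>. splitting (A \<mu>)" and g: "\<And>\<mu> \<nu> i. \<mu> \<noteq> \<nu> \<Longrightarrow> graded (A \<nu>) (A \<mu> i)"
  shows "splitting (\<lambda>f. \<Inter>\<mu>. A \<mu> (f \<mu>))"
proof -
  have ind: "independent (A \<mu>)" and sA: "sub (A \<mu> i)" for \<mu> i using A by (auto simp: splitting_def independent_sub)
  let ?C = "\<lambda>f. \<Inter>\<mu>. A \<mu> (f \<mu>)" and ?D = "\<lambda>M f. carrier V \<inter> (\<Inter>\<mu>\<in>M. A \<mu> (f \<mu>))"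
  have sC: "sub (?C f)" for f by (rule sub_INT[OF sA]) simp
  \<comment> \<open>The carrier is kept as a factor so that the empty intersection is a subspace; \<open>None\<close> indexes it.\<close>
  have D_eq: "?D M f = (\<Inter>k\<in>insert None (Some ` M). case k of None \<Rightarrow> carrier V | Some \<mu> \<Rightarrow> A \<mu> (f \<mu>))" for M f
    by auto
  have sD: "sub (?D M f)" for M f
    unfolding D_eq
  proof (rule sub_INT)
    show "sub (case k of None \<Rightarrow> carrier V | Some \<mu> \<Rightarrow> A \<mu> (f \<mu>))" for k
      by (cases k) (simp_all add: sA sub_top)
  qed simp
  have gD: "graded (A \<nu>) (?D M f)" if \<nu>M: "\<nu> \<notin> M" for \<nu> M f
    unfolding D_eq
  proof (rule graded_INT[OF ind])
    fix k assume "k \<in> insert None (Some ` M)"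
    then consider "k = None" | \<mu> where "k = Some \<mu>" "\<mu> \<noteq> \<nu>" using \<nu>M by auto
    then show "graded (A \<nu>) (case k of None \<Rightarrow> carrier V | Some \<mu> \<Rightarrow> A \<mu> (f \<mu>))"
    proof cases
      case 1
      then show ?thesis by (simp add: graded_carrier[OF A])
    next
      case 2
      then show ?thesis using g[of \<mu> \<nu> "f \<mu>"] by simp
    qed
  qed simp
  have "carrier V \<subseteq> Span UNIV (?D M)" for M
    using finite[of M]
  proof (induction M rule: finite_induct)
    case empty
    then show ?case using Span_upper[of UNIV "?D {}"] sub_top by simp
  next
    case (insert \<nu> M)
    have "?D M f \<subseteq> Span UNIV (?D (insert \<nu> M))" for f
    proof -
      have "?D M f \<subseteq> Span UNIV (\<lambda>k. ?D M f \<inter> A \<nu> k)" by (rule graded_expand[OF A sD gD[OF insert(2)]])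
      also have "\<dots> \<subseteq> Span UNIV (?D (insert \<nu> M))"
      proof (rule Span_le[OF sD])
        fix k
        have "?D M f \<inter> A \<nu> k \<subseteq> ?D (insert \<nu> M) (f(\<nu> := k))" using insert(2) by auto
        then show "\<exists>j\<in>UNIV. ?D M f \<inter> A \<nu> k \<subseteq> ?D (insert \<nu> M) j" by blast
      qed
      finally show ?thesis .
    qed
    then have "Span UNIV (?D M) \<subseteq> Span UNIV (?D (insert \<nu> M))" by (intro Span_least sub_Span sD)
    then show ?case using insert(3) by blast
  qed
  note D_span = this
  have DC: "?D UNIV f = ?C f" for f using sub_carrier[OF sA] by blast
  have span: "carrier V \<subseteq> Span UNIV ?C" using D_span[of UNIV] unfolding DC .
  have "independent ?C"
  proof (rule independent_if_disjoint[OF sC])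
    fix f :: "'m \<Rightarrow> 'i" and J assume J: "finite J" "f \<notin> J"
    let ?B = "\<lambda>\<mu>. Span (-{f \<mu>}) (A \<mu>)"
    have sB: "sub (?B \<mu>)" for \<mu> using sA by (rule sub_Span)
    have gB: "graded (A \<nu>) (?B \<mu>)" if "\<mu> \<noteq> \<nu>" for \<mu> \<nu>
      using g[OF that] sA by (intro graded_Span) auto
    have zero: "A \<nu> (f \<nu>) \<inter> ?B \<nu> \<subseteq> {\<zero>\<^bsub>V\<^esub>}" for \<nu>
      using Span_upper[of "{f \<nu>}" "A \<nu>" "f \<nu>"] sA independent_Int[OF ind, of "{f \<nu>}" \<nu> "-{f \<nu>}"]
      by (auto simp: Span_empty)
    have "?D M f \<inter> Span M ?B \<subseteq> {\<zero>\<^bsub>V\<^esub>}" for M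
      using finite[of M]
    proof (induction M rule: finite_induct)
      case empty
      then show ?case by (simp add: Span_empty)
    next
      case (insert \<nu> M)
      let ?X = "Span M ?B" and ?A = "A \<nu> (f \<nu>)"
      have X: "sub ?X" using sB by (rule sub_Span)
      have "graded (A \<nu>) ?X"
      proof (rule graded_Span[OF sA sB])
        fix \<mu> assume "\<mu> \<in> M"
        then have "\<mu> \<noteq> \<nu>" using insert(2) by auto
        then show "graded (A \<nu>) (?B \<mu>)" by (rule gB)
      qed
      then have gX: "?X \<subseteq> (?X \<inter> ?A) \<uplus> (?X \<inter> ?B \<nu>)" unfolding graded_def by blast
      have "Span (insert \<nu> M) ?B = ?B \<nu> \<uplus> ?X" by (rule Span_insert[OF sB sB])
      also have "\<dots> \<subseteq> (?X \<inter> ?A) \<uplus> ?B \<nu>"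
      proof (intro vsum_least sub_vsum sub_Int X sB sA vsum_upper2)
        show "?X \<subseteq> (?X \<inter> ?A) \<uplus> ?B \<nu>"
          using gX vsum_mono[of "?X \<inter> ?A" "?X \<inter> ?A" "?X \<inter> ?B \<nu>" "?B \<nu>"] by blast
      qed
      finally have "Span (insert \<nu> M) ?B \<inter> ?A \<subseteq> ((?X \<inter> ?A) \<uplus> ?B \<nu>) \<inter> ?A" by blast
      also have "\<dots> \<subseteq> (?X \<inter> ?A) \<uplus> (?B \<nu> \<inter> ?A)" by (intro modular sub_Int X sA sB) auto
      also have "\<dots> \<subseteq> ?X"
        using zero[of \<nu>] sub_zero[OF X] by (intro vsum_least X) auto
      finally show ?case using insert(3) by auto
    qed
    from this[of UNIV] have "?C f \<inter> Span UNIV ?B \<subseteq> {\<zero>\<^bsub>V\<^esub>}" unfolding DC .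
    moreover have "Span J ?C \<subseteq> Span UNIV ?B"
    proof (rule Span_le[OF sB])
      fix h assume "h \<in> J"
      then obtain \<mu> where "h \<mu> \<noteq> f \<mu>" using J by (metis ext)
      then have "A \<mu> (h \<mu>) \<subseteq> ?B \<mu>" by (intro Span_upper sA) simp
      then show "\<exists>\<mu>\<in>UNIV. ?C h \<subseteq> ?B \<mu>" by blast
    qed
    ultimately show "?C f \<inter> Span J ?C \<subseteq> {\<zero>\<^bsub>V\<^esub>}" by blast
  qed
  then show ?thesis using span sub_carrier[OF sub_Span[of UNIV ?C]] sC by (auto simp: splitting_def)
qed


lemma splitting_reindex:
  assumes "splitting A" "bij h" shows "splitting (\<lambda>i. A (h i))"
proof -
  have "h ` S \<inter> h ` T = h ` (S \<inter> T)" for S T using assms(2) by (simp add: bij_def image_Int)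
  moreover have "h ` UNIV = UNIV" using assms(2) by (simp add: bij_def)
  moreover have "Span (h ` S) A \<inter> Span (h ` T) A \<subseteq> Span (h ` S \<inter> h ` T) A" for S T
    using assms(1) unfolding splitting_def independent_def by blast
  ultimately show ?thesis using assms(1) unfolding splitting_def independent_def
    by (simp add: Span_reindex[of _ A h])
qed

lemma independent_Span_INT:
  assumes A: "independent A" and "finite M" "M \<noteq> {}"
  shows "(\<Inter>\<mu>\<in>M. Span (S \<mu>) A) = Span (\<Inter>\<mu>\<in>M. S \<mu>) A"
  using assms(2,3)
proof (induction rule: finite_ne_induct)
  case (insert x F)
  then show ?case by (simp add: independent_Int[OF A])
qed simp

text \<open>
  If \<open>C\<close> refines \<open>A\<close> through \<open>h\<close>, nothing in \<open>Span S A\<close> can involve pieces of \<open>C\<close> lying over \<open>- S\<close>. With \<open>h\<close> a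
  coordinate, the filtrations of one factor are read off in a combined splitting.
\<close>

lemma Span_refine:
  assumes C: "splitting C" and A: "independent A" and le: "\<And>j. C j \<subseteq> A (h j)"
  shows "Span {j. h j \<in> S} C = Span S A"
proof
  have sA: "sub (A i)" and sC: "sub (C j)" for i j
    using A C by (auto simp: splitting_def independent_sub)
  have r: "Span {j. h j \<in> T} C \<subseteq> Span T A" for T
    using Span_le[of T A "{j. h j \<in> T}" C] sA le by blast
  show "Span {j. h j \<in> S} C \<subseteq> Span S A" by (rule r)
  let ?X = "Span {j. h j \<in> S} C" and ?Y = "Span {j. h j \<in> -S} C"
  have s: "sub (Span T C)" "sub (Span U A)" for T U using sC sA by (auto intro: sub_Span)
  have "carrier V = Span ({j. h j \<in> S} \<union> {j. h j \<in> -S}) C"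
  proof -
    have "{j. h j \<in> S} \<union> {j. h j \<in> -S} = UNIV" by auto
    then show ?thesis using C unfolding splitting_def by metis
  qed
  then have "Span S A \<subseteq> (?X \<uplus> ?Y) \<inter> Span S A"
    using sub_carrier[OF s(2)] Span_Un[of "{j. h j \<in> S}" "{j. h j \<in> -S}" C] sC by auto
  also have "\<dots> \<subseteq> ?X \<uplus> (?Y \<inter> Span S A)" by (intro modular s r)
  also have "\<dots> \<subseteq> ?X"
  proof (intro vsum_least s order_refl)
    have "?Y \<inter> Span S A \<subseteq> Span (-S) A \<inter> Span S A" using r[of "-S"] by blast
    also have "\<dots> = {\<zero>\<^bsub>V\<^esub>}" by (simp add: independent_Int[OF A] Span_empty)
    finally show "?Y \<inter> Span S A \<subseteq> ?X" using sub_zero[OF s(1)] by blast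
  qed
  finally show "Span S A \<subseteq> ?X" .
qed

text \<open>
  A finite generating set involves finitely many pieces. It makes the filtrations defined by a degree
  on the index set finite.
\<close>

lemma splitting_finite_support:
  assumes fd: "fin_dim" and A: "splitting A"
  shows "\<exists>J. finite J \<and> (\<forall>S. Span S A = Span (S \<inter> J) A)"
proof -
  have sA: "sub (A i)" for i using A by (auto simp: splitting_def independent_sub)
  obtain B where B: "finite B" "B \<subseteq> carrier V" "span B = carrier V" using fd unfolding fin_dim_def by blast
  have "\<exists>F. finite F \<and> b \<in> Span F A" if "b \<in> B" for b
    using Span_finite[of b UNIV A] sA that B(2) A unfolding splitting_def by blast
  then obtain F where F: "\<And>b. b \<in> B \<Longrightarrow> finite (F b) \<and> b \<in> Span (F b) A" by metis
  let ?J = "\<Union>b\<in>B. F b"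
  have J: "sub (Span ?J A)" using sA by (rule sub_Span)
  have "B \<subseteq> Span ?J A"
  proof
    fix b assume b: "b \<in> B"
    then have "Span (F b) A \<subseteq> Span ?J A" by (intro Span_mono) auto
    then show "b \<in> Span ?J A" using F[OF b] by blast
  qed
  then have "span B \<subseteq> Span ?J A"
    using J by (intro span_is_subset) (auto simp: csubspace_def VectorSpace.subspace_def)
  then have eq: "Span ?J A = carrier V" using B(3) sub_carrier[OF J] by blast
  have "Span S A = Span (S \<inter> ?J) A" for S
  proof -
    have "Span S A \<subseteq> carrier V" using sA by (intro sub_carrier sub_Span)
    then have "Span S A = Span S A \<inter> Span ?J A" using eq by auto
    also have "\<dots> = Span (S \<inter> ?J) A" using A by (intro independent_Int) (simp add: splitting_def)
    finally show ?thesis .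
  qed
  moreover have "finite ?J" using F B(1) by blast
  ultimately show ?thesis by blast
qed


text \<open>
  In the application \<open>Z\<close> is a partial and \<open>W\<close> the total weight filtration, with \<open>a\<close>, \<open>b\<close> the Hodge degrees
  that belong to \<open>Z\<close>. The splitting \<open>A\<close> computes \<open>F\<close>, the splitting \<open>A'\<close> computes \<open>G\<close>, and they agree
  modulo lower total weight, so on the graded pieces of \<open>W\<close> both filtrations are given by \<open>A\<close> and are opposed
  because of the degrees. This is lifted step by step along \<open>W\<close>. A third splitting \<open>B\<close> is needed
  because \<open>U\<close> need not be a sum of pieces of \<open>A'\<close>: in the lifting of the spanning property, intersecting
  with \<open>U\<close>, \<open>G\<close> and \<open>Z\<close> must commute with reduction modulo \<open>W (k - 1)\<close>, and for this one splitting must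
  contain them all.
\<close>

lemma opposed_of_splittings:
  fixes A A' :: "'i \<Rightarrow> 'v set" and B :: "'j \<Rightarrow> 'v set" and wt a b :: "'i \<Rightarrow> int"
  assumes A: "splitting A" and A': "splitting A'" and B: "independent B"
    and W_A: "\<And>k. W k = Span {i. wt i \<le> k} A" and W_A': "\<And>k. W k = Span {i. wt i \<le> k} A'"
    and Z_A: "\<And>n. Z n = Span {i. a i + b i \<le> n} A" and Z_A': "\<And>n. Z n = Span {i. a i + b i \<le> n} A'"
    and F_A: "\<And>p. F p = Span {i. p \<le> a i} A" and G_A': "\<And>q. G q = Span {i. q \<le> b i} A'"
    and U_A: "U = Span S A" and U_B: "U = Span T B"
    and B_forms: "\<And>n. \<exists>S. Z n = Span S B" "\<And>q. \<exists>S. G q = Span S B" "\<And>k. \<exists>S. W k = Span S B"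
    and cong: "\<And>i. A i \<subseteq> A' i \<uplus> W (wt i - 1)" "\<And>i. A' i \<subseteq> A i \<uplus> W (wt i - 1)"
    and W_bot: "W k0 = {\<zero>\<^bsub>V\<^esub>}" and W_top: "W k1 = carrier V"
  shows "opposed_on_graded V (\<lambda>n. U \<inter> Z n) (\<lambda>p. U \<inter> F p) (\<lambda>q. U \<inter> G q)"
proof -
  have indA: "independent A" and indA': "independent A'" using A A' by (auto simp: splitting_def)
  have sA: "sub (A i)" and sA': "sub (A' i)" for i
    using indA indA' by (auto simp: independent_sub)
  have W: "sub (W k)" and Z: "sub (Z n)" and F: "sub (F p)" and G: "sub (G q)" and U: "sub U" for k n p q
    unfolding W_A Z_A F_A G_A' U_A using sA sA' by (auto intro: sub_Span)
  note subs = sub_vsum sub_Int W Z F G U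
  have W_mono: "W k \<subseteq> W l" if "k \<le> l" for k l unfolding W_A using that by (intro Span_mono) auto
  have ascend: "E \<subseteq> R" if R: "sub R" and E: "E \<subseteq> carrier V"
      and up: "\<And>k. E \<inter> W (k - 1) \<subseteq> R \<Longrightarrow> E \<inter> W k \<subseteq> R" for E R
  proof -
    have "E \<inter> W k \<subseteq> R" for k
    proof (cases "k0 \<le> k")
      case True
      then show ?thesis
      proof (induction k rule: int_ge_induct)
        case base
        then show ?case using W_bot sub_zero[OF R] by auto
      next
        case (step k)
        then show ?case using up[of "k + 1"] by simp
      qed
    next
      case False
      then show ?thesis using W_mono[of k k0] W_bot sub_zero[OF R] by auto
    qed
    then show ?thesis using W_top E by blast
  qed
  have "U \<inter> Z n \<subseteq> (((U \<inter> Z n) \<inter> (U \<inter> F p)) \<uplus> ((U \<inter> Z n) \<inter> (U \<inter> G q))) \<uplus> (U \<inter> Z (n - 1))"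
    (is "?E \<subseteq> (?f \<uplus> ?g) \<uplus> ?N") if q: "q = n + 1 - p" for n p q
  proof (rule ascend)
    let ?R = "(?f \<uplus> ?g) \<uplus> ?N"
    show R: "sub ?R" by (intro subs)
    have "?f \<subseteq> ?f \<uplus> ?g" "?g \<subseteq> ?f \<uplus> ?g" "?f \<uplus> ?g \<subseteq> ?R" "?N \<subseteq> ?R"
      by (intro vsum_upper1 vsum_upper2 subs)+
    then have R_upper: "?f \<subseteq> ?R" "?g \<subseteq> ?R" "?N \<subseteq> ?R" by auto
    show "?E \<subseteq> carrier V" using sub_carrier[OF U] by blast
    fix k assume IH: "?E \<inter> W (k - 1) \<subseteq> ?R"
    have "?E \<inter> W k = Span (S \<inter> {i. a i + b i \<le> n} \<inter> {i. wt i \<le> k}) A"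
      unfolding U_A Z_A W_A independent_Int[OF indA] by simp
    also have "\<dots> \<subseteq> ?R"
    proof (rule Span_least[OF R])
      fix i assume i: "i \<in> S \<inter> {i. a i + b i \<le> n} \<inter> {i. wt i \<le> k}"
      have iE: "A i \<subseteq> U" "A i \<subseteq> Z n" unfolding U_A Z_A using i by (auto intro!: Span_upper sA del: subsetI)
      \<comment> \<open>If neither degree condition holds, then \<open>a i + b i = n\<close> and \<open>a i < p\<close> force \<open>b i \<ge> q\<close>.\<close>
      consider "wt i \<le> k - 1" | "p \<le> a i" | "a i + b i \<le> n - 1"
        | "wt i = k" "q \<le> b i" using i q by fastforce
      then show "A i \<subseteq> ?R"
      proof cases
        case 1
        then have "A i \<subseteq> W (k - 1)" unfolding W_A by (intro Span_upper sA) simp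
        then show ?thesis using iE IH by blast
      next
        case 2
        then have "A i \<subseteq> F p" unfolding F_A by (intro Span_upper sA) simp
        then show ?thesis using iE R_upper by blast
      next
        case 3
        then have "A i \<subseteq> Z (n - 1)" unfolding Z_A by (intro Span_upper sA) simp
        then show ?thesis using iE R_upper by blast
      next
        case 4
        have "A' i \<subseteq> G q" unfolding G_A' using 4 by (intro Span_upper sA') simp
        then have "A i \<subseteq> G q \<uplus> W (k - 1)" using cong(1)[of i] vsum_mono[of "A' i" "G q"] 4 by blast
        moreover obtain Sz Sg Sw where BB: "Z n = Span Sz B" "G q = Span Sg B" "W (k - 1) = Span Sw B"
          using B_forms by meson
        ultimately have "A i \<subseteq> (Span Sg B \<uplus> Span Sw B) \<inter> (Span T B \<inter> Span Sz B)"
          using iE U_B by auto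
        also have "\<dots> = Span (Sg \<inter> (T \<inter> Sz)) B \<uplus> Span (Sw \<inter> (T \<inter> Sz)) B"
          unfolding independent_Int[OF B] independent_Un[OF B] by (simp add: Int_Un_distrib2)
        also have "\<dots> = (G q \<inter> ?E) \<uplus> (W (k - 1) \<inter> ?E)"
          unfolding BB U_B independent_Int[OF B] ..
        also have "\<dots> \<subseteq> ?R" using IH R_upper(2) by (intro vsum_least R) auto
        finally show ?thesis .
      qed
    qed
    finally show "?E \<inter> W k \<subseteq> ?R" .
  qed
  moreover have "(((U \<inter> Z n) \<inter> (U \<inter> F p)) \<uplus> (U \<inter> Z (n - 1))) \<inter> (((U \<inter> Z n) \<inter> (U \<inter> G q)) \<uplus> (U \<inter> Z (n - 1)))
      \<subseteq> U \<inter> Z (n - 1)" (is "?Y1 \<inter> ?Y2 \<subseteq> ?N") if q: "q = n + 1 - p" for n p q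
  proof (rule ascend)
    let ?Y = "?Y1 \<inter> ?Y2"
    show N: "sub ?N" by (intro subs)
    have Y: "sub ?Y" by (intro subs)
    then show "?Y \<subseteq> carrier V" by (rule sub_carrier)
    have NY: "?N \<subseteq> ?Y" using vsum_upper2 subs by (meson Int_greatest)
    fix k assume IH: "?Y \<inter> W (k - 1) \<subseteq> ?N"
    define T1 where "T1 = S \<inter> ({i. p \<le> a i \<and> a i + b i \<le> n} \<union> {i. a i + b i \<le> n - 1})"
    define T2 where "T2 = {i. q \<le> b i} \<union> {i. a i + b i \<le> n - 1} \<union> {i. wt i \<le> k - 1}"
    have Y1: "?Y1 \<subseteq> Span T1 A"
      unfolding T1_def U_A Z_A F_A independent_Int[OF indA] independent_Un[OF indA] by (intro Span_mono) auto
    have "?Y2 \<subseteq> G q \<uplus> Z (n - 1)" by (intro vsum_mono) auto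
    then have "?Y2 \<inter> W k \<subseteq> Span (({i. q \<le> b i} \<union> {i. a i + b i \<le> n - 1}) \<inter> {i. wt i \<le> k}) A'"
      unfolding independent_Int[OF indA', symmetric] independent_Un[OF indA', symmetric]
        G_A'[symmetric] Z_A'[symmetric] W_A'[symmetric] by blast
    also have "\<dots> \<subseteq> Span T2 A"
    proof (rule Span_least[OF sub_Span[OF sA]])
      fix i assume i: "i \<in> ({i. q \<le> b i} \<union> {i. a i + b i \<le> n - 1}) \<inter> {i. wt i \<le> k}"
      have Wk: "W (k - 1) \<subseteq> Span T2 A" unfolding W_A T2_def by (intro Span_mono) auto
      have "A i \<subseteq> Span T2 A" unfolding T2_def using i by (intro Span_upper sA) auto
      then have "A i \<uplus> W (wt i - 1) \<subseteq> Span T2 A"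
        using order_trans[OF W_mono[of "wt i - 1" "k - 1"] Wk] i by (intro vsum_least sub_Span sA) auto
      then show "A' i \<subseteq> Span T2 A" using cong(2)[of i] by blast
    qed
    finally have "?Y \<inter> W k \<subseteq> Span T1 A \<inter> Span T2 A" using Y1 by blast
    also have "\<dots> = Span (T1 \<inter> T2) A" by (rule independent_Int[OF indA])
    also have "\<dots> \<subseteq> ?N \<uplus> W (k - 1)"
    proof (rule Span_least)
      show "sub (?N \<uplus> W (k - 1))" by (intro subs)
      fix i assume i: "i \<in> T1 \<inter> T2"
      have up: "?N \<subseteq> ?N \<uplus> W (k - 1)" "W (k - 1) \<subseteq> ?N \<uplus> W (k - 1)" by (intro vsum_upper1 vsum_upper2 subs)+
      \<comment> \<open>The remaining case \<open>p \<le> a i\<close>, \<open>q \<le> b i\<close>, \<open>a i + b i \<le> n\<close> contradicts \<open>p + q = n + 1\<close>.\<close>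
      consider "wt i \<le> k - 1" | "i \<in> S" "a i + b i \<le> n - 1" using i q unfolding T1_def T2_def by fastforce
      then show "A i \<subseteq> ?N \<uplus> W (k - 1)"
      proof cases
        case 1
        then have "A i \<subseteq> W (k - 1)" unfolding W_A by (intro Span_upper sA) simp
        then show ?thesis using up by blast
      next
        case 2
        then have "A i \<subseteq> U" "A i \<subseteq> Z (n - 1)" unfolding U_A Z_A by (auto intro!: Span_upper sA del: subsetI)
        then show ?thesis using up by blast
      qed
    qed
    finally have "?Y \<inter> W k \<subseteq> (?N \<uplus> W (k - 1)) \<inter> ?Y" by blast
    also have "\<dots> \<subseteq> ?N \<uplus> (W (k - 1) \<inter> ?Y)" by (rule modular[OF N W Y NY])
    also have "\<dots> \<subseteq> ?N" using IH by (intro vsum_least N) auto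
    finally show "?Y \<inter> W k \<subseteq> ?N" .
  qed
  ultimately show ?thesis unfolding opposed_on_graded_def by simp
qed

end

section \<open>Two splittings opposite modulo lower weight\<close>

text \<open>
  The converse to \<open>deligne\<close>: a splitting \<open>C\<close> that computes \<open>F\<close> and a splitting \<open>C'\<close> that computes \<open>G\<close> and
  agrees with \<open>C\<close> modulo lower weight yield all the axioms. In addition, \<open>C_low\<close> records how
  far the filtration index of \<open>G\<close> has to drop along with the weight; this is what \<open>exchange\<close> is about.
\<close>

locale opposite_splittings = bifiltered V W F G tot "carrier V"
  for V :: "'v cspace" and W and F G :: "'k::ordered_ab_group_add \<Rightarrow> 'v set" and tot +
  fixes C C' :: "'k \<times> 'k \<Rightarrow> 'v set"
  assumes C: "complex_space.splitting V C" and C': "complex_space.splitting V C'"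
    and F_C: "F p = Sum_spaces V {(r, s). p \<le> r} C" and G_C': "G q = Sum_spaces V {(r, s). q \<le> s} C'"
    and W_C: "W n = Sum_spaces V {(r, s). tot (r + s) \<le> n} C"
    and W_C': "W n = Sum_spaces V {(r, s). tot (r + s) \<le> n} C'"
    and C_low: "C (p, q) \<subseteq> (G q \<inter> W (tot (p + q))) <+>\<^bsub>V\<^esub> low (tot (p + q)) q"
    and C_C': "C (r, s) \<subseteq> C' (r, s) <+>\<^bsub>V\<^esub> W (tot (r + s) - 1)"
    and C'_C: "C' (r, s) \<subseteq> C (r, s) <+>\<^bsub>V\<^esub> W (tot (r + s) - 1)"
    and tot_strict: "a \<le> b \<Longrightarrow> tot a = tot b \<Longrightarrow> a = b"
    and tot_attain: "k \<le> tot r \<Longrightarrow> \<exists>p\<le>r. tot p = k"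
begin

definition wt :: "'k \<times> 'k \<Rightarrow> int" where "wt = (\<lambda>(r, s). tot (r + s))"

lemma wt [simp]: "wt (r, s) = tot r + tot s"
  by (simp add: wt_def tot_add)

lemma indC: "independent C" and indC': "independent C'"
  using C C' by (auto simp: splitting_def)

lemma sub_C: "sub (C i)" and sub_C': "sub (C' i)"
  using indC indC' by (auto simp: independent_sub)

lemma sub_SpanC: "sub (Span S C)" and sub_SpanC': "sub (Span S C')"
  by (intro sub_Span sub_C sub_C')+

lemma wt_eq: "{(r, s). tot (r + s) \<le> n} = {i. wt i \<le> n}"
  by (auto simp: tot_add)

lemma W_wt: "W n = Span {i. wt i \<le> n} C" and W_wt': "W n = Span {i. wt i \<le> n} C'"
  using W_C W_C' unfolding wt_eq by blast+

text \<open>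
  For an index set containing all lower weights the two splittings are interchangeable. This is how
  \<open>G\<close>, modulo \<open>W (n - 1)\<close>, is expressed by \<open>C\<close>.
\<close>

lemma C_transfer:
  assumes T: "{i. wt i \<le> n - 1} \<subseteq> T" "T \<subseteq> {i. wt i \<le> n}"
  shows "Span T C = Span T C'"
proof -
  have "Span T X \<subseteq> Span T Y" if Y: "\<And>i. sub (Y i)" and W: "\<And>n. W n = Span {i. wt i \<le> n} Y"
      and XY: "\<And>i. X i \<subseteq> Y i \<uplus> W (wt i - 1)" for X Y
  proof (rule Span_least[OF sub_Span[OF Y]])
    fix i assume i: "i \<in> T"
    have "W (wt i - 1) \<subseteq> Span T Y" unfolding W using T i by (intro Span_mono) force
    moreover have "Y i \<subseteq> Span T Y" by (rule Span_upper[OF Y i])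
    ultimately have "Y i \<uplus> W (wt i - 1) \<subseteq> Span T Y" by (intro vsum_least sub_Span[OF Y])
    then show "X i \<subseteq> Span T Y" using XY[of i] by blast
  qed
  from this[OF sub_C' W_wt', of C] this[OF sub_C W_wt, of C'] show ?thesis
    using C_C' C'_C by (simp add: split_paired_all tot_add subset_antisym)
qed

lemma F_W_C: "W n \<inter> F p = Span {(r, s). p \<le> r \<and> wt (r, s) \<le> n} C"
  unfolding F_C W_wt independent_Int[OF indC] by (rule arg_cong[of _ _ "\<lambda>S. Span S C"]) auto

lemma P_C: "P n p = Span {(r, s). p \<le> r \<and> wt (r, s) \<le> n \<or> wt (r, s) \<le> n - 1} C"
  unfolding P_def F_C W_wt independent_Int[OF indC] independent_Un[OF indC] by (rule arg_cong[of _ _ "\<lambda>S. Span S C"]) auto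

lemma Q_C: "Q n q = Span {(r, s). q \<le> s \<and> wt (r, s) \<le> n \<or> wt (r, s) \<le> n - 1} C"
proof -
  have "Q n q = Span {(r, s). q \<le> s \<and> wt (r, s) \<le> n \<or> wt (r, s) \<le> n - 1} C'"
    unfolding Q_def G_C' W_wt' independent_Int[OF indC'] independent_Un[OF indC']
    by (rule arg_cong[of _ _ "\<lambda>S. Span S C'"]) auto
  also have "\<dots> = Span {(r, s). q \<le> s \<and> wt (r, s) \<le> n \<or> wt (r, s) \<le> n - 1} C"
    by (rule C_transfer[symmetric, of n]) auto
  finally show ?thesis .
qed

text \<open>
  Strictness of the degree makes an intersection of \<open>F p\<close> and \<open>G q\<close> in the graded piece of degree
  \<open>tot (p + q)\<close> a single component.
\<close>

lemma between: "p \<le> r \<Longrightarrow> q \<le> s \<Longrightarrow> tot r + tot s \<le> tot p + tot q \<Longrightarrow> (r, s) = (p, q)"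
  using tot_mono[of p r] tot_mono[of q s] tot_strict[of p r] tot_strict[of q s] by simp

lemma H_C: assumes n: "n = tot (p + q)" shows "H n (p, q) = Span ({(p, q)} \<union> {i. wt i \<le> n - 1}) C"
  unfolding H_def P_C Q_C split independent_Int[OF indC] 
  by (rule arg_cong[of _ _ "\<lambda>S. Span S C"]) (use between n in \<open>fastforce simp: tot_add\<close>)

lemma C_le_A: "C i \<subseteq> A i"
proof (cases i)
  case (Pair p q)
  have "C (p, q) \<subseteq> F p" "C (p, q) \<subseteq> W (tot (p + q))"
    unfolding F_C W_C by (intro Span_upper sub_C; simp)+
  then show ?thesis using C_low[of p q] unfolding A_def Pair by simp
qed

lemma deligne: "deligne V W F G tot (carrier V)"
proof
  fix n p
  let ?S = "Span {(r, s). p \<le> r \<and> tot (r + s) = n} (H n)"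
  have up: "?S \<subseteq> ?S \<uplus> W (n - 1)" "W (n - 1) \<subseteq> ?S \<uplus> W (n - 1)"
    by (intro vsum_upper1 vsum_upper2 sub_SpanH W)+
  show "P n p \<subseteq> ?S \<uplus> W (n - 1)"
    unfolding P_C
  proof (rule Span_least)
    show "sub (?S \<uplus> W (n - 1))" by (intro sub_vsum sub_SpanH W)
    fix i assume i: "i \<in> {(r, s). p \<le> r \<and> wt (r, s) \<le> n \<or> wt (r, s) \<le> n - 1}"
    show "C i \<subseteq> ?S \<uplus> W (n - 1)"
    proof (cases "wt i \<le> n - 1")
      case True
      then have "C i \<subseteq> W (n - 1)" unfolding W_wt by (intro Span_upper sub_C) simp
      then show ?thesis using up by blast
    next
      case False
      then obtain r s where rs: "i = (r, s)" "p \<le> r" "tot (r + s) = n" using i by (auto simp: tot_add)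
      have "C (r, s) \<subseteq> H n (r, s)" unfolding H_C[OF rs(3)[symmetric]] by (intro Span_upper sub_C) simp
      also have "\<dots> \<subseteq> ?S" using rs by (intro Span_upper sub_H) simp
      finally show ?thesis using up rs by blast
    qed
  qed
next
  fix p r s n assume "p \<le> r" and n: "tot (r + s) = n"
  let ?T = "{(r, s). p \<le> r \<and> tot (r + s) = n} - {(r, s)}"
  have "Span ?T (H n) \<subseteq> Span ({i. wt i \<le> n} - {(r, s)}) C"
  proof (rule Span_least[OF sub_SpanC])
    fix i assume "i \<in> ?T"
    then obtain r' s' where i: "i = (r', s')" "tot (r' + s') = n" "(r', s') \<noteq> (r, s)" by auto
    show "H n i \<subseteq> Span ({i. wt i \<le> n} - {(r, s)}) C"
      unfolding i(1) H_C[OF i(2)[symmetric]] by (rule Span_mono) (use i n in \<open>auto simp: tot_add\<close>)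
  qed
  moreover have "W (n - 1) \<subseteq> Span ({i. wt i \<le> n} - {(r, s)}) C"
    unfolding W_wt by (rule Span_mono) (use n in \<open>auto simp: tot_add\<close>)
  ultimately have "Span ?T (H n) \<uplus> W (n - 1) \<subseteq> Span ({i. wt i \<le> n} - {(r, s)}) C"
    by (intro vsum_least sub_SpanC)
  then have "H n (r, s) \<inter> (Span ?T (H n) \<uplus> W (n - 1))
      \<subseteq> Span ({(r, s)} \<union> {i. wt i \<le> n - 1}) C \<inter> Span ({i. wt i \<le> n} - {(r, s)}) C"
    unfolding H_C[OF n[symmetric]] by blast
  also have "\<dots> \<subseteq> W (n - 1)" unfolding independent_Int[OF indC] W_wt by (rule Span_mono) auto
  finally show "H n (r, s) \<inter> (Span ?T (H n) \<uplus> W (n - 1)) \<subseteq> W (n - 1)" .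
next
  fix p m
  let ?T = "{(r, s). m + 1 - tot p \<le> tot s \<and> wt (r, s) \<le> m \<or> wt (r, s) \<le> m - 1}"
  have "Span {q. m + 1 - tot p \<le> tot q} G \<subseteq> Span {(r, s). m + 1 - tot p \<le> tot s} C'"
  proof (rule Span_least[OF sub_SpanC'])
    fix q assume "q \<in> {q. m + 1 - tot p \<le> tot q}"
    then show "G q \<subseteq> Span {(r, s). m + 1 - tot p \<le> tot s} C'"
      unfolding G_C' using tot_mono[of q] by (intro Span_mono) force
  qed
  then have "(W m \<inter> Span {q. m + 1 - tot p \<le> tot q} G) \<uplus> W (m - 1)
      \<subseteq> (W m \<inter> Span {(r, s). m + 1 - tot p \<le> tot s} C') \<uplus> W (m - 1)"
    by (intro vsum_mono) auto
  also have "\<dots> \<subseteq> Span ?T C'"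
    unfolding W_wt' independent_Int[OF indC'] independent_Un[OF indC'] by (rule Span_mono) auto
  also have "\<dots> = Span ?T C" by (rule C_transfer[symmetric, of m]) auto
  finally have "F p \<inter> ((W m \<inter> Span {q. m + 1 - tot p \<le> tot q} G) \<uplus> W (m - 1))
      \<subseteq> Span {(r, s). p \<le> r} C \<inter> Span ?T C" unfolding F_C by blast
  also have "\<dots> \<subseteq> W (m - 1)"
    unfolding independent_Int[OF indC] W_wt
    by (rule Span_mono) (use tot_mono[of p] in force)
  finally show "F p \<inter> ((W m \<inter> Span {q. m + 1 - tot p \<le> tot q} G) \<uplus> W (m - 1)) \<subseteq> W (m - 1)" .
next
  fix n p q assume n: "n = tot (p + q)"
  let ?X = "F p \<inter> W n" and ?Y = "G q \<inter> W n" and ?Z = "W (n - 1)" and ?l = "low n q"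
  let ?R = "(F p \<inter> W (n - 1)) \<uplus> ?l"
  note subs = sub_vsum sub_Int F G W sub_low
  have R_up: "F p \<inter> W (n - 1) \<subseteq> ?R" "?l \<subseteq> ?R" "?R \<subseteq> ?R \<uplus> ?Y" "?Y \<subseteq> ?R \<uplus> ?Y"
    by (intro vsum_upper1 vsum_upper2 subs)+
  have "?X \<inter> (?Y \<uplus> ?Z) \<subseteq> Span {(r, s). p \<le> r \<and> wt (r, s) \<le> n} C \<inter> Q n q"
    unfolding F_W_C[symmetric] Q_def by (auto simp: Int_commute)
  also have "\<dots> \<subseteq> Span ({(p, q)} \<union> {(r, s). p \<le> r \<and> wt (r, s) \<le> n - 1}) C"
    unfolding Q_C independent_Int[OF indC] by (rule Span_mono) (use between n in \<open>fastforce simp: tot_add\<close>)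
  also have "\<dots> = C (p, q) \<uplus> (W (n - 1) \<inter> F p)"
    unfolding F_W_C using Span_insert[OF sub_C sub_C] by simp
  also have "\<dots> \<subseteq> ?R \<uplus> ?Y"
  proof (intro vsum_least subs)
    have "?Y \<uplus> ?l \<subseteq> ?R \<uplus> ?Y" using R_up by (intro vsum_least subs) blast+
    then show "C (p, q) \<subseteq> ?R \<uplus> ?Y" using C_low[of p q] n by blast
    show "W (n - 1) \<inter> F p \<subseteq> ?R \<uplus> ?Y" using R_up by blast
  qed
  finally have X: "?X \<inter> (?Y \<uplus> ?Z) \<subseteq> ?R \<uplus> ?Y" .
  have "(?X \<uplus> ?Y) \<inter> ?Z \<subseteq> (?Y \<uplus> ?X) \<inter> (?Y \<uplus> ?Z)"
    using vsum_comm[of ?X ?Y] vsum_upper2[of ?Y ?Z] subs by blast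
  also have "\<dots> \<subseteq> ?Y \<uplus> (?X \<inter> (?Y \<uplus> ?Z))" by (intro modular subs vsum_upper1)
  also have "\<dots> \<subseteq> ?R \<uplus> ?Y" using X R_up by (intro vsum_least subs) auto
  finally have "(?X \<uplus> ?Y) \<inter> ?Z \<subseteq> (?R \<uplus> ?Y) \<inter> ?Z" by blast
  also have "\<dots> \<subseteq> ?R \<uplus> (?Y \<inter> ?Z)"
    using low_le by (intro modular subs vsum_least) auto
  also have "\<dots> \<subseteq> ?R" using le_low[of q n] R_up by (intro vsum_least subs) auto
  finally show "(?X \<uplus> ?Y) \<inter> ?Z \<subseteq> ?R" .
qed

text \<open>
  \<open>C\<close> is a splitting contained in the independent family \<open>A\<close>, piece by piece.
\<close>

lemma A_eq_C: "A i = C i"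
proof -
  interpret deligne V W F G tot "carrier V" by (rule deligne)
  show ?thesis using splitting_maximal[OF C A_independent C_le_A] by simp
qed

text \<open>
  The total filtrations are the sums of pieces with \<open>tot r \<ge> k\<close> and \<open>tot s \<ge> k\<close>, so on the graded piece of
  weight \<open>n\<close> every index satisfies exactly one of \<open>tot r \<ge> k\<close> and \<open>tot s \<ge> n + 1 - k\<close>.
\<close>

lemma total_opposed:
  "opposed_on_graded V W (\<lambda>k. Span {p. tot p = k} F) (\<lambda>k. Span {p. tot p = k} G)"
proof -
  have TF: "Span {p. tot p = k} F = Span {(r, s). k \<le> tot r} C" for k
  proof
    show "Span {p. tot p = k} F \<subseteq> Span {(r, s). k \<le> tot r} C"
    proof (rule Span_least[OF sub_SpanC])
      fix p assume "p \<in> {p. tot p = k}"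
      then show "F p \<subseteq> Span {(r, s). k \<le> tot r} C"
        unfolding F_C using tot_mono[of p] by (intro Span_mono) auto
    qed
    show "Span {(r, s). k \<le> tot r} C \<subseteq> Span {p. tot p = k} F"
    proof (rule Span_le[OF F])
      fix i :: "'k \<times> 'k" assume "i \<in> {(r, s). k \<le> tot r}"
      then obtain r s p where i: "i = (r, s)" "p \<le> r" "tot p = k" using tot_attain by blast
      then have "C i \<subseteq> F p" unfolding F_C by (intro Span_upper sub_C) simp
      then show "\<exists>p\<in>{p. tot p = k}. C i \<subseteq> F p" using i by blast
    qed
  qed
  have TG: "Span {p. tot p = k} G = Span {(r, s). k \<le> tot s} C'" for k
  proof
    show "Span {p. tot p = k} G \<subseteq> Span {(r, s). k \<le> tot s} C'"
    proof (rule Span_least[OF sub_SpanC'])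
      fix p assume "p \<in> {p. tot p = k}"
      then show "G p \<subseteq> Span {(r, s). k \<le> tot s} C'"
        unfolding G_C' using tot_mono[of p] by (intro Span_mono) auto
    qed
    show "Span {(r, s). k \<le> tot s} C' \<subseteq> Span {p. tot p = k} G"
    proof (rule Span_le[OF G])
      fix i :: "'k \<times> 'k" assume "i \<in> {(r, s). k \<le> tot s}"
      then obtain r s p where i: "i = (r, s)" "p \<le> s" "tot p = k" using tot_attain by blast
      then have "C' i \<subseteq> G p" unfolding G_C' by (intro Span_upper sub_C') simp
      then show "\<exists>p\<in>{p. tot p = k}. C' i \<subseteq> G p" using i by blast
    qed
  qed
  have P: "(W n \<inter> Span {(r, s). k \<le> tot r} C) \<uplus> W (n - 1)
      = Span {(r, s). k \<le> tot r \<and> wt (r, s) \<le> n \<or> wt (r, s) \<le> n - 1} C" for n k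
    unfolding W_wt independent_Int[OF indC] independent_Un[OF indC]
    by (rule arg_cong[of _ _ "\<lambda>S. Span S C"]) auto
  have Q: "(W n \<inter> Span {(r, s). k \<le> tot s} C') \<uplus> W (n - 1)
      = Span {(r, s). k \<le> tot s \<and> wt (r, s) \<le> n \<or> wt (r, s) \<le> n - 1} C" for n k
  proof -
    have "(W n \<inter> Span {(r, s). k \<le> tot s} C') \<uplus> W (n - 1)
        = Span {(r, s). k \<le> tot s \<and> wt (r, s) \<le> n \<or> wt (r, s) \<le> n - 1} C'"
      unfolding W_wt' independent_Int[OF indC'] independent_Un[OF indC']
      by (rule arg_cong[of _ _ "\<lambda>S. Span S C'"]) auto
    also have "\<dots> = Span {(r, s). k \<le> tot s \<and> wt (r, s) \<le> n \<or> wt (r, s) \<le> n - 1} C"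
      by (rule C_transfer[symmetric, of n]) auto
    finally show ?thesis .
  qed
  show ?thesis
    unfolding opposed_on_graded_def TF TG P Q independent_Int[OF indC]
  proof (intro allI conjI)
    fix n k
    let ?f = "W n \<inter> Span {(r, s). k \<le> tot r} C" and ?g = "W n \<inter> Span {(r, s). n + 1 - k \<le> tot s} C'"
    let ?R = "(?f \<uplus> ?g) \<uplus> W (n - 1)"
    note subs = sub_vsum sub_Int W sub_SpanC sub_SpanC'
    have "?f \<subseteq> ?f \<uplus> ?g" "?g \<subseteq> ?f \<uplus> ?g" "?f \<uplus> ?g \<subseteq> ?R" and R3: "W (n - 1) \<subseteq> ?R"
      by (intro vsum_upper1 vsum_upper2 subs)+
    then have R1: "?f \<subseteq> ?R" and R2: "?g \<subseteq> ?R" by blast+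
    have sR: "sub ?R" by (intro subs)
    have R: "?f \<uplus> W (n - 1) \<subseteq> ?R" "?g \<uplus> W (n - 1) \<subseteq> ?R"
      by (rule vsum_least[OF sR R1 R3], rule vsum_least[OF sR R2 R3])
    have "W n = Span {i. wt i \<le> n} C" by (rule W_wt)
    also have "\<dots> \<subseteq> ?R"
    proof (rule Span_least)
      show "sub ?R" by (rule sR)
      fix i assume "i \<in> {i. wt i \<le> n}"
      then consider "i \<in> {(r, s). k \<le> tot r \<and> wt (r, s) \<le> n \<or> wt (r, s) \<le> n - 1}"
        | "i \<in> {(r, s). n + 1 - k \<le> tot s \<and> wt (r, s) \<le> n \<or> wt (r, s) \<le> n - 1}"
        by (cases i) fastforce
      then show "C i \<subseteq> ?R"
      proof cases
        case 1
        then show ?thesis using order_trans[OF Span_upper[OF sub_C 1] R(1)[unfolded P]] by blast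
      next
        case 2
        then show ?thesis using order_trans[OF Span_upper[OF sub_C 2] R(2)[unfolded Q]] by blast
      qed
    qed
    finally show "W n \<subseteq> ?R" .
    show "Span ({(r, s). k \<le> tot r \<and> wt (r, s) \<le> n \<or> wt (r, s) \<le> n - 1} \<inter>
        {(r, s). n + 1 - k \<le> tot s \<and> wt (r, s) \<le> n \<or> wt (r, s) \<le> n - 1}) C \<subseteq> W (n - 1)"
      unfolding W_wt by (rule Span_mono) auto
  qed
qed

end

section \<open>Plectic objects and partial weights\<close>

lemma tot_plus: "tot (a + b) = tot a + tot b"
  by (simp add: tot_def sum.distrib)

lemma tot_le: "a \<le> b \<Longrightarrow> tot a \<le> tot b"
  by (simp add: tot_def le_fun_def sum_mono)

lemma tot_eq_imp_eq:
  assumes "a \<le> b" "tot a = tot b" shows "a = b"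
proof
  fix \<mu>
  show "a \<mu> = b \<mu>"
    using sum_mono_inv[of a UNIV b \<mu>] assms by (simp add: tot_def le_fun_def)
qed

lemma tot_update: "tot (r(\<mu> := r \<mu> + d)) = tot r + d"
proof -
  have "tot (r(\<mu> := r \<mu> + d)) = (\<Sum>\<nu>\<in>UNIV. r \<nu> + (if \<nu> = \<mu> then d else 0))"
    unfolding tot_def by (rule sum.cong) auto
  then show ?thesis by (simp add: sum.distrib tot_def)
qed

lemma tot_lower: "k \<le> tot r \<Longrightarrow> \<exists>p\<le>r. tot p = k"
  using tot_update[of r undefined "k - tot r"]
  by (intro exI[of _ "r(undefined := r undefined + (k - tot r))"]) (auto simp: le_fun_def)

lemma tot_raise: "tot r \<le> k \<Longrightarrow> \<exists>p\<ge>r. tot p = k"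
  using tot_update[of r undefined "k - tot r"]
  by (intro exI[of _ "r(undefined := r undefined + (k - tot r))"]) (auto simp: le_fun_def)

lemma tot_large: "(\<And>\<mu>. p \<mu> < N \<mu>) \<Longrightarrow> tot p < tot (N :: 'g::finite \<Rightarrow> int)"
  unfolding tot_def by (rule sum_strict_mono) auto

text \<open>
  The member with index \<open>\<mu>\<close> of the family selected by \<open>I\<close>. With it \<open>multi_F\<close> is a plain
  intersection and \<open>multi_Fb\<close> is \<open>multi_F\<close> for the complement of \<open>I\<close>.
\<close>

definition fil :: "('v, 'l, 'g) filtered_space \<Rightarrow> 'g set \<Rightarrow> 'g \<Rightarrow> int \<Rightarrow> 'v set" where
  "fil X I \<mu> = (if \<mu> \<in> I then Fb_of X \<mu> else F_of X \<mu>)"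

lemma multi_F_fil: "multi_F X I p = (\<Inter>\<mu>. fil X I \<mu> (p \<mu>))"
  by (auto simp: multi_F_def fil_def split: if_splits)

lemma multi_Fb_fil: "multi_Fb X I = multi_F X (- I)"
  by (auto simp: multi_F_def multi_Fb_def fun_eq_iff)

locale filtered_object =
  fixes X :: "('v, 'l::finite, 'g::finite) filtered_space"
  assumes X: "is_filtered_space X"
begin

abbreviation "V \<equiv> space_of X"

sublocale complex_space V
  using X by (simp add: complex_space_def is_filtered_space_def fd_cspace_def)

abbreviation space_sum (infixl "\<uplus>" 65) where "A \<uplus> B \<equiv> A <+>\<^bsub>V\<^esub> B"

lemma fd: "fin_dim" and fdV: "fd_cspace V"
  using X by (simp_all add: is_filtered_space_def fd_cspace_def)

lemma asc_W: "ascending_filtration V (W_of X i)"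
  and desc_F: "descending_filtration V (F_of X \<mu>)" and desc_Fb: "descending_filtration V (Fb_of X \<mu>)"
  using X by (simp_all add: is_filtered_space_def)

lemma desc_fil: "descending_filtration V (fil X I \<mu>)"
  by (simp add: fil_def desc_F desc_Fb)

lemma sub_W: "sub (W_of X i n)" and W_mono: "m \<le> n \<Longrightarrow> W_of X i m \<subseteq> W_of X i n"
  and W_bot: "\<exists>n. W_of X i n = {\<zero>\<^bsub>V\<^esub>}" and W_top: "\<exists>n. W_of X i n = carrier V"
  using asc_W[of i] by (auto simp: ascending_filtration_def)

lemma sub_fil: "sub (fil X I \<mu> p)" and fil_mono: "p \<le> r \<Longrightarrow> fil X I \<mu> r \<subseteq> fil X I \<mu> p"
  and fil_bot: "\<exists>n. fil X I \<mu> n = {\<zero>\<^bsub>V\<^esub>}" and fil_top: "\<exists>n. fil X I \<mu> n = carrier V"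
  using desc_fil[of I \<mu>] by (auto simp: descending_filtration_def)

lemma fil_tops: "\<exists>p. \<forall>\<mu>. fil X I \<mu> (p \<mu>) = carrier V"
  using fil_top by (rule choice[OF allI])

end

locale plectic_object = filtered_object X for X :: "('v, unit, 'g::finite) filtered_space"
begin

sublocale B: bifiltered V "weight X" "multi_F X I" "multi_Fb X I" tot "carrier V" for I
proof unfold_locales
  fix a b p r :: "'g \<Rightarrow> int" and m n :: int
  show "tot (a + b) = tot a + tot b" by (rule tot_plus)
  show "tot a \<le> tot b" if "a \<le> b" using that by (rule tot_le)
  show "\<exists>c. c \<le> a \<and> c \<le> b" by (rule exI[of _ "\<lambda>\<mu>. min (a \<mu>) (b \<mu>)"]) (simp add: le_fun_def)
  have F: "sub (multi_F X J p)" for J unfolding multi_F_fil by (rule sub_INT[OF sub_fil]) simp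
  then show "sub (multi_F X I p)" "sub (multi_Fb X I p)" unfolding multi_Fb_fil by blast+
  have m: "multi_F X J r \<subseteq> multi_F X J p" if "p \<le> r" for J
  proof -
    have "fil X J \<mu> (r \<mu>) \<subseteq> fil X J \<mu> (p \<mu>)" for \<mu>
      using that by (intro fil_mono) (simp add: le_fun_def)
    then show ?thesis unfolding multi_F_fil by blast
  qed
  then show "multi_F X I r \<subseteq> multi_F X I p" "multi_Fb X I r \<subseteq> multi_Fb X I p" if "p \<le> r"
    unfolding multi_Fb_fil using that by blast+
  show "sub (weight X n)" by (rule sub_W)
  show "weight X m \<subseteq> weight X n" if "m \<le> n" using that by (rule W_mono)
  show "\<exists>n. weight X n = {\<zero>\<^bsub>V\<^esub>}" "\<exists>n. weight X n = carrier V" by (rule W_bot W_top)+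
  show "weight X n \<subseteq> carrier V" by (rule sub_carrier[OF sub_W])
  obtain p where "\<forall>\<mu>. fil X I \<mu> (p \<mu>) = carrier V" using fil_tops by blast
  then show "\<exists>p. multi_F X I p = carrier V" unfolding multi_F_fil by (intro exI[of _ p]) simp
qed

lemma lower_Fb_eq: "lower_Fb X I n q = B.low I n q"
proof -
  have "{j. \<forall>\<mu>. 0 \<le> j \<mu>} = {j :: 'g \<Rightarrow> int. 0 \<le> j}" by (simp add: le_fun_def)
  moreover have "(\<lambda>\<mu>. q \<mu> - j \<mu>) = q - j" for j by (simp add: fun_diff_def)
  ultimately show ?thesis unfolding lower_Fb_def B.low_def by simp
qed

lemma A_sub_eq: "A_sub X I p q = B.A I (p, q)"
  unfolding A_sub_def B.A_def Let_def lower_Fb_eq by (simp add: plus_fun_def)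

lemma partial_weight_eq: "partial_weight X I \<mu> n = Span {(p, q). p \<mu> + q \<mu> \<le> n} (B.A I)"
proof -
  have "(\<lambda>(p, q). A_sub X I p q) = B.A I" by (auto simp: A_sub_eq fun_eq_iff)
  then show ?thesis unfolding partial_weight_def by simp
qed

text \<open>
  Since \<open>B.P I n p\<close> and \<open>B.H I n\<close> are the full preimages, the decomposition of the graded piece is exactly
  the pair of conditions \<open>P_split\<close> and \<open>H_indep\<close>; the reverse inclusion of the sum holds by
  monotonicity.
\<close>

lemma plectic_a_iff:
  "plectic_a X I \<longleftrightarrow> (\<forall>n p.
     B.P I n p \<subseteq> Span {(r, s). p \<le> r \<and> tot (r + s) = n} (B.H I n) \<uplus> weight X (n - 1) \<and>
     (\<forall>r s. p \<le> r \<longrightarrow> tot (r + s) = n \<longrightarrow>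
        B.H I n (r, s) \<inter> (Span ({(r, s). p \<le> r \<and> tot (r + s) = n} - {(r, s)}) (B.H I n) \<uplus> weight X (n - 1))
          \<subseteq> weight X (n - 1)))"
proof -
  have "is_direct_sum (Gr V (weight X) n) (Gr_sub V (weight X) n (multi_F X I p))
        {(r, s). (\<forall>\<mu>. p \<mu> \<le> r \<mu>) \<and> tot (\<lambda>\<mu>. r \<mu> + s \<mu>) = n}
        (\<lambda>(r, s). Gr_sub V (weight X) n (multi_F X I r) \<inter> Gr_sub V (weight X) n (multi_Fb X I s)) \<longleftrightarrow>
     B.P I n p \<subseteq> Span {(r, s). p \<le> r \<and> tot (r + s) = n} (B.H I n) \<uplus> weight X (n - 1) \<and>
     (\<forall>r s. p \<le> r \<longrightarrow> tot (r + s) = n \<longrightarrow>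
        B.H I n (r, s) \<inter> (Span ({(r, s). p \<le> r \<and> tot (r + s) = n} - {(r, s)}) (B.H I n) \<uplus> weight X (n - 1))
          \<subseteq> weight X (n - 1))" for n p
  proof -
    interpret q: subquotient V "weight X (n - 1)" "weight X n"
      by unfold_locales (auto intro: sub_W W_mono[THEN subsetD, rotated])
    let ?S = "{(r, s). p \<le> r \<and> tot (r + s) = n}" and ?T = "weight X n \<inter> multi_F X I p"
    have S: "{(r, s). (\<forall>\<mu>. p \<mu> \<le> r \<mu>) \<and> tot (\<lambda>\<mu>. r \<mu> + s \<mu>) = n} = ?S"
      by (simp add: le_fun_def plus_fun_def)
    have U: "(\<lambda>(r, s). Gr_sub V (weight X) n (multi_F X I r) \<inter> Gr_sub V (weight X) n (multi_Fb X I s))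
        = (\<lambda>i. q.coset ` B.H I n i)"
    proof (rule ext)
      fix i :: "('g \<Rightarrow> int) \<times> ('g \<Rightarrow> int)"
      obtain r s where i: "i = (r, s)" by (cases i)
      have "sub (weight X n \<inter> multi_F X I r)" "sub (weight X n \<inter> multi_Fb X I s)"
        by (intro sub_Int B.W B.F B.G)+
      then show "(case i of (r, s) \<Rightarrow> Gr_sub V (weight X) n (multi_F X I r) \<inter> Gr_sub V (weight X) n (multi_Fb X I s))
          = q.coset ` B.H I n i"
        unfolding i split Gr_sub_def B.H_def B.P_def B.Q_def by (intro q.coset_image_Int) auto
    qed
    have T: "sub ?T" "?T \<subseteq> weight X n" by (auto intro!: sub_Int B.W B.F)
    have PT: "?T \<uplus> weight X (n - 1) = B.P I n p" by (simp add: B.P_def)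
    have Sle: "Span ?S (B.H I n) \<subseteq> B.P I n p"
    proof (rule Span_least[OF B.sub_P])
      fix i assume "i \<in> ?S"
      then obtain r s where i: "i = (r, s)" "p \<le> r" by auto
      have "B.P I n r \<subseteq> B.P I n p"
        unfolding B.P_def using B.F_mono[OF i(2)] by (intro vsum_mono) auto
      then show "B.H I n i \<subseteq> B.P I n p" unfolding i B.H_def by auto
    qed
    let ?R = "Span ?S (B.H I n) \<uplus> weight X (n - 1)"
    have "?T \<subseteq> B.P I n p" unfolding PT[symmetric] by (intro vsum_upper1 T sub_W)
    moreover have "B.P I n p \<subseteq> ?R" if "?T \<subseteq> ?R"
      unfolding PT[symmetric] by (rule vsum_least[OF _ that vsum_upper2]) (intro sub_vsum B.sub_SpanH sub_W)+
    ultimately have TR: "?T \<subseteq> ?R \<longleftrightarrow> B.P I n p \<subseteq> ?R" by blast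
    have gr: "Gr V (weight X) n = q.Q" "Gr_sub V (weight X) n (multi_F X I p) = q.coset ` ?T"
      by (simp_all add: Gr_def Gr_sub_def)
    have H: "sub (B.H I n i) \<and> B.H I n i \<subseteq> weight X n \<and> weight X (n - 1) \<subseteq> B.H I n i" for i
      by (intro conjI B.sub_H B.H_le B.W_le_H)
    have ball: "(\<forall>i\<in>?S. R i) \<longleftrightarrow> (\<forall>r s. p \<le> r \<longrightarrow> tot (r + s) = n \<longrightarrow> R (r, s))" for R by auto
    show ?thesis
      unfolding S U gr q.direct_sum_quotient_iff[OF T H] PT TR ball using Sle by simp
  qed
  then show ?thesis unfolding plectic_a_def by simp
qed

text \<open>
  The three plectic conditions are the axioms of the splitting: (a) decomposes the graded
  pieces, (b) gives the opposedness because each \<open>multi_F\<close> lies in the total filtration, and (c) is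
  \<open>exchange\<close> verbatim.
\<close>

lemma deligne:
  assumes a: "plectic_a X I" and b: "plectic_b X I" and c: "plectic_c X I"
  shows "deligne V (weight X) (multi_F X I) (multi_Fb X I) tot (carrier V)"
proof unfold_locales
  fix n :: int and p r s :: "'g \<Rightarrow> int"
  show "B.P I n p \<subseteq> Span {(r, s). p \<le> r \<and> tot (r + s) = n} (B.H I n) \<uplus> weight X (n - 1)"
    using a unfolding plectic_a_iff by blast
  show "B.H I n (r, s) \<inter> (Span ({(r, s). p \<le> r \<and> tot (r + s) = n} - {(r, s)}) (B.H I n) \<uplus> weight X (n - 1))
          \<subseteq> weight X (n - 1)" if "p \<le> r" "tot (r + s) = n"
    using a that unfolding plectic_a_iff by blast
next
  fix p :: "'g \<Rightarrow> int" and m :: int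
  let ?F = "total_F X I" and ?G = "total_Fb X I" and ?W = "weight X"
  have desc: "descending_filtration V ?F" "descending_filtration V ?G" and op: "opposed_on_graded V ?W ?F ?G"
    using b unfolding plectic_b_def mixed_Hodge_iff by auto
  have sF: "sub (?F k)" and sG: "sub (?G k)" and G_mono: "k \<le> l \<Longrightarrow> ?G l \<subseteq> ?G k" for k l
    using desc by (auto simp: descending_filtration_def)
  have "Span {q. m + 1 - tot p \<le> tot q} (multi_Fb X I) \<subseteq> ?G (m + 1 - tot p)"
  proof (rule Span_least[OF sG])
    fix q :: "'g \<Rightarrow> int" assume q: "q \<in> {q. m + 1 - tot p \<le> tot q}"
    have "multi_Fb X I q \<subseteq> ?G (tot q)" unfolding total_Fb_def by (intro Span_upper B.G) simp
    then show "multi_Fb X I q \<subseteq> ?G (m + 1 - tot p)" using G_mono[of "m + 1 - tot p" "tot q"] q by auto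
  qed
  then have "(?W m \<inter> Span {q. m + 1 - tot p \<le> tot q} (multi_Fb X I)) \<uplus> ?W (m - 1)
      \<subseteq> (?W m \<inter> ?G (m + 1 - tot p)) \<uplus> ?W (m - 1)" (is "?L \<subseteq> ?R") by (intro vsum_mono) auto
  moreover have "?R \<subseteq> ?W m" using W_mono[of "m - 1" m] by (intro vsum_least sub_W) auto
  moreover have "multi_F X I p \<subseteq> ?F (tot p)" unfolding total_F_def by (intro Span_upper B.F) simp
  ultimately have "multi_F X I p \<inter> ?L \<subseteq> (?W m \<inter> ?F (tot p)) \<inter> ?R" by blast
  also have "\<dots> \<subseteq> ((?W m \<inter> ?F (tot p)) \<uplus> ?W (m - 1)) \<inter> ?R"
    using vsum_upper1[OF sub_Int[OF sub_W sF] sub_W] by blast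
  also have "\<dots> \<subseteq> ?W (m - 1)" using op unfolding opposed_on_graded_def by blast
  finally show "multi_F X I p \<inter> ?L \<subseteq> ?W (m - 1)" .
next
  fix n :: int and p q :: "'g \<Rightarrow> int" assume "n = tot (p + q)"
  then show "((multi_F X I p \<inter> weight X n) \<uplus> (multi_Fb X I q \<inter> weight X n)) \<inter> weight X (n - 1)
      \<subseteq> (multi_F X I p \<inter> weight X (n - 1)) \<uplus> B.low I n q"
    using c unfolding plectic_c_def lower_Fb_eq[symmetric] by (simp add: plus_fun_def)
qed

lemma plectic_a_c_if_deligne:
  assumes "deligne V (weight X) (multi_F X I) (multi_Fb X I) tot (carrier V)"
  shows "plectic_a X I" and "plectic_c X I"
proof -
  interpret D: deligne V "weight X" "multi_F X I" "multi_Fb X I" tot "carrier V" by (rule assms)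
  show "plectic_a X I" unfolding plectic_a_iff using D.P_split D.H_indep by blast
  show "plectic_c X I" unfolding plectic_c_def lower_Fb_eq using D.exchange by (simp add: plus_fun_def)
qed

end

definition total_weight :: "('v, 'g::finite, 'g) filtered_space \<Rightarrow> int \<Rightarrow> 'v set" where
  "total_weight Y n = Sum_spaces (space_of Y) {m. tot m = n} (\<lambda>m. \<Inter>\<mu>. W_of Y \<mu> (m \<mu>))"

definition to_plectic :: "('v, 'g::finite, 'g) filtered_space \<Rightarrow> ('v, unit, 'g) filtered_space" where
  "to_plectic Y = \<lparr>space_of = space_of Y, W_of = (\<lambda>_. total_weight Y), F_of = F_of Y, Fb_of = Fb_of Y\<rparr>"

definition to_family :: "('v, unit, 'g::finite) filtered_space \<Rightarrow> ('v, 'g, 'g) filtered_space" where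
  "to_family X = \<lparr>space_of = space_of X, W_of = partial_weight X {}, F_of = F_of X, Fb_of = Fb_of X\<rparr>"

lemma fil_to_plectic: "fil (to_plectic Y) = fil Y" and fil_to_family: "fil (to_family X) = fil X"
  by (simp_all add: fil_def to_plectic_def to_family_def fun_eq_iff)

text \<open>
  Each intersection of partial weights is the sum of the pieces with \<open>r + s \<le> m\<close>, and \<open>tot (r + s) \<le> n\<close>
  holds exactly if \<open>r + s\<close> is below some tuple of total degree \<open>n\<close>.
\<close>

lemma (in complex_space) total_weight_Span:
  fixes A :: "('g::finite \<Rightarrow> int) \<times> ('g \<Rightarrow> int) \<Rightarrow> 'v set"
  assumes A: "independent A" and Z: "\<And>\<mu> n. Z \<mu> n = Span {(r, s). r \<mu> + s \<mu> \<le> n} A"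
  shows "Span {m. tot m = n} (\<lambda>m. \<Inter>\<mu>. Z \<mu> (m \<mu>)) = Span {(r, s). tot (r + s) \<le> n} A"
proof -
  have sA: "sub (A i)" for i by (rule independent_sub[OF A])
  have eq: "(\<Inter>\<mu>. Z \<mu> (m \<mu>)) = Span {(r, s). r + s \<le> m} A" for m
  proof -
    have "(\<Inter>\<mu>. Z \<mu> (m \<mu>)) = Span (\<Inter>\<mu>. {(r, s). r \<mu> + s \<mu> \<le> m \<mu>}) A"
      unfolding Z by (rule independent_Span_INT[OF A]) auto
    also have "(\<Inter>\<mu>. {(r, s). r \<mu> + s \<mu> \<le> m \<mu>}) = {(r, s). r + s \<le> m}"
      by (auto simp: le_fun_def)
    finally show ?thesis .
  qed
  show ?thesis
    unfolding eq
  proof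
    show "Span {m. tot m = n} (\<lambda>m. Span {(r, s). r + s \<le> m} A) \<subseteq> Span {(r, s). tot (r + s) \<le> n} A"
    proof (rule Span_least[OF sub_Span[OF sA]])
      fix m :: "'g \<Rightarrow> int" assume "m \<in> {m. tot m = n}"
      then show "Span {(r, s). r + s \<le> m} A \<subseteq> Span {(r, s). tot (r + s) \<le> n} A"
        using tot_le[of _ m] by (intro Span_mono) auto
    qed
    show "Span {(r, s). tot (r + s) \<le> n} A \<subseteq> Span {m. tot m = n} (\<lambda>m. Span {(r, s). r + s \<le> m} A)"
    proof (rule Span_le)
      show "sub (Span {(r, s). r + s \<le> m} A)" for m by (rule sub_Span[OF sA])
      fix i :: "('g \<Rightarrow> int) \<times> ('g \<Rightarrow> int)" assume "i \<in> {(r, s). tot (r + s) \<le> n}"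
      then obtain r s where i: "i = (r, s)" "tot (r + s) \<le> n" by auto
      then obtain m where m: "r + s \<le> m" "tot m = n" using tot_raise by blast
      then have "A i \<subseteq> Span {(r, s). r + s \<le> m} A" by (intro Span_upper sA) (simp add: i)
      then show "\<exists>m\<in>{m. tot m = n}. A i \<subseteq> Span {(r, s). r + s \<le> m} A" using m by blast
    qed
  qed
qed

text \<open>
  Only finitely many pieces matter, so the degree is bounded on them.
\<close>

lemma (in complex_space) ascending_of_degree:
  fixes w :: "'i \<Rightarrow> int"
  assumes "fin_dim" and A: "splitting A" and W: "\<And>n. W n = Span {i. w i \<le> n} A"
  shows "ascending_filtration V W"
proof -
  obtain J where J: "finite J" "\<And>S. Span S A = Span (S \<inter> J) A" using splitting_finite_support[OF assms(1) A] by blast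
  have sA: "sub (A i)" for i using A by (simp add: splitting_def independent_sub)
  let ?m = "Min (insert 0 (w ` J)) - 1" and ?M = "Max (insert 0 (w ` J))"
  have "?m < w i \<and> w i \<le> ?M" if "i \<in> J" for i
  proof -
    have "Min (insert 0 (w ` J)) \<le> w i" "w i \<le> ?M" by (rule Min_le Max_ge; use that J(1) in simp)+
    then show ?thesis by linarith
  qed
  then have e: "{i. w i \<le> ?m} \<inter> J = {}" "{i. w i \<le> ?M} \<inter> J = UNIV \<inter> J" by force+
  have "W ?m = {\<zero>\<^bsub>V\<^esub>}" unfolding W J(2)[of "{i. w i \<le> ?m}"] e by (rule Span_empty)
  moreover have "W ?M = carrier V"
    unfolding W J(2)[of "{i. w i \<le> ?M}"] e using A J(2)[of UNIV] by (simp add: splitting_def)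
  moreover have "sub (W n)" for n unfolding W by (rule sub_Span[OF sA])
  moreover have "W m \<subseteq> W n" if "m \<le> n" for m n unfolding W using that by (intro Span_mono) auto
  ultimately show ?thesis unfolding ascending_filtration_def by blast
qed

section \<open>From plectic structures to orthogonal families\<close>

lemma Collect_pair: "{(r, s). R r s} = {i. R (fst i) (snd i)}"
  by auto

context complex_space
begin

lemma Span_swap: "Span {i. R i} (\<lambda>i. A (prod.swap i)) = Span {i. R (prod.swap i)} A"
  unfolding Span_reindex[of _ A prod.swap] by (rule arg_cong[of _ _ "\<lambda>S. Span S A"]) force

lemma opposed_on_graded_sym:
  assumes "opposed_on_graded V W F G" and W: "\<And>n. sub (W n)" and F: "\<And>n. sub (F n)" and G: "\<And>n. sub (G n)"
  shows "opposed_on_graded V W G F"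
  unfolding opposed_on_graded_def
proof (intro allI)
  fix n p :: int
  have e: "n + 1 - (n + 1 - p) = p" by simp
  have "W n \<inter> F (n + 1 - p) \<uplus> W n \<inter> G p = W n \<inter> G p \<uplus> W n \<inter> F (n + 1 - p)"
    by (intro vsum_comm sub_Int W F G)
  then show "W n \<subseteq> ((W n \<inter> G p) \<uplus> (W n \<inter> F (n + 1 - p))) \<uplus> W (n - 1) \<and>
     ((W n \<inter> G p) \<uplus> W (n - 1)) \<inter> ((W n \<inter> F (n + 1 - p)) \<uplus> W (n - 1)) \<subseteq> W (n - 1)"
    using assms(1)[unfolded opposed_on_graded_def, rule_format, of n "n + 1 - p"] unfolding e
    by (simp add: Int_commute)
qed

end

locale mixed_plectic_object = plectic_object X for X :: "('v, unit, 'g::finite) filtered_space" +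
  assumes mixed_plectic: "mixed_plectic X"
begin

lemma weak: "plectic_a X I" "plectic_b X I" "plectic_c X I"
  using mixed_plectic by (auto simp: mixed_plectic_def mixed_weak_plectic_def)

sublocale D: deligne V "weight X" "multi_F X I" "multi_Fb X I" tot "carrier V" for I
  by (rule deligne[OF weak])

lemma A_splitting: "splitting (B.A I)"
  unfolding splitting_def using D.A_independent D.Span_A by blast

lemma A_ind: "independent (B.A I)"
  by (rule D.A_independent)

lemma weight_Span: "weight X n = Span {i. tot (fst i + snd i) \<le> n} (B.A I)"
proof
  obtain p where p: "multi_F X I p = carrier V" using B.F_top by blast
  have "weight X n = multi_F X I p \<inter> weight X n" using p sub_carrier[OF sub_W] by blast
  also have "\<dots> \<subseteq> Span {i. tot (fst i + snd i) \<le> n} (B.A I)"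
    unfolding D.F_Int_W by (rule Span_mono) auto
  finally show "weight X n \<subseteq> Span {i. tot (fst i + snd i) \<le> n} (B.A I)" .
  show "Span {i. tot (fst i + snd i) \<le> n} (B.A I) \<subseteq> weight X n"
  proof (rule Span_least[OF sub_W])
    fix i :: "('g \<Rightarrow> int) \<times> ('g \<Rightarrow> int)" assume "i \<in> {i. tot (fst i + snd i) \<le> n}"
    then show "B.A I i \<subseteq> weight X n"
      using order_trans[OF B.A_le_W[of I "fst i" "snd i"] W_mono[of "tot (fst i + snd i)" n]] by simp
  qed
qed

lemma fil_Span: "fil X I \<mu> k = Span {i. k \<le> fst i \<mu>} (B.A I)"
proof
  obtain p where p: "\<forall>\<nu>. fil X I \<nu> (p \<nu>) = carrier V" using fil_tops by blast
  obtain n where n: "weight X n = carrier V" using W_top by blast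
  have "fil X I \<mu> k \<subseteq> multi_F X I (p(\<mu> := k)) \<inter> weight X n"
    unfolding multi_F_fil n using p sub_carrier[OF sub_fil, of I \<mu> k] by auto
  also have "\<dots> \<subseteq> Span {i. k \<le> fst i \<mu>} (B.A I)"
    unfolding D.F_Int_W by (rule Span_mono) (auto simp: le_fun_def dest!: spec[of _ \<mu>])
  finally show "fil X I \<mu> k \<subseteq> Span {i. k \<le> fst i \<mu>} (B.A I)" .
  show "Span {i. k \<le> fst i \<mu>} (B.A I) \<subseteq> fil X I \<mu> k"
  proof (rule Span_least[OF sub_fil])
    fix i :: "('g \<Rightarrow> int) \<times> ('g \<Rightarrow> int)" assume i: "i \<in> {i. k \<le> fst i \<mu>}"
    have "B.A I i \<subseteq> multi_F X I (fst i)" using B.A_le_F[of I "fst i" "snd i"] by simp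
    also have "\<dots> \<subseteq> fil X I \<mu> (fst i \<mu>)" unfolding multi_F_fil by blast
    also have "\<dots> \<subseteq> fil X I \<mu> k" using i by (intro fil_mono) simp
    finally show "B.A I i \<subseteq> fil X I \<mu> k" .
  qed
qed

lemma partial_weight_Span: "partial_weight X {} \<mu> n = Span {i. fst i \<mu> + snd i \<mu> \<le> n} (B.A I)"
proof -
  have "partial_weight X {} \<mu> n = partial_weight X I \<mu> n"
    using mixed_plectic by (auto simp: mixed_plectic_def)
  then show ?thesis by (simp add: partial_weight_eq Collect_pair)
qed

text \<open>
  Both sides have the same image in the graded piece, as exchanging \<open>I\<close> with its complement exchanges \<open>F\<close>
  and \<open>G\<close>.
\<close>

lemma A_opposite: "B.A I i \<subseteq> B.A (- I) (prod.swap i) \<uplus> weight X (tot (fst i + snd i) - 1)"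
proof (cases i)
  case (Pair r s)
  have "B.H I n (r, s) = B.H (- I) n (s, r)" for n
    unfolding B.H_def B.P_def B.Q_def split unfolding multi_Fb_fil double_complement by (rule Int_commute)
  then show ?thesis
    using B.A_le_H[of I r s] D.H_eq[of "tot (r + s)" s r "- I"] Pair by (simp add: add.commute)
qed

text \<open>
  The splittings for \<open>I\<close> and \<open>- I\<close> compute \<open>F\<^sub>\<nu>\<close> and \<open>Fb\<^sub>\<nu>\<close>. If \<open>U\<close> is a step of \<open>F\<^sub>\<mu>\<close> or
  \<open>Fb\<^sub>\<mu>\<close> with \<open>\<mu> \<noteq> \<nu>\<close>, it is seen by both splittings for \<open>I\<close> and \<open>J\<close> as long as these sets agree
  on \<open>\<mu>\<close>, while they have to differ on \<open>\<nu>\<close>.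
\<close>

lemma opposed_family:
  assumes \<nu>: "\<nu> \<notin> I" "\<nu> \<in> J" and U: "U = Span S (B.A I)" "U = Span T (B.A J)"
  shows "opposed_on_graded V (\<lambda>n. U \<inter> partial_weight X {} \<nu> n) (\<lambda>p. U \<inter> F_of X \<nu> p) (\<lambda>p. U \<inter> Fb_of X \<nu> p)"
proof -
  have F: "F_of X \<nu> = fil X I \<nu>" and G: "Fb_of X \<nu> = fil X (- I) \<nu>" "Fb_of X \<nu> = fil X J \<nu>"
    using \<nu> by (auto simp: fil_def)
  obtain k0 where k0: "weight X k0 = {\<zero>\<^bsub>V\<^esub>}" using W_bot by blast
  obtain k1 where k1: "weight X k1 = carrier V" using W_top by blast
  have sw: "splitting (\<lambda>i. B.A (- I) (prod.swap i))" by (rule splitting_reindex[OF A_splitting bij_swap])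
  show ?thesis
  proof (rule opposed_of_splittings[where A = "B.A I" and A' = "\<lambda>i. B.A (- I) (prod.swap i)" and B = "B.A J"
        and wt = "\<lambda>i. tot (fst i + snd i)" and a = "\<lambda>i. fst i \<nu>" and b = "\<lambda>i. snd i \<nu>" and W = "weight X",
        OF A_splitting sw A_ind _ _ _ _ _ _ U _ _ _ _ _ k0 k1])
    show "weight X k = Span {i. tot (fst i + snd i) \<le> k} (B.A I)" for k by (rule weight_Span)
    show "weight X k = Span {i. tot (fst i + snd i) \<le> k} (\<lambda>i. B.A (- I) (prod.swap i))" for k
      unfolding Span_swap by (subst weight_Span[of k "- I"]) (simp add: add.commute)
    show "partial_weight X {} \<nu> n = Span {i. fst i \<nu> + snd i \<nu> \<le> n} (B.A I)" for n
      by (rule partial_weight_Span)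
    show "partial_weight X {} \<nu> n = Span {i. fst i \<nu> + snd i \<nu> \<le> n} (\<lambda>i. B.A (- I) (prod.swap i))" for n
      unfolding Span_swap by (subst partial_weight_Span[of \<nu> n "- I"]) (simp add: add.commute)
    show "F_of X \<nu> p = Span {i. p \<le> fst i \<nu>} (B.A I)" for p unfolding F by (rule fil_Span)
    show "Fb_of X \<nu> q = Span {i. q \<le> snd i \<nu>} (\<lambda>i. B.A (- I) (prod.swap i))" for q
      unfolding Span_swap G(1) by (subst fil_Span) simp
    show "\<exists>S. partial_weight X {} \<nu> n = Span S (B.A J)" for n using partial_weight_Span by blast
    show "\<exists>S. Fb_of X \<nu> q = Span S (B.A J)" for q unfolding G(2) using fil_Span by blast
    show "\<exists>S. weight X k = Span S (B.A J)" for k using weight_Span by blast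
    show "B.A I i \<subseteq> B.A (- I) (prod.swap i) \<uplus> weight X (tot (fst i + snd i) - 1)" for i
      by (rule A_opposite)
    show "B.A (- I) (prod.swap i) \<subseteq> B.A I i \<uplus> weight X (tot (fst i + snd i) - 1)" for i
      using A_opposite[of "- I" "prod.swap i"] by (simp add: add.commute)
  qed
qed

lemma asc_partial_weight: "ascending_filtration V (partial_weight X {} \<mu>)"
  by (rule ascending_of_degree[OF fd A_splitting partial_weight_Span])

lemma to_family_filtered: "is_filtered_space (to_family X)"
  unfolding is_filtered_space_def to_family_def
  using asc_partial_weight desc_F desc_Fb fdV by simp

text \<open>
  For a step of \<open>F\<^sub>\<mu>\<close> the sets \<open>{}\<close> and \<open>{\<nu>}\<close> are used, for a step of \<open>Fb\<^sub>\<mu>\<close> the sets \<open>{\<mu>}\<close> and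
  \<open>{\<mu>, \<nu>}\<close>; the partial weights are computed by every splitting.
\<close>

lemma to_family_orthogonal: "orthogonal_family (to_family X)"
proof -
  have on: "mixed_Hodge_on V U (partial_weight X {} \<nu>) (F_of X \<nu>) (Fb_of X \<nu>)"
    if \<nu>: "\<nu> \<notin> I" "\<nu> \<in> J" and U: "U = Span S (B.A I)" "U = Span T (B.A J)" for \<nu> I J U S T
  proof -
    have "sub U" unfolding U(1) by (rule B.sub_SpanA)
    then show ?thesis
      using mixed_Hodge_on_iff[OF fd asc_partial_weight desc_F desc_Fb] opposed_family[OF that] by blast
  qed
  have "mixed_Hodge V (partial_weight X {} \<nu>) (F_of X \<nu>) (Fb_of X \<nu>)" for \<nu>
  proof -
    have c: "carrier V = Span UNIV (B.A I)" for I using A_splitting by (simp add: splitting_def)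
    have "sub (partial_weight X {} \<nu> n)" "sub (F_of X \<nu> n)" "sub (Fb_of X \<nu> n)" for n
      using asc_partial_weight desc_F desc_Fb by (auto simp: ascending_filtration_def descending_filtration_def)
    then have "carrier V \<inter> partial_weight X {} \<nu> n = partial_weight X {} \<nu> n"
      "carrier V \<inter> F_of X \<nu> n = F_of X \<nu> n" "carrier V \<inter> Fb_of X \<nu> n = Fb_of X \<nu> n" for n
      using sub_carrier by blast+
    then have "opposed_on_graded V (partial_weight X {} \<nu>) (F_of X \<nu>) (Fb_of X \<nu>)"
      using opposed_family[of \<nu> "{}" "{\<nu>}" "carrier V", OF _ _ c c] by simp
    then show ?thesis unfolding mixed_Hodge_iff using fdV asc_partial_weight desc_F desc_Fb by blast
  qed
  moreover have "mixed_Hodge_on V (partial_weight X {} \<mu> n) (partial_weight X {} \<nu>) (F_of X \<nu>) (Fb_of X \<nu>)" for \<mu> \<nu> n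
    by (rule on[of \<nu> "{}" "{\<nu>}", OF _ _ partial_weight_Span partial_weight_Span]) auto
  moreover have "mixed_Hodge_on V (F_of X \<mu> n) (partial_weight X {} \<nu>) (F_of X \<nu>) (Fb_of X \<nu>)"
    if "\<nu> \<noteq> \<mu>" for \<mu> \<nu> n
  proof -
    have e: "F_of X \<mu> = fil X {} \<mu>" "F_of X \<mu> = fil X {\<nu>} \<mu>" using that by (auto simp: fil_def)
    have "F_of X \<mu> n = Span {i. n \<le> fst i \<mu>} (B.A {})" "F_of X \<mu> n = Span {i. n \<le> fst i \<mu>} (B.A {\<nu>})"
      using fil_Span[of "{}" \<mu> n] fil_Span[of "{\<nu>}" \<mu> n] e by simp_all
    then show ?thesis by (rule on[of \<nu> "{}" "{\<nu>}", rotated 2]) auto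
  qed
  moreover have "mixed_Hodge_on V (Fb_of X \<mu> n) (partial_weight X {} \<nu>) (F_of X \<nu>) (Fb_of X \<nu>)"
    if "\<nu> \<noteq> \<mu>" for \<mu> \<nu> n
  proof -
    have e: "Fb_of X \<mu> = fil X {\<mu>} \<mu>" "Fb_of X \<mu> = fil X {\<mu>, \<nu>} \<mu>" using that by (auto simp: fil_def)
    have "Fb_of X \<mu> n = Span {i. n \<le> fst i \<mu>} (B.A {\<mu>})" "Fb_of X \<mu> n = Span {i. n \<le> fst i \<mu>} (B.A {\<mu>, \<nu>})"
      using fil_Span[of "{\<mu>}" \<mu> n] fil_Span[of "{\<mu>, \<nu>}" \<mu> n] e by simp_all
    then show ?thesis by (rule on[of \<nu> "{\<mu>}" "{\<mu>, \<nu>}", rotated 2]) (use that in auto)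
  qed
  ultimately show ?thesis unfolding orthogonal_family_def to_family_def by simp
qed

lemma total_weight_to_family: "total_weight (to_family X) n = weight X n"
proof -
  have "total_weight (to_family X) n = Span {(r, s). tot (r + s) \<le> n} (B.A {})"
    unfolding total_weight_def to_family_def
    by simp (rule total_weight_Span[OF A_ind], simp add: partial_weight_Span[of _ _ "{}"] Collect_pair)
  then show ?thesis by (simp add: weight_Span[of n "{}"] Collect_pair)
qed

end

section \<open>From orthogonal families to plectic structures\<close>

text \<open>
  Functoriality of Deligne's subspaces for the inclusion of a subspace with its induced filtrations.
\<close>

lemma (in complex_space) bifiltered_A_mono:
  fixes F1 F2 G1 G2 :: "'k::ordered_ab_group_add \<Rightarrow> 'v set"
  assumes 1: "bifiltered V W1 F1 G1 t X1" and 2: "bifiltered V W2 F2 G2 t X2"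
    and W: "\<And>n. W1 n \<subseteq> W2 n" and F: "\<And>p. F1 p \<subseteq> F2 p" and G: "\<And>q. G1 q \<subseteq> G2 q"
  shows "bifiltered.A V W1 F1 G1 t i \<subseteq> bifiltered.A V W2 F2 G2 t i"
proof (cases i)
  case (Pair p q)
  interpret B1: bifiltered V W1 F1 G1 t X1 by (rule 1)
  interpret B2: bifiltered V W2 F2 G2 t X2 by (rule 2)
  have "B1.low n q \<subseteq> B2.low n q" for n
    unfolding B1.low_def B2.low_def
  proof (rule Span_le)
    show "sub (G2 (q - j) \<inter> W2 (n - t j - 1))" for j by (intro sub_Int B2.G B2.W)
    fix j assume "j \<in> {j :: 'k. 0 \<le> j}"
    then show "\<exists>j'\<in>{j. 0 \<le> j}. G1 (q - j) \<inter> W1 (n - t j - 1) \<subseteq> G2 (q - j') \<inter> W2 (n - t j' - 1)"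
      using G W by (intro bexI[of _ j] Int_mono)
  qed
  then have "(G1 q \<inter> W1 (t (p + q))) \<uplus> B1.low (t (p + q)) q \<subseteq> (G2 q \<inter> W2 (t (p + q))) \<uplus> B2.low (t (p + q)) q"
    by (intro vsum_mono Int_mono G W)
  then show ?thesis
    unfolding Pair B1.A_def B2.A_def split by (intro Int_mono F W)
qed

locale family_object = filtered_object Y for Y :: "('v, 'g::finite, 'g) filtered_space" +
  assumes orthogonal: "orthogonal_family Y"
begin

lemma fil_pair: "(fil Y I \<mu> = F_of Y \<mu> \<and> fil Y (- I) \<mu> = Fb_of Y \<mu>) \<or>
    (fil Y I \<mu> = Fb_of Y \<mu> \<and> fil Y (- I) \<mu> = F_of Y \<mu>)"
  by (simp add: fil_def)

lemma opposed_fil: "opposed_on_graded V (W_of Y \<mu>) (fil Y I \<mu>) (fil Y (- I) \<mu>)"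
proof -
  have "opposed_on_graded V (W_of Y \<mu>) (F_of Y \<mu>) (Fb_of Y \<mu>)"
    using orthogonal unfolding orthogonal_family_def mixed_Hodge_iff by blast
  moreover from this have "opposed_on_graded V (W_of Y \<mu>) (Fb_of Y \<mu>) (F_of Y \<mu>)"
    using opposed_on_graded_sym[OF _ sub_W] desc_F desc_Fb by (simp add: descending_filtration_def)
  ultimately show ?thesis using fil_pair[of I \<mu>] by auto
qed

sublocale E: deligne V "W_of Y \<mu>" "fil Y I \<mu>" "fil Y (- I) \<mu>" "\<lambda>n. n" "carrier V" for I \<mu>
  by (rule deligne_of_opposed[OF sub_W sub_fil sub_fil W_mono fil_mono fil_mono W_bot
        sub_carrier[OF sub_W] W_top fil_top fil_bot opposed_fil])

lemma E_splitting: "splitting (E.A \<mu> I)"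
  unfolding splitting_def using E.A_independent E.Span_A by blast

text \<open>
  The Deligne splitting of the sub-structure \<open>U\<close> consists of subspaces of the pieces of the ambient
  splitting and spans \<open>U\<close>.
\<close>

lemma graded_if_opposed:
  assumes U: "sub U" and op: "opposed_on_graded V (\<lambda>n. U \<inter> W_of Y \<nu> n) (\<lambda>p. U \<inter> fil Y I \<nu> p) (\<lambda>p. U \<inter> fil Y (- I) \<nu> p)"
  shows "graded (E.A \<nu> I) U"
proof -
  have bot: "U \<inter> {\<zero>\<^bsub>V\<^esub>} = {\<zero>\<^bsub>V\<^esub>}" and top: "U \<inter> carrier V = U"
    using sub_zero[OF U] sub_carrier[OF U] by auto
  have "deligne V (\<lambda>n. U \<inter> W_of Y \<nu> n) (\<lambda>p. U \<inter> fil Y I \<nu> p) (\<lambda>p. U \<inter> fil Y (- I) \<nu> p) (\<lambda>n. n) U"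
  proof (rule deligne_of_opposed[OF _ _ _ _ _ _ _ _ _ _ _ op])
    show "sub (U \<inter> W_of Y \<nu> n)" "sub (U \<inter> fil Y I \<nu> n)" "sub (U \<inter> fil Y (- I) \<nu> n)" for n
      by (intro sub_Int U sub_W sub_fil)+
    show "U \<inter> W_of Y \<nu> m \<subseteq> U \<inter> W_of Y \<nu> n" if "m \<le> n" for m n using W_mono[OF that] by blast
    show "U \<inter> fil Y I \<nu> n \<subseteq> U \<inter> fil Y I \<nu> m" if "m \<le> n" for m n using fil_mono[OF that] by blast
    show "U \<inter> fil Y (- I) \<nu> n \<subseteq> U \<inter> fil Y (- I) \<nu> m" if "m \<le> n" for m n using fil_mono[OF that] by blast
    obtain n where "W_of Y \<nu> n = {\<zero>\<^bsub>V\<^esub>}" using W_bot by blast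
    then show "\<exists>n. U \<inter> W_of Y \<nu> n = {\<zero>\<^bsub>V\<^esub>}" using bot by auto
    obtain n where "W_of Y \<nu> n = carrier V" using W_top by blast
    then show "\<exists>n. U \<inter> W_of Y \<nu> n = U" using top by auto
    obtain n where "fil Y I \<nu> n = carrier V" using fil_top by blast
    then show "\<exists>n. U \<inter> fil Y I \<nu> n = U" using top by auto
    obtain n where "fil Y I \<nu> n = {\<zero>\<^bsub>V\<^esub>}" using fil_bot by blast
    then show "\<exists>n. U \<inter> fil Y I \<nu> n = {\<zero>\<^bsub>V\<^esub>}" using bot by auto
  qed auto
  then interpret R: deligne V "\<lambda>n. U \<inter> W_of Y \<nu> n" "\<lambda>p. U \<inter> fil Y I \<nu> p" "\<lambda>p. U \<inter> fil Y (- I) \<nu> p" "\<lambda>n. n" U .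
  have le: "R.A i \<subseteq> U \<inter> E.A \<nu> I i" for i
  proof -
    have "R.A i \<subseteq> E.A \<nu> I i"
      by (rule bifiltered_A_mono[OF R.bifiltered_axioms E.bifiltered_axioms]) auto
    moreover have "R.A i \<subseteq> U" using R.A_le_W[of "fst i" "snd i"] by auto
    ultimately show ?thesis by blast
  qed
  have "U \<subseteq> Span UNIV R.A" using R.Span_A by simp
  also have "\<dots> \<subseteq> Span UNIV (\<lambda>i. U \<inter> E.A \<nu> I i)"
  proof (rule Span_le)
    show "sub (U \<inter> E.A \<nu> I i)" for i by (intro sub_Int U E.sub_A)
    show "\<exists>j\<in>UNIV. R.A i \<subseteq> U \<inter> E.A \<nu> I j" for i using le by blast
  qed
  finally show ?thesis by (rule graded_if_Span[OF E.sub_A U])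
qed

lemma graded_filtration:
  assumes "\<mu> \<noteq> \<nu>" and U: "U = W_of Y \<mu> n \<or> U = F_of Y \<mu> n \<or> U = Fb_of Y \<mu> n"
  shows "graded (E.A \<nu> I) U"
proof -
  have sF: "sub (F_of Y \<nu> n)" "sub (Fb_of Y \<nu> n)" for \<nu> n
    using desc_F desc_Fb by (simp_all add: descending_filtration_def)
  have sU: "sub U" using U sF sub_W by blast
  have "mixed_Hodge_on V U (W_of Y \<nu>) (F_of Y \<nu>) (Fb_of Y \<nu>)"
  proof -
    have "\<nu> \<noteq> \<mu>" using assms(1) by simp
    then have "mixed_Hodge_on V (W_of Y \<mu> n) (W_of Y \<nu>) (F_of Y \<nu>) (Fb_of Y \<nu>) \<and>
        mixed_Hodge_on V (F_of Y \<mu> n) (W_of Y \<nu>) (F_of Y \<nu>) (Fb_of Y \<nu>) \<and>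
        mixed_Hodge_on V (Fb_of Y \<mu> n) (W_of Y \<nu>) (F_of Y \<nu>) (Fb_of Y \<nu>)"
      using orthogonal unfolding orthogonal_family_def by simp
    then show ?thesis using U by (elim disjE) simp_all
  qed
  then have "opposed_on_graded V (\<lambda>n. U \<inter> W_of Y \<nu> n) (\<lambda>p. U \<inter> F_of Y \<nu> p) (\<lambda>p. U \<inter> Fb_of Y \<nu> p)"
    using mixed_Hodge_on_iff[OF fd asc_W desc_F desc_Fb sU] by blast
  moreover from this have "opposed_on_graded V (\<lambda>n. U \<inter> W_of Y \<nu> n) (\<lambda>p. U \<inter> Fb_of Y \<nu> p) (\<lambda>p. U \<inter> F_of Y \<nu> p)"
    by (rule opposed_on_graded_sym) (intro sub_Int sU sF sub_W)+
  ultimately have "opposed_on_graded V (\<lambda>n. U \<inter> W_of Y \<nu> n) (\<lambda>p. U \<inter> fil Y I \<nu> p) (\<lambda>p. U \<inter> fil Y (- I) \<nu> p)"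
    using fil_pair[of I \<nu>] by auto
  then show ?thesis by (rule graded_if_opposed[OF sU])
qed

text \<open>
  The pieces for \<open>\<mu>\<close> are built from the filtrations with index \<open>\<mu>\<close> by intersections and sums, and all of these
  filtrations are graded for \<open>\<nu>\<close>.
\<close>

lemma graded_E: assumes ne: "\<mu> \<noteq> \<nu>" shows "graded (E.A \<nu> J) (E.A \<mu> I i)"
proof (cases i)
  case (Pair p q)
  have W: "graded (E.A \<nu> J) (W_of Y \<mu> n)" for n using graded_filtration[OF ne, of _ n] by blast
  have F: "graded (E.A \<nu> J) (fil Y K \<mu> n)" for K n
  proof -
    have "fil Y K \<mu> n = W_of Y \<mu> n \<or> fil Y K \<mu> n = F_of Y \<mu> n \<or> fil Y K \<mu> n = Fb_of Y \<mu> n"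
      by (simp add: fil_def)
    then show ?thesis by (rule graded_filtration[OF ne])
  qed
  note FW = graded_Int[OF E.A_independent F W]
  have low: "graded (E.A \<nu> J) (E.low \<mu> I n q)" for n
    unfolding E.low_def by (rule graded_Span[OF E.sub_A _ FW]) (intro sub_Int E.G E.W)
  have A: "E.A \<mu> I (p, q) = (fil Y I \<mu> p \<inter> W_of Y \<mu> (p + q)) \<inter>
      ((fil Y (- I) \<mu> q \<inter> W_of Y \<mu> (p + q)) <+>\<^bsub>V\<^esub> E.low \<mu> I (p + q) q)"
    unfolding E.A_def by simp
  show ?thesis
    unfolding Pair A
    by (intro graded_Int[OF E.A_independent FW] graded_vsum[OF E.sub_A _ E.sub_low FW low] sub_Int E.G E.W)
qed

definition C :: "'g set \<Rightarrow> ('g \<Rightarrow> int) \<times> ('g \<Rightarrow> int) \<Rightarrow> 'v set" where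
  "C I i = (\<Inter>\<mu>. E.A \<mu> I (fst i \<mu>, snd i \<mu>))"

lemma C_splitting: "splitting (C I)"
proof -
  let ?h = "\<lambda>i \<mu>. (fst i \<mu>, snd i \<mu>) :: int \<times> int"
  have "splitting (\<lambda>f. \<Inter>\<mu>. E.A \<mu> I (f \<mu>))"
    by (rule splitting_combine[OF E_splitting graded_E])
  moreover have "bij (?h :: ('g \<Rightarrow> int) \<times> ('g \<Rightarrow> int) \<Rightarrow> _)"
    by (rule bij_betw_byWitness[of _ "\<lambda>f. (\<lambda>\<mu>. fst (f \<mu>), \<lambda>\<mu>. snd (f \<mu>))"]) auto
  ultimately have "splitting (\<lambda>i. \<Inter>\<mu>. E.A \<mu> I (?h i \<mu>))" by (rule splitting_reindex)
  moreover have "(\<lambda>i. \<Inter>\<mu>. E.A \<mu> I (?h i \<mu>)) = C I" by (simp add: C_def fun_eq_iff)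
  ultimately show ?thesis by simp
qed

lemma C_ind: "independent (C I)" and sub_C: "sub (C I i)"
  using C_splitting by (auto simp: splitting_def independent_sub)

lemma Span_C: "Span {i. (fst i \<mu>, snd i \<mu>) \<in> S} (C I) = Span S (E.A \<mu> I)"
  by (rule Span_refine[OF C_splitting E.A_independent]) (auto simp: C_def)

lemma fil_C: "fil Y I \<mu> k = Span {i. k \<le> fst i \<mu>} (C I)"
proof -
  obtain n where n: "W_of Y \<mu> n = carrier V" using W_top by blast
  have "fil Y I \<mu> k = fil Y I \<mu> k \<inter> W_of Y \<mu> n" using sub_carrier[OF sub_fil] by (simp add: n Int_absorb2)
  also have "\<dots> \<subseteq> Span {j. k \<le> fst j} (E.A \<mu> I)" unfolding E.F_Int_W by (rule Span_mono) auto
  finally have "fil Y I \<mu> k \<subseteq> Span {j. k \<le> fst j} (E.A \<mu> I)" .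
  moreover have "Span {j. k \<le> fst j} (E.A \<mu> I) \<subseteq> fil Y I \<mu> k"
  proof (rule Span_least[OF sub_fil])
    fix j :: "int \<times> int" assume "j \<in> {j. k \<le> fst j}"
    then show "E.A \<mu> I j \<subseteq> fil Y I \<mu> k"
      using order_trans[OF E.A_le_F[of \<mu> I "fst j" "snd j"] fil_mono[of k "fst j"]] by simp
  qed
  ultimately show ?thesis using Span_C[of \<mu> "{j. k \<le> fst j}" I] by simp
qed

lemma W_E: "W_of Y \<mu> n = Span {j. fst j + snd j \<le> n} (E.A \<mu> I)"
proof
  obtain p where p: "fil Y I \<mu> p = carrier V" using fil_top by blast
  have "W_of Y \<mu> n = fil Y I \<mu> p \<inter> W_of Y \<mu> n" using sub_carrier[OF sub_W] by (simp add: p Int_absorb1)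
  also have "\<dots> \<subseteq> Span {j. fst j + snd j \<le> n} (E.A \<mu> I)" unfolding E.F_Int_W by (rule Span_mono) auto
  finally show "W_of Y \<mu> n \<subseteq> Span {j. fst j + snd j \<le> n} (E.A \<mu> I)" .
  show "Span {j. fst j + snd j \<le> n} (E.A \<mu> I) \<subseteq> W_of Y \<mu> n"
  proof (rule Span_least[OF sub_W])
    fix j :: "int \<times> int" assume "j \<in> {j. fst j + snd j \<le> n}"
    then show "E.A \<mu> I j \<subseteq> W_of Y \<mu> n"
      using order_trans[OF E.A_le_W[of \<mu> I "fst j" "snd j"] W_mono[of "fst j + snd j" n]] by simp
  qed
qed

lemma W_C: "W_of Y \<mu> n = Span {i. fst i \<mu> + snd i \<mu> \<le> n} (C I)"
  using W_E[of \<mu> n I] Span_C[of \<mu> "{j. fst j + snd j \<le> n}" I] by simp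

lemma total_weight_C: "total_weight Y n = Span {i. tot (fst i + snd i) \<le> n} (C I)"
  unfolding total_weight_def
  by (subst total_weight_Span[OF C_ind]) (simp_all add: W_C[of _ _ I] Collect_pair)

lemma multi_F_C: "(\<Inter>\<mu>. fil Y I \<mu> (p \<mu>)) = Span {i. p \<le> fst i} (C I)"
proof -
  have "(\<Inter>\<mu>. fil Y I \<mu> (p \<mu>)) = Span (\<Inter>\<mu>. {i. p \<mu> \<le> fst i \<mu>}) (C I)"
    unfolding fil_C by (rule independent_Span_INT[OF C_ind]) auto
  also have "(\<Inter>\<mu>. {i. p \<mu> \<le> fst i \<mu>}) = {i :: _ \<times> ('g \<Rightarrow> int). p \<le> fst i}" by (auto simp: le_fun_def)
  finally show ?thesis .
qed

text \<open>
  Inclusions between the splittings for single indices multiply to inclusions between the combined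
  ones, because intersections are computed on index sets.
\<close>

lemma C_le_Span:
  assumes "\<And>\<mu>. E.A \<mu> I (fst i \<mu>, snd i \<mu>) \<subseteq> Span (S \<mu>) (E.A \<mu> J)"
  shows "C I i \<subseteq> Span {k. \<forall>\<mu>. (fst k \<mu>, snd k \<mu>) \<in> S \<mu>} (C J)"
proof -
  have "C I i \<subseteq> (\<Inter>\<mu>. Span {k. (fst k \<mu>, snd k \<mu>) \<in> S \<mu>} (C J))"
    unfolding C_def Span_C[unfolded C_def] using assms by blast
  also have "\<dots> = Span (\<Inter>\<mu>. {k. (fst k \<mu>, snd k \<mu>) \<in> S \<mu>}) (C J)"
    by (rule independent_Span_INT[OF C_ind]) auto
  also have "(\<Inter>\<mu>. {k. (fst k \<mu>, snd k \<mu>) \<in> S \<mu>}) = {k. \<forall>\<mu>. (fst k \<mu>, snd k \<mu>) \<in> S \<mu>}" by auto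
  finally show ?thesis .
qed

lemma E_opposite:
  "E.A \<mu> I (a, b) \<subseteq> Span ({(b, a)} \<union> {j. fst j + snd j \<le> a + b - 1}) (E.A \<mu> (- I))"
proof -
  have "E.H \<mu> I n (a, b) = E.H \<mu> (- I) n (b, a)" for n
    unfolding E.H_def E.P_def E.Q_def split unfolding double_complement by (rule Int_commute)
  then have "E.A \<mu> I (a, b) \<subseteq> E.A \<mu> (- I) (b, a) <+>\<^bsub>V\<^esub> W_of Y \<mu> (a + b - 1)"
    using E.A_le_H[of \<mu> I a b] E.H_eq[of "a + b" b a \<mu> "- I"] by (simp add: add.commute)
  also have "\<dots> = Span ({(b, a)} \<union> {j. fst j + snd j \<le> a + b - 1}) (E.A \<mu> (- I))"
    unfolding W_E[of \<mu> "a + b - 1" "- I"] 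
    using Span_insert[of "E.A \<mu> (- I)" "(b, a)" "{j. fst j + snd j \<le> a + b - 1}", OF E.sub_A E.sub_A] by simp
  finally show ?thesis .
qed

text \<open>
  For each \<open>\<mu>\<close> the index pair is either exchanged or the partial weight drops. If it drops for at least one
  \<open>\<mu>\<close>, so does the total weight.
\<close>

lemma C_opposite: "C I i \<subseteq> C (- I) (prod.swap i) <+>\<^bsub>V\<^esub> total_weight Y (tot (fst i + snd i) - 1)"
proof -
  let ?S = "\<lambda>\<mu>. {(snd i \<mu>, fst i \<mu>)} \<union> {j. fst j + snd j \<le> fst i \<mu> + snd i \<mu> - 1}"
  have "C I i \<subseteq> Span {k. \<forall>\<mu>. (fst k \<mu>, snd k \<mu>) \<in> ?S \<mu>} (C (- I))"
    by (rule C_le_Span[OF E_opposite])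
  also have "\<dots> \<subseteq> Span ({prod.swap i} \<union> {k. tot (fst k + snd k) \<le> tot (fst i + snd i) - 1}) (C (- I))"
  proof (rule Span_mono, rule subsetI)
    fix k :: "('g \<Rightarrow> int) \<times> ('g \<Rightarrow> int)" assume "k \<in> {k. \<forall>\<mu>. (fst k \<mu>, snd k \<mu>) \<in> ?S \<mu>}"
    then have k: "(fst k \<mu> = snd i \<mu> \<and> snd k \<mu> = fst i \<mu>) \<or> fst k \<mu> + snd k \<mu> \<le> fst i \<mu> + snd i \<mu> - 1" for \<mu>
      by fastforce
    have le: "fst k + snd k \<le> fst i + snd i" unfolding le_fun_def using k by (simp, smt (verit))
    show "k \<in> {prod.swap i} \<union> {k. tot (fst k + snd k) \<le> tot (fst i + snd i) - 1}"
    proof (cases "fst k + snd k = fst i + snd i")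
      case True
      have "fst k \<mu> = snd i \<mu> \<and> snd k \<mu> = fst i \<mu>" for \<mu>
        using k[of \<mu>] fun_cong[OF True, of \<mu>] by auto
      then have "k = prod.swap i" by (simp add: prod_eq_iff fun_eq_iff)
      then show ?thesis by simp
    next
      case False
      then show ?thesis using tot_le[OF le] tot_eq_imp_eq[OF le] by fastforce
    qed
  qed
  also have "\<dots> = C (- I) (prod.swap i) <+>\<^bsub>V\<^esub> total_weight Y (tot (fst i + snd i) - 1)"
    unfolding total_weight_C[of _ "- I"] using Span_insert[OF sub_C sub_C] by simp
  finally show ?thesis .
qed

lemma to_plectic_filtered: "is_filtered_space (to_plectic Y)"
proof -
  have "ascending_filtration V (total_weight Y)"
    by (rule ascending_of_degree[OF fd C_splitting total_weight_C])
  then show ?thesis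
    unfolding is_filtered_space_def to_plectic_def using desc_F desc_Fb fdV by simp
qed

sublocale X: plectic_object "to_plectic Y"
  rewrites "space_of (to_plectic Y) = space_of Y"
    and "weight (to_plectic Y) = total_weight Y"
proof -
  show "plectic_object (to_plectic Y)"
    by (simp add: plectic_object_def filtered_object_def to_plectic_filtered)
qed (simp_all add: to_plectic_def)


lemma multi_F_Span: "multi_F (to_plectic Y) I p = Span {i. p \<le> fst i} (C I)"
  unfolding multi_F_fil fil_to_plectic by (rule multi_F_C)

text \<open>
  For each \<open>\<mu>\<close> the definition of the Deligne subspace lowers the index of the opposite filtration by some
  \<open>j \<mu> \<ge> 0\<close> and, if \<open>j \<mu> > 0\<close>, the partial weight by at least \<open>j \<mu> + 1\<close>. If all \<open>j \<mu>\<close> vanish, the piece lies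
  in the first summand; otherwise the total weight drops by at least \<open>tot j + 1\<close> and the piece lies in
  the summand of \<open>lower_Fb\<close> that belongs to \<open>j\<close>.
\<close>

lemma C_low:
  "C I i \<subseteq> (multi_Fb (to_plectic Y) I (snd i) \<inter> total_weight Y (tot (fst i + snd i))) <+>\<^bsub>V\<^esub>
     X.B.low I (tot (fst i + snd i)) (snd i)"
proof -
  let ?n = "tot (fst i + snd i)" and ?q = "snd i" and ?p = "fst i"
  let ?G = "multi_Fb (to_plectic Y) I" and ?W = "total_weight Y" and ?low = "X.B.low I"
  let ?R = "(?G ?q \<inter> ?W ?n) <+>\<^bsub>V\<^esub> ?low ?n ?q"
  \<comment> \<open>The least drop of weight that goes with a drop by \<open>j\<close> of the filtration index.\<close>
  define d :: "int \<Rightarrow> int" where "d j = (if j = 0 then 0 else j + 1)" for j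
  define S where "S \<mu> = {k. \<exists>j\<ge>0. ?q \<mu> - j \<le> fst k \<and> fst k + snd k \<le> ?p \<mu> + ?q \<mu> - d j}" for \<mu>
  have E_low: "E.A \<mu> I (?p \<mu>, ?q \<mu>) \<subseteq> Span (S \<mu>) (E.A \<mu> (- I))" for \<mu>
  proof -
    let ?a = "?p \<mu>" and ?b = "?q \<mu>"
    have GW: "fil Y (- I) \<mu> x \<inter> W_of Y \<mu> y = Span {k. x \<le> fst k \<and> fst k + snd k \<le> y} (E.A \<mu> (- I))" for x y
      unfolding E.F_Int_W by (simp add: Collect_pair)
    have sS: "sub (Span (S \<mu>) (E.A \<mu> (- I)))" by (rule E.sub_SpanA)
    have "fil Y (- I) \<mu> ?b \<inter> W_of Y \<mu> (?a + ?b) \<subseteq> Span (S \<mu>) (E.A \<mu> (- I))"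
      unfolding GW S_def by (rule Span_mono) (auto simp: d_def intro!: exI[of _ 0])
    moreover have "E.low \<mu> I (?a + ?b) ?b \<subseteq> Span (S \<mu>) (E.A \<mu> (- I))"
      unfolding E.low_def
    proof (rule Span_least[OF sS])
      fix j :: int assume "j \<in> {j. 0 \<le> j}"
      then show "fil Y (- I) \<mu> (?b - j) \<inter> W_of Y \<mu> (?a + ?b - j - 1) \<subseteq> Span (S \<mu>) (E.A \<mu> (- I))"
        unfolding GW S_def by (intro Span_mono) (auto simp: d_def intro!: exI[of _ j])
    qed
    ultimately show ?thesis
      using order_trans[OF E.A_le_G[of \<mu> I ?a ?b] vsum_least[OF sS]] by blast
  qed
  have G: "?G q = Span {k. q \<le> fst k} (C (- I))" for q
    unfolding multi_Fb_fil by (rule multi_F_Span)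
  have sR: "sub ?R" by (intro sub_vsum sub_Int X.B.G X.B.W X.B.sub_low)
  have up: "?G ?q \<inter> ?W ?n \<subseteq> ?R" "?low ?n ?q \<subseteq> ?R"
    by (intro vsum_upper1 vsum_upper2 sub_Int X.B.G X.B.W X.B.sub_low)+
  have "C I i \<subseteq> Span {k. \<forall>\<mu>. (fst k \<mu>, snd k \<mu>) \<in> S \<mu>} (C (- I))"
    by (rule C_le_Span[OF E_low])
  also have "\<dots> \<subseteq> ?R"
  proof (rule Span_least[OF sR])
    fix k :: "('g \<Rightarrow> int) \<times> ('g \<Rightarrow> int)" assume "k \<in> {k. \<forall>\<mu>. (fst k \<mu>, snd k \<mu>) \<in> S \<mu>}"
    then have "\<forall>\<mu>. \<exists>j\<ge>0. ?q \<mu> - j \<le> fst k \<mu> \<and> fst k \<mu> + snd k \<mu> \<le> ?p \<mu> + ?q \<mu> - d j"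
      by (simp add: S_def)
    then obtain j where j: "\<And>\<mu>. 0 \<le> j \<mu> \<and> ?q \<mu> - j \<mu> \<le> fst k \<mu> \<and>
        fst k \<mu> + snd k \<mu> \<le> ?p \<mu> + ?q \<mu> - d (j \<mu>)" by metis
    have j0: "0 \<le> j" and qj: "?q - j \<le> fst k" using j by (auto simp: le_fun_def)
    have kC: "C (- I) k \<subseteq> ?G (?q - j)" unfolding G by (rule Span_upper[OF sub_C]) (simp add: qj)
    have W: "C (- I) k \<subseteq> ?W m" if "tot (fst k + snd k) \<le> m" for m
      unfolding total_weight_C[of m "- I"] by (rule Span_upper[OF sub_C]) (simp add: that)
    have d: "d (j \<mu>) \<ge> j \<mu>" for \<mu> by (simp add: d_def)
    show "C (- I) k \<subseteq> ?R"
    proof (cases "j = 0")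
      case True
      have "fst k + snd k \<le> ?p + ?q" using j d_def True by (simp add: le_fun_def)
      then have "C (- I) k \<subseteq> ?W ?n" by (intro W tot_le)
      then show ?thesis using kC up(1) True by auto
    next
      case False
      then obtain \<nu> where \<nu>: "j \<nu> \<noteq> 0" by (auto simp: fun_eq_iff)
      have le: "fst k + snd k \<le> ?p + ?q - j"
        unfolding le_fun_def
      proof
        fix \<mu>
        show "(fst k + snd k) \<mu> \<le> (?p + ?q - j) \<mu>" using j[of \<mu>] d[of \<mu>] by simp
      qed
      have "(fst k + snd k) \<nu> < (?p + ?q - j) \<nu>" using j[of \<nu>] \<nu> by (simp add: d_def)
      then have "fst k + snd k \<noteq> ?p + ?q - j" by (metis less_irrefl)
      then have "tot (fst k + snd k) < tot (?p + ?q - j)"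
        using tot_le[OF le] tot_eq_imp_eq[OF le] by fastforce
      moreover have "tot (?p + ?q - j) = ?n - tot j" by (rule X.B.tot_diff)
      ultimately have "C (- I) k \<subseteq> ?W (?n - tot j - 1)" by (intro W) simp
      then have "C (- I) k \<subseteq> ?G (?q - j) \<inter> ?W (?n - tot j - 1)" using kC by blast
      also have "\<dots> \<subseteq> ?low ?n ?q"
        unfolding X.B.low_def by (rule Span_upper) (use j0 in \<open>auto intro: sub_Int X.B.G X.B.W\<close>)
      finally show ?thesis using up(2) by blast
    qed
  qed
  finally show ?thesis .
qed

sublocale S: opposite_splittings V "total_weight Y" "multi_F (to_plectic Y) I" "multi_Fb (to_plectic Y) I" tot
    "C I" "\<lambda>i. C (- I) (prod.swap i)" for I
proof unfold_locales
  show "splitting (C I)" by (rule C_splitting)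
  show "splitting (\<lambda>i. C (- I) (prod.swap i))" by (rule splitting_reindex[OF C_splitting bij_swap])
  show "multi_F (to_plectic Y) I p = Span {(r, s). p \<le> r} (C I)" for p
    by (simp add: multi_F_Span Collect_pair)
  show "multi_Fb (to_plectic Y) I q = Span {(r, s). q \<le> s} (\<lambda>i. C (- I) (prod.swap i))" for q
    unfolding Collect_pair Span_swap multi_Fb_fil by (simp add: multi_F_Span)
  show "total_weight Y n = Span {(r, s). tot (r + s) \<le> n} (C I)" for n
    by (simp add: total_weight_C[of n I] Collect_pair)
  show "total_weight Y n = Span {(r, s). tot (r + s) \<le> n} (\<lambda>i. C (- I) (prod.swap i))" for n
    unfolding Collect_pair Span_swap by (simp add: total_weight_C[of n "- I"] add.commute)
  show "C I (p, q) \<subseteq> (multi_Fb (to_plectic Y) I q \<inter> total_weight Y (tot (p + q))) <+>\<^bsub>V\<^esub>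
      X.B.low I (tot (p + q)) q" for p q
    using C_low[of I "(p, q)"] by simp
  show "C I (r, s) \<subseteq> C (- I) (prod.swap (r, s)) <+>\<^bsub>V\<^esub> total_weight Y (tot (r + s) - 1)" for r s
    using C_opposite[of I "(r, s)"] by simp
  show "C (- I) (prod.swap (r, s)) \<subseteq> C I (r, s) <+>\<^bsub>V\<^esub> total_weight Y (tot (r + s) - 1)" for r s
    using C_opposite[of "- I" "(s, r)"] by (simp add: add.commute)
  show "a = b" if "a \<le> b" "tot a = tot b" for a b :: "'g \<Rightarrow> int" using that by (rule tot_eq_imp_eq)
  show "\<exists>p\<le>r. tot p = k" if "k \<le> tot r" for k and r :: "'g \<Rightarrow> int" using that by (rule tot_lower)
qed

lemma partial_weight_to_plectic: "partial_weight (to_plectic Y) I \<mu> n = W_of Y \<mu> n"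
proof -
  have "X.B.A I = C I" using S.A_eq_C by (simp add: fun_eq_iff)
  then show ?thesis unfolding X.partial_weight_eq W_C[of \<mu> n I] by (simp add: Collect_pair)
qed

text \<open>
  The total filtration ends because a tuple of large total degree is large in some coordinate, where
  the filtration vanishes.
\<close>

lemma desc_total: "descending_filtration V (\<lambda>k. Span {p. tot p = k} (multi_F (to_plectic Y) I))"
  unfolding descending_filtration_def
proof (intro conjI allI impI)
  let ?F = "multi_F (to_plectic Y) I" and ?T = "\<lambda>k. Span {p. tot p = k} (multi_F (to_plectic Y) I)"
  show sT: "sub (?T k)" for k by (rule sub_Span[OF X.B.F])
  show "?T l \<subseteq> ?T k" if kl: "k \<le> l" for k l
  proof (rule Span_le[OF X.B.F])
    fix r :: "'g \<Rightarrow> int" assume "r \<in> {p. tot p = l}"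
    then obtain p where p: "p \<le> r" "tot p = k" using tot_lower[of k r] kl by auto
    then show "\<exists>p\<in>{p. tot p = k}. ?F r \<subseteq> ?F p" using X.B.F_mono[OF p(1)] by blast
  qed
  obtain p where p: "?F p = carrier V" using X.B.F_top by blast
  have "?F p \<subseteq> ?T (tot p)" by (rule Span_upper[OF X.B.F]) simp
  then show "\<exists>k. ?T k = carrier V" using p sub_carrier[OF sT[of "tot p"]] by (intro exI[of _ "tot p"]) auto
  obtain N where N: "\<And>\<mu>. fil Y I \<mu> (N \<mu>) = {\<zero>\<^bsub>V\<^esub>}" using fil_bot by metis
  have "?T (tot N) \<subseteq> {\<zero>\<^bsub>V\<^esub>}"
  proof (rule Span_least[OF sub_bot])
    fix p :: "'g \<Rightarrow> int" assume "p \<in> {p. tot p = tot N}"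
    then have "\<not> (\<forall>\<mu>. p \<mu> < N \<mu>)" using tot_large[of p N] by auto
    then obtain \<mu> where "N \<mu> \<le> p \<mu>" by (auto simp: not_less)
    then have "fil Y I \<mu> (p \<mu>) \<subseteq> {\<zero>\<^bsub>V\<^esub>}" using fil_mono[of "N \<mu>" "p \<mu>" I \<mu>] N by simp
    then show "?F p \<subseteq> {\<zero>\<^bsub>V\<^esub>}" unfolding multi_F_fil fil_to_plectic by blast
  qed
  then show "\<exists>k. ?T k = {\<zero>\<^bsub>V\<^esub>}" using sub_zero[OF sT[of "tot N"]] by (intro exI[of _ "tot N"]) auto
qed

lemma to_plectic_mixed: "mixed_plectic (to_plectic Y)"
proof -
  have "plectic_b (to_plectic Y) I" for I
  proof -
    have s: "space_of (to_plectic Y) = V" "weight (to_plectic Y) = total_weight Y" by (simp_all add: to_plectic_def)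
    have "descending_filtration V (total_F (to_plectic Y) I)" "descending_filtration V (total_Fb (to_plectic Y) I)"
      using desc_total[of I] desc_total[of "- I"]
      unfolding total_F_def[abs_def] total_Fb_def[abs_def] s multi_Fb_fil by auto
    moreover have "opposed_on_graded V (total_weight Y) (total_F (to_plectic Y) I) (total_Fb (to_plectic Y) I)"
      using S.total_opposed[of I] unfolding total_F_def[abs_def] total_Fb_def[abs_def] s .
    ultimately show ?thesis
      unfolding plectic_b_def mixed_Hodge_iff s using fdV ascending_of_degree[OF fd C_splitting total_weight_C] by blast
  qed
  moreover have "plectic_a (to_plectic Y) I" "plectic_c (to_plectic Y) I" for I
    using X.plectic_a_c_if_deligne[OF S.deligne] .
  ultimately show ?thesis
    unfolding mixed_plectic_def mixed_weak_plectic_def by (simp add: partial_weight_to_plectic)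
qed

end

section \<open>Functors and equivalence\<close>

lemma linear_map_image_Sum:
  assumes f: "linear_map class_ring V V' f"
    and U: "\<And>i. i \<in> S \<Longrightarrow> csubspace V (U i)" and U': "\<And>i. i \<in> S \<Longrightarrow> csubspace V' (U' i)"
    and le: "\<And>i. i \<in> S \<Longrightarrow> f ` U i \<subseteq> U' i"
  shows "f ` Sum_spaces V S U \<subseteq> Sum_spaces V' S U'"
proof -
  interpret f: linear_map class_ring V V' f by (rule f)
  interpret A: complex_space V by (simp add: complex_space_def f.V.vectorspace_axioms)
  interpret B: complex_space V' by (simp add: complex_space_def f.W.vectorspace_axioms)
  have s: "csubspace V' (Sum_spaces V' S U')" by (rule B.sub_Span[OF U'])
  let ?Z = "{x \<in> carrier V. f x \<in> Sum_spaces V' S U'}"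
  have "csubspace V ?Z"
  proof (rule A.subI)
    show "\<zero>\<^bsub>V\<^esub> \<in> ?Z" using B.sub_zero[OF s] by simp
    show "x \<oplus>\<^bsub>V\<^esub> y \<in> ?Z" if "x \<in> ?Z" "y \<in> ?Z" for x y using that B.sub_add[OF s, of "f x" "f y"] by simp
    show "c \<odot>\<^bsub>V\<^esub> x \<in> ?Z" if "x \<in> ?Z" for c x
      using that B.sub_smult[OF s, of "f x" c] f.f_smult[of c x] A.sub_smult[OF A.sub_top, of x c] by simp
  qed auto
  moreover have "U i \<subseteq> ?Z" if "i \<in> S" for i
    using le[OF that] A.sub_carrier[OF U[OF that]] B.Span_upper[of S U' i, OF U' that] by blast
  ultimately have "Sum_spaces V S U \<subseteq> ?Z" by (rule A.Span_least)
  then show ?thesis by blast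
qed

lemma linear_map_image_set_add:
  assumes f: "linear_map class_ring V V' f" and "A \<subseteq> carrier V" "B \<subseteq> carrier V"
    and "f ` A \<subseteq> A'" "f ` B \<subseteq> B'"
  shows "f ` (A <+>\<^bsub>V\<^esub> B) \<subseteq> A' <+>\<^bsub>V'\<^esub> B'"
proof -
  interpret f: linear_map class_ring V V' f by (rule f)
  have "f (a \<oplus>\<^bsub>V\<^esub> b) = f a \<oplus>\<^bsub>V'\<^esub> f b" if "a \<in> A" "b \<in> B" for a b
    using that assms(2,3) by (intro f.f_add) auto
  then show ?thesis using assms(4,5) by (fastforce simp: set_add_def')
qed

lemma filtered_mapsD:
  assumes "f \<in> filtered_maps X Y"
  shows "f \<in> extensional (carrier (space_of X))" "linear_map class_ring (space_of X) (space_of Y) f"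
    "f ` W_of X i n \<subseteq> W_of Y i n" "f ` fil X I \<mu> p \<subseteq> fil Y I \<mu> p"
  using assms by (auto simp: filtered_maps_def fil_def)

lemma filtered_mapsI:
  assumes "f \<in> extensional (carrier (space_of X))" "linear_map class_ring (space_of X) (space_of Y) f"
    "\<And>i n. f ` W_of X i n \<subseteq> W_of Y i n" "\<And>I \<mu> p. f ` fil X I \<mu> p \<subseteq> fil Y I \<mu> p"
  shows "f \<in> filtered_maps X Y"
proof -
  have "f ` F_of X \<mu> p \<subseteq> F_of Y \<mu> p" "f ` Fb_of X \<mu> p \<subseteq> Fb_of Y \<mu> p" for \<mu> p
    using assms(4)[of "{}" \<mu> p] assms(4)[of UNIV \<mu> p] by (simp_all add: fil_def)
  then show ?thesis using assms(1-3) by (simp add: filtered_maps_def)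
qed

lemma to_plectic_map:
  assumes X: "is_filtered_space X" and Y: "is_filtered_space Y" and f: "f \<in> filtered_maps X Y"
  shows "f \<in> filtered_maps (to_plectic X) (to_plectic Y)"
proof -
  interpret X: filtered_object X by (rule filtered_object.intro[OF X])
  interpret Y: filtered_object Y by (rule filtered_object.intro[OF Y])
  note f' = filtered_mapsD[OF f]
  have "f ` total_weight X n \<subseteq> total_weight Y n" for n
    unfolding total_weight_def
  proof (rule linear_map_image_Sum[OF f'(2)])
    show "csubspace (space_of X) (\<Inter>\<mu>. W_of X \<mu> (m \<mu>))" for m by (rule X.sub_INT[OF X.sub_W]) simp
    show "csubspace (space_of Y) (\<Inter>\<mu>. W_of Y \<mu> (m \<mu>))" for m by (rule Y.sub_INT[OF Y.sub_W]) simp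
    show "f ` (\<Inter>\<mu>. W_of X \<mu> (m \<mu>)) \<subseteq> (\<Inter>\<mu>. W_of Y \<mu> (m \<mu>))" for m using f'(3) by blast
  qed
  then show ?thesis
    using f'(1,2,4) by (intro filtered_mapsI) (simp_all add: fil_to_plectic, simp_all add: to_plectic_def)
qed

text \<open>
  The subspaces \<open>A_sub\<close> are built from the filtrations by intersections and sums, and a filtered map
  respects each of these operations.
\<close>

lemma to_family_map:
  assumes X: "is_filtered_space X" and Y: "is_filtered_space Y" and f: "f \<in> filtered_maps X Y"
  shows "f \<in> filtered_maps (to_family X) (to_family Y)"
proof -
  interpret X: plectic_object X by (simp add: plectic_object_def filtered_object_def X)
  interpret Y: plectic_object Y by (simp add: plectic_object_def filtered_object_def Y)
  note f' = filtered_mapsD[OF f]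
  have F: "f ` multi_F X I p \<subseteq> multi_F Y I p" for I p
  proof -
    have "f ` fil X I \<mu> (p \<mu>) \<subseteq> fil Y I \<mu> (p \<mu>)" for \<mu> by (rule f'(4))
    then show ?thesis unfolding multi_F_fil by fastforce
  qed
  have G: "f ` multi_Fb X I p \<subseteq> multi_Fb Y I p" for I p
    unfolding multi_Fb_fil by (rule F)
  have low: "f ` lower_Fb X I n q \<subseteq> lower_Fb Y I n q" for I n q
    unfolding lower_Fb_def
  proof (rule linear_map_image_Sum[OF f'(2)])
    fix j :: "'b \<Rightarrow> int"
    let ?q = "\<lambda>\<mu>. q \<mu> - j \<mu>" and ?m = "n - tot j - 1"
    show "csubspace (space_of X) (multi_Fb X I ?q \<inter> weight X ?m)" by (intro X.sub_Int X.B.G X.sub_W)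
    show "csubspace (space_of Y) (multi_Fb Y I ?q \<inter> weight Y ?m)" by (intro Y.sub_Int Y.B.G Y.sub_W)
    show "f ` (multi_Fb X I ?q \<inter> weight X ?m) \<subseteq> multi_Fb Y I ?q \<inter> weight Y ?m"
      using G[of I ?q] f'(3)[of "()" ?m] by blast
  qed
  have A: "f ` A_sub X I p q \<subseteq> A_sub Y I p q" for I p q
  proof -
    let ?n = "tot (\<lambda>\<mu>. p \<mu> + q \<mu>)"
    have "f ` ((multi_Fb X I q \<inter> weight X ?n) <+>\<^bsub>space_of X\<^esub> lower_Fb X I ?n q)
        \<subseteq> (multi_Fb Y I q \<inter> weight Y ?n) <+>\<^bsub>space_of Y\<^esub> lower_Fb Y I ?n q"
    proof (rule linear_map_image_set_add[OF f'(2) _ _ _ low])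
      show "multi_Fb X I q \<inter> weight X ?n \<subseteq> carrier (space_of X)" using X.sub_carrier[OF X.sub_W] by blast
      show "lower_Fb X I ?n q \<subseteq> carrier (space_of X)"
        unfolding X.lower_Fb_eq by (rule X.sub_carrier[OF X.B.sub_low])
      show "f ` (multi_Fb X I q \<inter> weight X ?n) \<subseteq> multi_Fb Y I q \<inter> weight Y ?n"
        using G[of I q] f'(3)[of "()" ?n] by blast
    qed
    moreover have "f ` (multi_F X I p \<inter> weight X ?n) \<subseteq> multi_F Y I p \<inter> weight Y ?n"
      using F[of I p] f'(3)[of "()" ?n] by blast
    ultimately show ?thesis unfolding A_sub_def Let_def by blast
  qed
  have sX: "csubspace (space_of X) (A_sub X I p q)" and sY: "csubspace (space_of Y) (A_sub Y I p q)" for I p q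
    unfolding X.A_sub_eq Y.A_sub_eq by (rule X.B.sub_A Y.B.sub_A)+
  have "f ` partial_weight X {} \<mu> n \<subseteq> partial_weight Y {} \<mu> n" for \<mu> n
    unfolding partial_weight_def
  proof (rule linear_map_image_Sum[OF f'(2)], goal_cases)
    case (1 i) then show ?case using sX by (cases i) simp
  next
    case (2 i) then show ?case using sY by (cases i) simp
  next
    case (3 i) then show ?case using A by (cases i) simp
  qed
  then show ?thesis
    using f'(1,2,4) by (intro filtered_mapsI) (simp_all add: fil_to_family, simp_all add: to_family_def)
qed

lemma filtered_id: assumes X: "is_filtered_space X" shows "(\<lambda>x\<in>carrier (space_of X). x) \<in> filtered_maps X X"
proof -
  interpret filtered_object X by (rule filtered_object.intro[OF X])
  have "linear_map class_ring V V (\<lambda>x\<in>carrier V. x)"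
    unfolding linear_map_def mod_hom_def mod_hom_axioms_def LinearCombinations.module_hom_def
    using vectorspace_axioms module_axioms sub_smult[OF sub_top] by (auto simp: M.a_closed)
  moreover have "(\<lambda>x\<in>carrier V. x) ` U = U" if "sub U" for U
    using sub_carrier[OF that] by force
  ultimately show ?thesis using sub_W sub_fil by (intro filtered_mapsI) auto
qed

lemma filtered_compose:
  assumes X: "is_filtered_space X" and f: "f \<in> filtered_maps X Y" and h: "h \<in> filtered_maps Y Z"
  shows "compose (carrier (space_of X)) h f \<in> filtered_maps X Z"
proof -
  interpret X: filtered_object X by (rule filtered_object.intro[OF X])
  note f' = filtered_mapsD[OF f] and h' = filtered_mapsD[OF h]
  interpret f: linear_map class_ring "space_of X" "space_of Y" f by (rule f'(2))
  interpret h: linear_map class_ring "space_of Y" "space_of Z" h by (rule h'(2))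
  have c: "compose (carrier (space_of X)) h f x = h (f x)" if "x \<in> carrier (space_of X)" for x
    using that by (simp add: compose_def)
  have s: "c \<odot>\<^bsub>space_of X\<^esub> x \<in> carrier (space_of X)" if "x \<in> carrier (space_of X)" for c x
    using X.sub_smult[OF X.sub_top that] .
  have "linear_map class_ring (space_of X) (space_of Z) (compose (carrier (space_of X)) h f)"
    unfolding linear_map_def mod_hom_def mod_hom_axioms_def LinearCombinations.module_hom_def
  proof (intro conjI CollectI allI impI)
    fix a b assume "a \<in> carrier (space_of X) \<and> b \<in> carrier (space_of X)"
    then show "compose (carrier (space_of X)) h f (a \<oplus>\<^bsub>space_of X\<^esub> b) =
        compose (carrier (space_of X)) h f a \<oplus>\<^bsub>space_of Z\<^esub> compose (carrier (space_of X)) h f b"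
      by (simp add: c)
  next
    fix r a assume a: "r \<in> carrier (class_ring :: complex ring) \<and> a \<in> carrier (space_of X)"
    then show "compose (carrier (space_of X)) h f (r \<odot>\<^bsub>space_of X\<^esub> a) =
        r \<odot>\<^bsub>space_of Z\<^esub> compose (carrier (space_of X)) h f a"
      using f.f_smult[of r a] h.f_smult[of r "f a"] by (simp add: c s)
  qed (use f'(2) h'(2) in \<open>auto simp: c linear_map_def vectorspace_def\<close>)
  moreover have "compose (carrier (space_of X)) h f ` U \<subseteq> U''"
    if U: "csubspace (space_of X) U" and f: "f ` U \<subseteq> U'" and h: "h ` U' \<subseteq> U''" for U U' U''
  proof -
    have "compose (carrier (space_of X)) h f ` U = h ` f ` U"
      unfolding image_image by (rule image_cong) (use c X.sub_carrier[OF U] in auto)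
    then show ?thesis using image_mono[OF f, of h] h by simp
  qed
  note im = this
  have "compose (carrier (space_of X)) h f ` W_of X i n \<subseteq> W_of Z i n" for i n
    by (rule im[OF X.sub_W f'(3) h'(3)])
  moreover have "compose (carrier (space_of X)) h f ` fil X I \<mu> p \<subseteq> fil Z I \<mu> p" for I \<mu> p
    by (rule im[OF X.sub_fil f'(4) h'(4)])
  ultimately show ?thesis by (intro filtered_mapsI) (simp_all add: compose_def)
qed

lemma Fil_category: "is_category (Fil :: (('v, 'l::finite, 'm::finite) filtered_space, 'v \<Rightarrow> 'v) category)"
proof -
  have cl: "f x \<in> carrier (space_of Y)" if "f \<in> filtered_maps X Y" "x \<in> carrier (space_of X)"
    for f X and Y :: "('v, 'l, 'm) filtered_space" and x
  proof -
    interpret f: linear_map class_ring "space_of X" "space_of Y" f by (rule filtered_mapsD(2)[OF that(1)])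
    show ?thesis using that(2) by simp
  qed
  have unit: "compose (carrier (space_of X)) f (\<lambda>x\<in>carrier (space_of X). x) = f"
      "compose (carrier (space_of X)) (\<lambda>x\<in>carrier (space_of Y). x) f = f"
    if "f \<in> filtered_maps X Y" for f and X Y :: "('v, 'l, 'm) filtered_space"
    using filtered_mapsD(1)[OF that] cl[OF that]
    by (auto simp: compose_def fun_eq_iff extensional_def restrict_def)
  have assoc: "compose (carrier (space_of X)) (compose (carrier (space_of Y)) k h) f =
      compose (carrier (space_of X)) k (compose (carrier (space_of X)) h f)"
    if "f \<in> filtered_maps X Y" for f h k and X Y :: "('v, 'l, 'm) filtered_space"
    using cl[OF that] by (auto simp: compose_def fun_eq_iff restrict_def)
  show ?thesis
    unfolding is_category_def Fil_def
    by (intro conjI ballI) (simp_all add: filtered_id filtered_compose unit assoc)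
qed

lemma full_subcategory_category: "is_category C \<Longrightarrow> is_category (full_subcategory C P)"
  unfolding is_category_def full_subcategory_def by simp

text \<open>
  Enough here, since both composites of the two constructions are equal to, and not just isomorphic
  to, the identity.
\<close>

lemma naturally_isomorphic_id:
  assumes C: "is_category C" and obj: "\<And>X. X \<in> Obj C \<Longrightarrow> on_obj \<Phi> X = X"
    and arr: "\<And>X Y f. X \<in> Obj C \<Longrightarrow> Y \<in> Obj C \<Longrightarrow> f \<in> Hom C X Y \<Longrightarrow> on_arr \<Phi> X Y f = f"
  shows "naturally_isomorphic C C \<Phi> id_func"
  unfolding naturally_isomorphic_def id_func_def
proof (intro exI[of _ "Id C"] conjI ballI)
  fix X assume X: "X \<in> Obj C"
  have i: "Id C X \<in> Hom C X X" using C X unfolding is_category_def by blast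
  then have "Comp C X X X (Id C X) (Id C X) = Id C X" using C X unfolding is_category_def by blast
  then show "is_iso C (on_obj \<Phi> X) (on_obj \<lparr>on_obj = \<lambda>X. X, on_arr = \<lambda>X Y f. f\<rparr> X) (Id C X)"
    unfolding is_iso_def using i X by (auto simp: obj)
  fix Y f assume Y: "Y \<in> Obj C" and f: "f \<in> Hom C X Y"
  have "Comp C X Y Y (Id C Y) f = f" "Comp C X X Y f (Id C X) = f"
    using C X Y f unfolding is_category_def by blast+
  then show "Comp C (on_obj \<Phi> X) (on_obj \<Phi> Y) (on_obj \<lparr>on_obj = \<lambda>X. X, on_arr = \<lambda>X Y f. f\<rparr> Y) (Id C Y) (on_arr \<Phi> X Y f) =
      Comp C (on_obj \<Phi> X) (on_obj \<lparr>on_obj = \<lambda>X. X, on_arr = \<lambda>X Y f. f\<rparr> X) (on_obj \<lparr>on_obj = \<lambda>X. X, on_arr = \<lambda>X Y f. f\<rparr> Y)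
        (on_arr \<lparr>on_obj = \<lambda>X. X, on_arr = \<lambda>X Y f. f\<rparr> X Y f) (Id C X)"
    by (simp add: obj arr X Y f)
qed

theorem theorem1p3:
  shows "equivalent_categories (OF TYPE('v) TYPE('g::finite)) (MHS TYPE('v) TYPE('g))"
proof -
  let ?O = "OF TYPE('v) TYPE('g)" and ?M = "MHS TYPE('v) TYPE('g)"
  have cO: "is_category ?O" and cM: "is_category ?M"
    unfolding OF_def MHS_def by (rule full_subcategory_category[OF Fil_category])+
  have objO: "Y \<in> Obj ?O \<longleftrightarrow> is_filtered_space Y \<and> orthogonal_family Y" for Y
    by (simp add: OF_def full_subcategory_def Fil_def)
  have objM: "X \<in> Obj ?M \<longleftrightarrow> is_filtered_space X \<and> mixed_plectic X" for X
    by (simp add: MHS_def full_subcategory_def Fil_def)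
  have str: "Hom ?O = filtered_maps" "Hom ?M = filtered_maps"
    "Id ?O Y = (\<lambda>x\<in>carrier (space_of Y). x)" "Id ?M X = (\<lambda>x\<in>carrier (space_of X). x)"
    "Comp ?O Y Y' Y'' h f = compose (carrier (space_of Y)) h f"
    "Comp ?M X X' X'' h f = compose (carrier (space_of X)) h f" for X X' X'' Y Y' Y'' h f
    by (simp_all add: OF_def MHS_def full_subcategory_def Fil_def)
  have sp: "space_of (to_plectic Y) = space_of Y" "space_of (to_family X) = space_of X"
    for Y :: "('v, 'g, 'g) filtered_space" and X :: "('v, unit, 'g) filtered_space"
    by (simp_all add: to_plectic_def to_family_def)
  have to_M: "to_plectic Y \<in> Obj ?M \<and> to_family (to_plectic Y) = Y" if "Y \<in> Obj ?O" for Y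
  proof -
    interpret family_object Y
      using that unfolding objO by (simp add: family_object_def filtered_object_def family_object_axioms_def)
    have "to_family (to_plectic Y) = Y"
      by (rule filtered_space.equality) (simp_all add: to_family_def partial_weight_to_plectic fun_eq_iff, simp_all add: to_plectic_def)
    then show ?thesis unfolding objM using to_plectic_filtered to_plectic_mixed by blast
  qed
  have to_O: "to_family X \<in> Obj ?O \<and> to_plectic (to_family X) = X" if "X \<in> Obj ?M" for X
  proof -
    interpret mixed_plectic_object X
      using that unfolding objM
      by (simp add: mixed_plectic_object_def plectic_object_def filtered_object_def mixed_plectic_object_axioms_def)
    have "to_plectic (to_family X) = X"
      by (rule filtered_space.equality) (simp_all add: to_plectic_def total_weight_to_family fun_eq_iff, simp_all add: to_family_def)
    then show ?thesis unfolding objO using to_family_filtered to_family_orthogonal by blast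
  qed
  let ?\<Phi> = "\<lparr>on_obj = to_plectic, on_arr = \<lambda>_ _ f. f\<rparr> :: (('v, 'g, 'g) filtered_space, 'v \<Rightarrow> 'v, ('v, unit, 'g) filtered_space, 'v \<Rightarrow> 'v) func"
  let ?\<Psi> = "\<lparr>on_obj = to_family, on_arr = \<lambda>_ _ f. f\<rparr> :: (('v, unit, 'g) filtered_space, 'v \<Rightarrow> 'v, ('v, 'g, 'g) filtered_space, 'v \<Rightarrow> 'v) func"
  have "is_functor ?O ?M ?\<Phi>"
    unfolding is_functor_def by (auto simp: str sp to_M intro: to_plectic_map simp: objO)
  moreover have "is_functor ?M ?O ?\<Psi>"
    unfolding is_functor_def by (auto simp: str sp to_O intro: to_family_map simp: objM)
  moreover have "naturally_isomorphic ?O ?O (comp_func ?\<Psi> ?\<Phi>) id_func"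
    by (rule naturally_isomorphic_id[OF cO]) (simp_all add: comp_func_def to_M)
  moreover have "naturally_isomorphic ?M ?M (comp_func ?\<Phi> ?\<Psi>) id_func"
    by (rule naturally_isomorphic_id[OF cM]) (simp_all add: comp_func_def to_O)
  ultimately show ?thesis unfolding equivalent_categories_def using cO cM by blast
qed

end
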